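(* Let $f\in\mathcal T_n$ be a type function and let $i\in I_f$, $j\in O_f$. Then $i\not\rightsquigarrow_f j$ (there is no signalling from $i$ to $j$ in $f$) if and only if the rank $r_f(i,j)$ of the pair $i,j$ in $f$ is even.
   Context: Notation. $[n]=\{1,\dots,n\}$; $\theta=\theta_n\in\{0,1\}^n$ is the zero string. $\mathcal F_n=\{f:\{0,1\}^n\to\{0,1\} : f(\theta)=1\}$; $p_n\in\mathcal F_n$ is the indicator function of $\{\theta\}$, $1_n$ the constant function $1$, and $f^*=1-f+p_n$. For $T\subseteq[n]$, $p_T(s)=\prod_{i\in T}(1-s_i)$. For $f\in\mathcal F_m$, $g\in\mathcal F_n$, $(f\otimes g)(s^1s^2)=f(s^1)g(s^2)$, where $s^1\in\{0,1\}^m$, $s^2\in\{0,1\}^n$ and $s^1s^2$ is the concatenation. A permutation $\sigma$ of $[n]$ acts on strings by $\sigma(s)=s_{\sigma^{-1}(1)}\dots s_{\sigma^{-1}(n)}$. With $e^i_j=\delta_{i,j}$, put $I_f=\{i: f(e^i)=0\}$, $O_f=\{j: f(e^j)=1\}$. The sets $\mathcal T_n\subseteq\mathcal F_n$ ($n\ge1$) of type functions form the smallest family with $1_1\in\mathcal T_1$ closed under $f\mapsto f^*$, $f\mapsto f\circ\sigma$ (all permutations), and $(f,g)\mapsto f\otimes g$. Structure poset. Every $f\in\mathcal F_n$ has a unique expansion $f=\sum_{T\subseteq[n]}\hat f_T\,p_T$ with real coefficients. For $f\in\mathcal T_n$, the structure poset is $\mathcal P_f=\{T\subseteq[n]:\hat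 f_T\ne0\}$ ordered by inclusion. For $T\in\mathcal P_f$ the label set is $L_T=T\setminus\bigcup\{S\in\mathcal P_f: S\subsetneq T\}$. It is known that $\mathcal P_f$ is graded of even rank $r(f)$ (all maximal chains have length $r(f)$, where the length of a chain is its number of elements minus one), with rank function $\rho_f:\mathcal P_f\to\{0,\dots,r(f)\}$ (minimal elements have rank 0, rank increases by one along covers). For $i\in[n]$ let $\mathbb T_i^f=\{T\in\mathcal P_f: i\in L_T\}$. It is known that all elements of $\mathbb T_i^f$ have the same rank, denoted $r_f(i)$; if $\mathbb T_i^f=\emptyset$ (i.e. $i$ is not contained in any label set), $i$ is called a free output and $r_f(i):=r(f)+1$. Rank of a pair. For $i,j\in[n]$, $r_f(i,j)=\max\{\rho_f(S\wedge T): S\in\mathbb T_i^f,\ T\in\mathbb T_j^f\}$, where $S\wedge T$ is the meet in the poset $\mathcal P_f$ and only pairs whose meet exists are considered. If the set is empty, $r_f(i,j)=-1$, unless $i$ or $j$ is a free output, in which case $r_f(i,j)=\min\{r_f(i),r_f(j)\}$. The sets $T_1(f)$. Let $A_1,\dots,A_n$ be nontrivial elementary types, i.e. quantum systems with finite-dimensional complex Hilbert spaces $\mathcal H_{A_i}$ of dimension $\ge2$; $\mathcal H=\bigotimes_{i=1}^n\mathcal H_{A_i}$, $\mathcal H_T=\bigotimes_{i\in T}\mathcal H_{A_i}$ ($\mathcal H_\emptyset=\mathbb C$). Let $L_{i,0}=\mathbb R I_{\mathcal H_{A_i}}$, $L_{i,1}$ the traceless Hermitian operators on $\mathcal H_{A_i}$,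 $L_s=L_{1,s_1}\otimes\dots\otimes L_{n,s_n}$ for $s\in\{0,1\}^n$, and $S_f=\bigoplus_{s: f(s)=1}L_s$. Then $T_1(f)=\{C\in S_f: C\ge0,\ \mathrm{Tr}[C]=\prod_{i\in I_f}\dim\mathcal H_{A_i}\}$. Signalling. Write $I=I_f$, $O=O_f$. Let $\Phi:B(\mathcal H_I)\to B(\mathcal H_O)$ be a channel (completely positive trace preserving map) with Choi operator $C_\Phi=\sum_{k,l}|k\rangle\langle l|\otimes\Phi(|k\rangle\langle l|)$, regarded as an operator on $\mathcal H\cong\mathcal H_I\otimes\mathcal H_O$. We write $i\not\rightsquigarrow_\Phi j$ if $\mathrm{Tr}_{O\setminus\{j\}}[C_\Phi]=I_{\mathcal H_{A_i}}\otimes C_{\Phi_1}$ for some channel $\Phi_1:B(\mathcal H_{I\setminus\{i\}})\to B(\mathcal H_{A_j})$. Then $i\not\rightsquigarrow_f j$ means that $i\not\rightsquigarrow_\Phi j$ for every choice of nontrivial elementary types $A_1,\dots,A_n$ and every channel $\Phi$ with $C_\Phi\in T_1(f)$. *)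

theory Defs
  imports
    "HOL-Analysis.Analysis"
    "HOL-Combinatorics.Permutations"
    "HOL-Library.Function_Algebras"
begin

section \<open>Boolean functions and type functions\<close>

type_synonym str = "nat \<Rightarrow> nat"

definition strings :: "nat \<Rightarrow> str set" where
  "strings n = {1..n} \<rightarrow>\<^sub>E {0, 1}"

definition zero_str :: "nat \<Rightarrow> str" where
  "zero_str n = (\<lambda>k\<in>{1..n}. 0)"

definition unit_str :: "nat \<Rightarrow> nat \<Rightarrow> str" where
  "unit_str n i = (\<lambda>k\<in>{1..n}. if k = i then 1 else 0)"

definition perm_str :: "nat \<Rightarrow> (nat \<Rightarrow> nat) \<Rightarrow> str \<Rightarrow> str" where
  "perm_str n \<sigma> s = (\<lambda>k\<in>{1..n}. s (inv \<sigma> k))"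

text \<open>A function on strings is real valued, with values in \<open>{0, 1}\<close>, and is \<open>undefined\<close>
  off \<^term>\<open>strings n\<close>, so that equality of functions is equality on strings.\<close>

definition bool_funs :: "nat \<Rightarrow> (str \<Rightarrow> real) set" where
  "bool_funs n = {f \<in> strings n \<rightarrow>\<^sub>E {0, 1}. f (zero_str n) = 1}"

definition point_fun :: "nat \<Rightarrow> str \<Rightarrow> real" where
  "point_fun n = (\<lambda>s\<in>strings n. if s = zero_str n then 1 else 0)"

definition one_fun :: "nat \<Rightarrow> str \<Rightarrow> real" where
  "one_fun n = (\<lambda>s\<in>strings n. 1)"

definition dual_fun :: "nat \<Rightarrow> (str \<Rightarrow> real) \<Rightarrow> str \<Rightarrow> real" where
  "dual_fun n f = (\<lambda>s\<in>strings n. 1 - f s + point_fun n s)"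

definition perm_fun :: "nat \<Rightarrow> (nat \<Rightarrow> nat) \<Rightarrow> (str \<Rightarrow> real) \<Rightarrow> str \<Rightarrow> real" where
  "perm_fun n \<sigma> f = (\<lambda>s\<in>strings n. f (perm_str n \<sigma> s))"

definition tensor_fun :: "nat \<Rightarrow> nat \<Rightarrow> (str \<Rightarrow> real) \<Rightarrow> (str \<Rightarrow> real) \<Rightarrow> str \<Rightarrow> real" where
  "tensor_fun m n f g =
    (\<lambda>s\<in>strings (m + n). f (restrict s {1..m}) * g (\<lambda>k\<in>{1..n}. s (m + k)))"

inductive type_fun :: "nat \<Rightarrow> (str \<Rightarrow> real) \<Rightarrow> bool" where
  one: "type_fun 1 (one_fun 1)"
| dual: "type_fun n f \<Longrightarrow> type_fun n (dual_fun n f)"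
| perm: "type_fun n f \<Longrightarrow> \<sigma> permutes {1..n} \<Longrightarrow> type_fun n (perm_fun n \<sigma> f)"
| tensor: "type_fun m f \<Longrightarrow> type_fun n g \<Longrightarrow> type_fun (m + n) (tensor_fun m n f g)"

lemma bool_funsI:
  assumes "\<And>s. s \<in> strings n \<Longrightarrow> f s \<in> {0, 1}" "\<And>s. s \<notin> strings n \<Longrightarrow> f s = undefined"
    and "f (zero_str n) = 1"
  shows "f \<in> bool_funs n"
  unfolding bool_funs_def using assms by (intro CollectI conjI PiE_I)

lemma bool_funsD: "f \<in> bool_funs n \<Longrightarrow> s \<in> strings n \<Longrightarrow> f s = 0 \<or> f s = 1"
  "f \<in> bool_funs n \<Longrightarrow> f (zero_str n) = 1"
  unfolding bool_funs_def by (blast dest: PiE_mem, blast)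

lemma zero_str_in_strings [simp]: "zero_str n \<in> strings n"
  by (simp add: strings_def zero_str_def restrict_PiE_iff)

lemma type_fun_bool_funs: "type_fun n f \<Longrightarrow> f \<in> bool_funs n"
proof (induction rule: type_fun.induct)
  case one
  show ?case by (rule bool_funsI) (simp_all add: one_fun_def)
next
  case (dual n f)
  show ?case
    using bool_funsD[OF dual.IH]
    by (intro bool_funsI) (auto simp add: dual_fun_def point_fun_def)
next
  case (perm n f \<sigma>)
  have inv: "inv \<sigma> k \<in> {1..n}" if "k \<in> {1..n}" for k
    using permutes_in_image[OF permutes_inv[OF perm.hyps(2)]] that by blast
  have p: "perm_str n \<sigma> s \<in> strings n" if s: "s \<in> strings n" for s
    using PiE_mem[OF s[unfolded strings_def] inv]
    unfolding strings_def perm_str_def restrict_PiE_iff by blast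
  have pz: "perm_str n \<sigma> (zero_str n) = zero_str n"
    unfolding perm_str_def zero_str_def by (rule restrict_ext) (use inv in simp)
  show ?case
  proof (rule bool_funsI)
    fix s assume "s \<in> strings n"
    then show "perm_fun n \<sigma> f s \<in> {0, 1}"
      using bool_funsD(1)[OF perm.IH p] by (simp add: perm_fun_def)
  qed (simp_all add: perm_fun_def pz bool_funsD(2)[OF perm.IH])
next
  case (tensor m f n g)
  have mem: "s k \<in> {0, 1}" if "s \<in> strings (m + n)" "k \<in> {1..m + n}" for s k
    using that unfolding strings_def by (rule PiE_mem)
  have l: "restrict s {1..m} \<in> strings m" if "s \<in> strings (m + n)" for s
    unfolding strings_def restrict_PiE_iff using mem[OF that] by simp
  have r: "(\<lambda>k\<in>{1..n}. s (m + k)) \<in> strings n" if "s \<in> strings (m + n)" for s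
    unfolding strings_def restrict_PiE_iff using mem[OF that] by simp
  have z: "restrict (zero_str (m + n)) {1..m} = zero_str m"
    "(\<lambda>k\<in>{1..n}. zero_str (m + n) (m + k)) = zero_str n"
    unfolding zero_str_def by (rule restrict_ext, simp)+
  show ?case
  proof (rule bool_funsI)
    fix s assume s: "s \<in> strings (m + n)"
    show "tensor_fun m n f g s \<in> {0, 1}"
      using bool_funsD(1)[OF tensor.IH(1) l[OF s]] bool_funsD(1)[OF tensor.IH(2) r[OF s]] s
      by (auto simp only: tensor_fun_def restrict_apply' mult_zero_left mult_zero_right mult_1
        insert_iff empty_iff)
  qed (simp_all only: tensor_fun_def z restrict_apply' restrict_apply zero_str_in_strings if_False if_True
      bool_funsD(2)[OF tensor.IH(1)] bool_funsD(2)[OF tensor.IH(2)] mult_1)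
qed

definition inputs :: "nat \<Rightarrow> (str \<Rightarrow> real) \<Rightarrow> nat set" where
  "inputs n f = {i \<in> {1..n}. f (unit_str n i) = 0}"

definition outputs :: "nat \<Rightarrow> (str \<Rightarrow> real) \<Rightarrow> nat set" where
  "outputs n f = {j \<in> {1..n}. f (unit_str n j) = 1}"

section \<open>The structure poset and its ranks\<close>

definition mono_fun :: "nat set \<Rightarrow> str \<Rightarrow> real" where
  "mono_fun T s = (\<Prod>i\<in>T. 1 - real (s i))"

definition coeff :: "nat \<Rightarrow> (str \<Rightarrow> real) \<Rightarrow> nat set \<Rightarrow> real" where
  "coeff n f = (THE c. (\<forall>T. \<not> T \<subseteq> {1..n} \<longrightarrow> c T = 0) \<and>
     (\<forall>s\<in>strings n. f s = (\<Sum>T\<in>Pow {1..n}. c T * mono_fun T s)))"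

definition poset :: "nat \<Rightarrow> (str \<Rightarrow> real) \<Rightarrow> nat set set" where
  "poset n f = {T. T \<subseteq> {1..n} \<and> coeff n f T \<noteq> 0}"

definition label :: "nat set set \<Rightarrow> nat set \<Rightarrow> nat set" where
  "label P T = T - \<Union>{S \<in> P. S \<subset> T}"

definition label_nodes :: "nat set set \<Rightarrow> nat \<Rightarrow> nat set set" where
  "label_nodes P i = {T \<in> P. i \<in> label P T}"

definition covered_by :: "nat set set \<Rightarrow> nat set \<Rightarrow> nat set \<Rightarrow> bool" where
  "covered_by P S T \<longleftrightarrow> S \<in> P \<and> T \<in> P \<and> S \<subset> T \<and> \<not> (\<exists>U\<in>P. S \<subset> U \<and> U \<subset> T)"

text \<open>The three definite descriptions below denote the intended objects when the poset is graded
  and all nodes labelled by \<open>i\<close> have equal rank; both hold for posets of type functions.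
  The rank function is normalised to be \<open>0\<close> off \<open>P\<close> to make it unique.\<close>

definition rank_fun :: "nat set set \<Rightarrow> nat set \<Rightarrow> nat" where
  "rank_fun P = (THE \<rho>. (\<forall>T. T \<notin> P \<longrightarrow> \<rho> T = 0) \<and>
     (\<forall>T\<in>P. \<not> (\<exists>S\<in>P. S \<subset> T) \<longrightarrow> \<rho> T = 0) \<and>
     (\<forall>S T. covered_by P S T \<longrightarrow> \<rho> T = \<rho> S + 1))"

definition poset_rank :: "nat set set \<Rightarrow> nat" where
  "poset_rank P = (THE r. \<forall>C. subset.maxchain P C \<longrightarrow> card C = r + 1)"

definition free_output :: "nat set set \<Rightarrow> nat \<Rightarrow> bool" where
  "free_output P i \<longleftrightarrow> label_nodes P i = {}"

definition index_rank :: "nat set set \<Rightarrow> nat \<Rightarrow> nat" where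
  "index_rank P i =
    (if free_output P i then poset_rank P + 1
     else (THE r. \<forall>T\<in>label_nodes P i. rank_fun P T = r))"

definition is_meet :: "nat set set \<Rightarrow> nat set \<Rightarrow> nat set \<Rightarrow> nat set \<Rightarrow> bool" where
  "is_meet P S T M \<longleftrightarrow> M \<in> P \<and> M \<subseteq> S \<and> M \<subseteq> T \<and> (\<forall>U\<in>P. U \<subseteq> S \<and> U \<subseteq> T \<longrightarrow> U \<subseteq> M)"

definition meet_ranks :: "nat set set \<Rightarrow> nat \<Rightarrow> nat \<Rightarrow> nat set" where
  "meet_ranks P i j =
    {rank_fun P M | M S T. S \<in> label_nodes P i \<and> T \<in> label_nodes P j \<and> is_meet P S T M}"

definition pair_rank :: "nat \<Rightarrow> (str \<Rightarrow> real) \<Rightarrow> nat \<Rightarrow> nat \<Rightarrow> int" where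
  "pair_rank n f i j = (let P = poset n f in
     if meet_ranks P i j \<noteq> {} then int (Max (meet_ranks P i j))
     else if free_output P i \<or> free_output P j then int (min (index_rank P i) (index_rank P j))
     else -1)"

section \<open>Operators\<close>

text \<open>An operator on the Hilbert space with orthonormal basis indexed by a finite set \<open>J\<close> is given
  by its matrix entries, which are \<open>0\<close> outside \<open>J \<times> J\<close>.  Sums of operators are pointwise, by the
  instances of \<^theory>\<open>HOL-Library.Function_Algebras\<close>.\<close>

type_synonym 'a opr = "'a \<Rightarrow> 'a \<Rightarrow> complex"

definition operators :: "'a set \<Rightarrow> 'a opr set" where
  "operators J = {A. \<forall>x y. x \<notin> J \<or> y \<notin> J \<longrightarrow> A x y = 0}"

definition scale_opr :: "complex \<Rightarrow> 'a opr \<Rightarrow> 'a opr" where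
  "scale_opr c A = (\<lambda>x y. c * A x y)"

definition scale_opr_real :: "real \<Rightarrow> 'a opr \<Rightarrow> 'a opr" where
  "scale_opr_real r A = scale_opr (of_real r) A"

interpretation real_opr: vector_space scale_opr_real
  by unfold_locales
     (auto simp: scale_opr_real_def scale_opr_def plus_fun_def fun_eq_iff algebra_simps)

definition id_opr :: "'a set \<Rightarrow> 'a opr" where
  "id_opr J = (\<lambda>x y. if x \<in> J \<and> x = y then 1 else 0)"

definition unit_opr :: "'a \<Rightarrow> 'a \<Rightarrow> 'a opr" where
  "unit_opr k l = (\<lambda>x y. if x = k \<and> y = l then 1 else 0)"

definition trace_opr :: "'a set \<Rightarrow> 'a opr \<Rightarrow> complex" where
  "trace_opr J A = (\<Sum>x\<in>J. A x x)"

definition hermitian_opr :: "'a opr \<Rightarrow> bool" where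
  "hermitian_opr A \<longleftrightarrow> (\<forall>x y. A y x = cnj (A x y))"

definition positive_opr :: "'a set \<Rightarrow> 'a opr \<Rightarrow> bool" where
  "positive_opr J A \<longleftrightarrow> A \<in> operators J \<and>
     (\<forall>v. (\<Sum>x\<in>J. \<Sum>y\<in>J. cnj (v x) * A x y * v y) \<in> nonneg_Reals)"

section \<open>Composite systems\<close>

text \<open>\<^term>\<open>d i\<close> is the dimension of the \<open>i\<close>-th elementary system, and \<^term>\<open>basis d T\<close> indexes
  the product basis of the tensor product of the systems in \<open>T\<close>.  As the factors are indexed by
  their site, reordering of tensor factors is implicit.\<close>

type_synonym midx = "nat \<Rightarrow> nat"

definition basis :: "(nat \<Rightarrow> nat) \<Rightarrow> nat set \<Rightarrow> midx set" where
  "basis d T = (\<Pi>\<^sub>E i\<in>T. {..<d i})"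

definition tensor_opr :: "(nat \<Rightarrow> nat) \<Rightarrow> nat set \<Rightarrow> nat set \<Rightarrow> midx opr \<Rightarrow> midx opr \<Rightarrow> midx opr" where
  "tensor_opr d S T A B = (\<lambda>x y. if x \<in> basis d (S \<union> T) \<and> y \<in> basis d (S \<union> T)
     then A (restrict x S) (restrict y S) * B (restrict x T) (restrict y T) else 0)"

definition elem_tensor :: "nat \<Rightarrow> (nat \<Rightarrow> nat) \<Rightarrow> (nat \<Rightarrow> nat opr) \<Rightarrow> midx opr" where
  "elem_tensor n d A = (\<lambda>x y. if x \<in> basis d {1..n} \<and> y \<in> basis d {1..n}
     then (\<Prod>i\<in>{1..n}. A i (x i) (y i)) else 0)"

text \<open>The partial trace over the systems in \<open>T\<close> of an operator on \<open>S \<union> T\<close>, for disjoint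
  \<open>S\<close> and \<open>T\<close>.\<close>

definition ptrace_opr :: "(nat \<Rightarrow> nat) \<Rightarrow> nat set \<Rightarrow> nat set \<Rightarrow> midx opr \<Rightarrow> midx opr" where
  "ptrace_opr d S T A = (\<lambda>x y. if x \<in> basis d S \<and> y \<in> basis d S
     then (\<Sum>z\<in>basis d T. A (override_on x z T) (override_on y z T)) else 0)"

definition local_space :: "nat \<Rightarrow> nat \<Rightarrow> nat opr set" where
  "local_space k b = (if b = 0 then {scale_opr_real r (id_opr {..<k}) | r. True}
     else {A \<in> operators {..<k}. hermitian_opr A \<and> trace_opr {..<k} A = 0})"

definition string_space :: "nat \<Rightarrow> (nat \<Rightarrow> nat) \<Rightarrow> str \<Rightarrow> midx opr set" where
  "string_space n d s =
    real_opr.span {elem_tensor n d A | A. \<forall>i\<in>{1..n}. A i \<in> local_space (d i) (s i)}"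

definition fun_space :: "nat \<Rightarrow> (nat \<Rightarrow> nat) \<Rightarrow> (str \<Rightarrow> real) \<Rightarrow> midx opr set" where
  "fun_space n d f = {\<Sum>s\<in>{s \<in> strings n. f s = 1}. X s | X.
     \<forall>s\<in>strings n. f s = 1 \<longrightarrow> X s \<in> string_space n d s}"

definition T1 :: "nat \<Rightarrow> (nat \<Rightarrow> nat) \<Rightarrow> (str \<Rightarrow> real) \<Rightarrow> midx opr set" where
  "T1 n d f = {C \<in> fun_space n d f. positive_opr (basis d {1..n}) C \<and>
     trace_opr (basis d {1..n}) C = of_nat (\<Prod>i\<in>inputs n f. d i)}"

section \<open>Channels and signalling\<close>

text \<open>Amplification of \<open>\<Phi>\<close> by the identity on an ancilla, applied blockwise.\<close>

definition ampl :: "('a opr \<Rightarrow> 'b opr) \<Rightarrow> (nat \<times> 'a) opr \<Rightarrow> (nat \<times> 'b) opr" where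
  "ampl \<Phi> X = (\<lambda>(a, x) (b, y). \<Phi> (\<lambda>x' y'. X (a, x') (b, y')) x y)"

definition channel :: "(nat \<Rightarrow> nat) \<Rightarrow> nat set \<Rightarrow> nat set \<Rightarrow> (midx opr \<Rightarrow> midx opr) \<Rightarrow> bool" where
  "channel d S T \<Phi> \<longleftrightarrow>
     (\<forall>A\<in>operators (basis d S). \<Phi> A \<in> operators (basis d T)) \<and>
     (\<forall>A\<in>operators (basis d S). \<forall>B\<in>operators (basis d S). \<Phi> (A + B) = \<Phi> A + \<Phi> B) \<and>
     (\<forall>c. \<forall>A\<in>operators (basis d S). \<Phi> (scale_opr c A) = scale_opr c (\<Phi> A)) \<and>
     (\<forall>A\<in>operators (basis d S). trace_opr (basis d T) (\<Phi> A) = trace_opr (basis d S) A) \<and>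
     (\<forall>k X. positive_opr ({..<k} \<times> basis d S) X \<longrightarrow>
        positive_opr ({..<k} \<times> basis d T) (ampl \<Phi> X))"

definition choi :: "(nat \<Rightarrow> nat) \<Rightarrow> nat set \<Rightarrow> nat set \<Rightarrow> (midx opr \<Rightarrow> midx opr) \<Rightarrow> midx opr" where
  "choi d S T \<Phi> =
    (\<Sum>k\<in>basis d S. \<Sum>l\<in>basis d S. tensor_opr d S T (unit_opr k l) (\<Phi> (unit_opr k l)))"

definition no_signalling_channel ::
    "(nat \<Rightarrow> nat) \<Rightarrow> nat set \<Rightarrow> nat set \<Rightarrow> (midx opr \<Rightarrow> midx opr) \<Rightarrow> nat \<Rightarrow> nat \<Rightarrow> bool" where
  "no_signalling_channel d S T \<Phi> i j \<longleftrightarrow>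
     (\<exists>\<Psi>. channel d (S - {i}) {j} \<Psi> \<and>
        ptrace_opr d (S \<union> {j}) (T - {j}) (choi d S T \<Phi>) =
        tensor_opr d {i} ((S - {i}) \<union> {j}) (id_opr (basis d {i})) (choi d (S - {i}) {j} \<Psi>))"

definition no_signalling :: "nat \<Rightarrow> (str \<Rightarrow> real) \<Rightarrow> nat \<Rightarrow> nat \<Rightarrow> bool" where
  "no_signalling n f i j \<longleftrightarrow>
     (\<forall>d \<Phi>. (\<forall>k\<in>{1..n}. 2 \<le> d k) \<and>
        channel d (inputs n f) (outputs n f) \<Phi> \<and>
        choi d (inputs n f) (outputs n f) \<Phi> \<in> T1 n d f \<longrightarrow>
        no_signalling_channel d (inputs n f) (outputs n f) \<Phi> i j)"

end

theory Submission
  imports Defs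
begin

text \<open>
  Write \<open>F W\<close> for \<open>f\<close> evaluated at the indicator string of \<open>W\<close>. By induction over the construction
  of type functions, \<open>F\<close> is increasing in the outputs and decreasing in the inputs, and this reduces
  signalling from \<open>i\<close> to \<open>j\<close> to the single value \<open>F {i, j}\<close>: if it vanishes, no string in the support
  of \<open>f\<close> is zero on the outputs other than \<open>j\<close> and nonzero at \<open>i\<close>, so the partial trace of the Choi
  operator has an identity factor at \<open>i\<close>; otherwise the operator \<open>I + Z\<^sub>i Z\<^sub>j\<close> on qubits is, up to
  scaling, the Choi operator of a signalling classical channel.

  It remains to match \<open>F {i, j}\<close> with the parity of the rank of the pair. Adjoin \<open>{}\<close> and the
  full set as bottom and top to the structure poset, with ranks \<open>-1\<close> and \<open>r + 1\<close> where they are new.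
  Duality toggles the membership of these two elements only, so it leaves the extended poset fixed and
  shifts all ranks by one, flipping both parities. The tensor product multiplies the posets, and labels
  of one factor are paired with minimal elements of the other, so ranks of pairs within a factor persist
  and pairs across factors get an even rank.
\<close>

section \<open>Set families with labels and meets\<close>

text \<open>The extension absorbs the case distinctions in the rank of a pair. Labels without a
  common lower bound meet in an adjoined bottom, whose rank -1 is the default value; a free output
  is labelled at an adjoined top, and meeting with the top returns the other set, which is where the
  smaller of the two index ranks comes from. The rank of a pair is thus, in parity, the maximum of
  one nonempty set. The induction closes only if it also carries gradedness, constant label ranks,
  existence of meets of labels, even label rank for inputs and odd for outputs, and membership of
  the full set exactly when its rank is even. The same facts justify the definite descriptions
  behind the ranks. The obstacle is the tensor product: the extension of a product is not the
  product of the extensions. Meets are therefore computed in the unextended posets, and the sets of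
  ranks are compared after inserting -1 on both sides. Passing from strings over
  \<open>{1..n}\<close> to arbitrary finite carriers makes permutations and concatenation instances
  of relabelling.\<close>

definition ext_poset :: "nat set \<Rightarrow> nat set set \<Rightarrow> nat set set" where
  "ext_poset V P = P \<union> {{}, V}"

text \<open>Integer valued because an adjoined bottom has rank -1; the rank function is an argument
  so that the same notion serves a poset and its extension.\<close>

definition meet_values :: "nat set set \<Rightarrow> (nat set \<Rightarrow> int) \<Rightarrow> nat \<Rightarrow> nat \<Rightarrow> int set" where
  "meet_values Q \<tau> i j =
    {\<tau> M | M S T. S \<in> label_nodes Q i \<and> T \<in> label_nodes Q j \<and> is_meet Q S T M}"

definition weight :: "nat set set \<Rightarrow> (nat set \<Rightarrow> int) \<Rightarrow> nat set \<Rightarrow> int" where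
  "weight P \<tau> T = (if T \<in> P then if even (\<tau> T) then 1 else -1 else 0)"

text \<open>This is the rank of \<open>P\<close> itself: an adjoined top lies one level above the
  maximal members of \<open>P\<close>.\<close>

definition top_rank :: "nat set \<Rightarrow> nat set set \<Rightarrow> (nat set \<Rightarrow> int) \<Rightarrow> int" where
  "top_rank V P \<tau> = (if V \<in> P then \<tau> V else \<tau> V - 1)"

lemma mem_label_nodes:
  "T \<in> label_nodes P i \<longleftrightarrow> T \<in> P \<and> i \<in> T \<and> (\<forall>S\<in>P. i \<in> S \<longrightarrow> \<not> S \<subset> T)"
  unfolding label_nodes_def label_def by blast

lemma ex_minimal_below:
  assumes "T \<in> P" "finite T"
  shows "\<exists>S\<in>P. S \<subseteq> T \<and> (\<forall>R\<in>P. \<not> R \<subset> S)"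
proof -
  have "finite {S \<in> P. S \<subseteq> T}" "{S \<in> P. S \<subseteq> T} \<noteq> {}"
    using assms by (auto intro: finite_subset[of _ "Pow T"])
  from finite_has_minimal[OF this] obtain S where "S \<in> P" "S \<subseteq> T"
    "\<forall>R\<in>{S \<in> P. S \<subseteq> T}. R \<subseteq> S \<longrightarrow> S = R" by auto
  then show ?thesis by (intro bexI[of _ S]) auto
qed

lemma free_output_iff:
  assumes "\<And>T. T \<in> P \<Longrightarrow> finite T"
  shows "free_output P i \<longleftrightarrow> (\<forall>T\<in>P. i \<notin> T)"
proof
  assume free: "free_output P i"
  show "\<forall>T\<in>P. i \<notin> T"
  proof (intro ballI notI)
    fix T assume T: "T \<in> P" "i \<in> T"
    then have "\<exists>S\<in>{S\<in>P. i \<in> S}. S \<subseteq> T \<and> (\<forall>R\<in>{S\<in>P. i \<in> S}. \<not> R \<subset> S)"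
      using assms by (intro ex_minimal_below) auto
    then show False using free by (auto simp: free_output_def mem_label_nodes set_eq_iff)
  qed
next
  assume "\<forall>T\<in>P. i \<notin> T"
  then show "free_output P i" by (auto simp: free_output_def mem_label_nodes)
qed

lemma is_meet_commute: "is_meet Q S T M \<longleftrightarrow> is_meet Q T S M"
  unfolding is_meet_def by blast

lemma meet_values_commute: "meet_values Q \<tau> i j = meet_values Q \<tau> j i"
  unfolding meet_values_def using is_meet_commute by blast

lemma is_meet_subset: "S \<subseteq> T \<Longrightarrow> S \<in> Q \<Longrightarrow> is_meet Q S T M \<longleftrightarrow> M = S"
  unfolding is_meet_def by blast

lemma meet_valuesI:
  "S \<in> label_nodes Q i \<Longrightarrow> T \<in> label_nodes Q j \<Longrightarrow> is_meet Q S T M \<Longrightarrow> x = \<tau> M \<Longrightarrow>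
    x \<in> meet_values Q \<tau> i j"
  unfolding meet_values_def by blast

section \<open>Adjoining a bottom and a top to a set family\<close>

locale set_family =
  fixes V :: "nat set" and P :: "nat set set"
  assumes finite_V: "finite V" and V_nonempty: "V \<noteq> {}" and P_subset: "P \<subseteq> Pow V"
begin

abbreviation "Q \<equiv> ext_poset V P"

lemma Q_simps: "{} \<in> Q" "V \<in> Q" "P \<subseteq> Q" "Q \<subseteq> Pow V" "finite Q" "finite P"
  "T \<in> Q \<longleftrightarrow> T \<in> P \<or> T = {} \<or> T = V"
  using P_subset finite_V by (auto simp: ext_poset_def intro: finite_subset[of P "Pow V"])

lemma finite_elt: "T \<in> Q \<Longrightarrow> finite T"
  using Q_simps(4) finite_V finite_subset by blast

lemma psubset_V: "T \<in> Q \<Longrightarrow> \<not> V \<subset> T"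
  using Q_simps(4) by auto

text \<open>Neither \<open>{}\<close> nor \<open>V\<close> can lie strictly between two members, so
  intermediate elements need only be sought in \<open>P\<close>.\<close>

lemma covered_by_extI:
  assumes "S \<in> Q" "T \<in> Q" "S \<subset> T" "\<And>U. U \<in> P \<Longrightarrow> S \<subset> U \<Longrightarrow> U \<subset> T \<Longrightarrow> False"
  shows "covered_by Q S T"
  unfolding covered_by_def
proof (intro conjI notI)
  assume "\<exists>U\<in>Q. S \<subset> U \<and> U \<subset> T"
  then obtain U where U: "U \<in> Q" "S \<subset> U" "U \<subset> T" by blast
  then have "U \<noteq> {}" "U \<noteq> V" using psubset_V[OF assms(2)] by auto
  then have "U \<in> P" using U(1) Q_simps(7) by blast
  then show False using assms(4) U by blast
qed (use assms in auto)

lemma free_iff: "free_output P i \<longleftrightarrow> (\<forall>T\<in>P. i \<notin> T)"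
  using finite_elt Q_simps(3) by (intro free_output_iff) blast

lemma label_nodes_free: "i \<in> V \<Longrightarrow> free_output P i \<Longrightarrow> label_nodes Q i = {V}"
proof -
  assume i: "i \<in> V" and "free_output P i"
  then have "T \<in> Q \<and> i \<in> T \<longleftrightarrow> T = V" for T
    unfolding free_iff Q_simps(7) by blast
  then show ?thesis unfolding set_eq_iff mem_label_nodes by blast
qed

text \<open>Once a member of \<open>P\<close> contains \<open>i\<close>, an adjoined
  \<open>V\<close> is not minimal among the sets containing \<open>i\<close>, and \<open>{}\<close>
  contains no index.\<close>

lemma label_nodes_nonfree: "\<not> free_output P i \<Longrightarrow> label_nodes Q i = label_nodes P i"
proof -
  assume "\<not> free_output P i"
  then obtain T where T: "T \<in> P" "i \<in> T" by (auto simp: free_iff)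
  show ?thesis
  proof (intro set_eqI iffI)
    fix U assume U: "U \<in> label_nodes Q i"
    then have "\<not> T \<subset> U" using T Q_simps(3) by (auto simp: mem_label_nodes)
    then have "U = V \<Longrightarrow> T = V" using T P_subset by auto
    then have "U \<in> P" using U T Q_simps(7)[of U] by (auto simp: mem_label_nodes)
    then show "U \<in> label_nodes P i" using U Q_simps(3) by (simp add: mem_label_nodes subset_iff)
  next
    fix U assume U: "U \<in> label_nodes P i"
    then have "U \<in> Q" using Q_simps(3) by (auto simp: mem_label_nodes)
    have "\<not> S \<subset> U" if "S \<in> Q" "i \<in> S" for S
    proof
      assume "S \<subset> U"
      then have "S \<noteq> V" using psubset_V \<open>U \<in> Q\<close> by blast
      then have "S \<in> P" using that Q_simps(7)[of S] by blast
      then show False using U that(2) \<open>S \<subset> U\<close> unfolding mem_label_nodes by blast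
    qed
    then show "U \<in> label_nodes Q i" using U \<open>U \<in> Q\<close> by (simp add: mem_label_nodes)
  qed
qed

lemma label_nodes_nonempty: "i \<in> V \<Longrightarrow> label_nodes Q i \<noteq> {}"
  using label_nodes_free label_nodes_nonfree by (cases "free_output P i") (simp_all add: free_output_def)

lemma meet_values_subset: "meet_values Q \<tau> i j \<subseteq> \<tau> ` Q"
  by (auto simp: meet_values_def is_meet_def)

lemma finite_meet_values: "finite (meet_values Q \<tau> i j)"
  using meet_values_subset Q_simps by (meson finite_imageI finite_subset)

lemma label_nodes_subset: "T \<in> label_nodes Q i \<Longrightarrow> T \<in> Q \<and> T \<subseteq> V"
  using Q_simps(4) by (auto simp: mem_label_nodes)

lemma is_meet_V: "T \<in> Q \<Longrightarrow> is_meet Q T V M \<longleftrightarrow> M = T"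
  using Q_simps(4) by (intro is_meet_subset) auto

text \<open>The only node of a free output is the top, and meeting with the top changes nothing.
  This reproduces the convention that a free output yields the smaller index rank.\<close>

lemma meet_values_free_image:
  assumes "j \<in> V" "free_output P j"
  shows "meet_values Q \<tau> i j = \<tau> ` label_nodes Q i"
proof -
  have "is_meet Q S V M \<longleftrightarrow> M = S" if "S \<in> label_nodes Q i" for S M
    using is_meet_V label_nodes_subset[OF that] by blast
  then have "meet_values Q \<tau> i j = {\<tau> M | M. M \<in> label_nodes Q i}"
    unfolding meet_values_def label_nodes_free[OF assms] by auto
  then show ?thesis by auto
qed

text \<open>Greatest lower bounds in \<open>P\<close> survive the extension, and an adjoined bottom
  becomes the meet exactly where \<open>P\<close> has no common lower bound. Common lower bounds
  without a greatest one still give no meet.\<close>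

lemma is_meet_ext_iff:
  assumes "S \<in> P" "T \<in> P"
  shows "is_meet Q S T M \<longleftrightarrow>
    is_meet P S T M \<or> M = {} \<and> (\<forall>X\<in>P. \<not> (X \<subseteq> S \<and> X \<subseteq> T))"
proof -
  have V: "X \<in> P" if "X \<in> Q" "X \<subseteq> S" "X \<noteq> {}" for X
  proof (cases "X = V")
    case True
    then have "S = V" using that assms(1) P_subset by auto
    then show ?thesis using True assms by simp
  qed (use that Q_simps(7) in blast)
  show ?thesis
  proof
    assume "is_meet Q S T M"
    then have M: "M \<in> Q" "M \<subseteq> S" "M \<subseteq> T"
      and inf: "\<And>X. X \<in> P \<Longrightarrow> X \<subseteq> S \<Longrightarrow> X \<subseteq> T \<Longrightarrow> X \<subseteq> M"
      using Q_simps(3)[THEN subsetD] by (simp_all add: is_meet_def)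
    show "is_meet P S T M \<or> M = {} \<and> (\<forall>X\<in>P. \<not> (X \<subseteq> S \<and> X \<subseteq> T))"
    proof (cases "M \<in> P")
      case True
      then show ?thesis using M inf by (simp add: is_meet_def)
    next
      case False
      then have "M = {}" using V[of M] M by blast
      moreover have "\<not> (X \<subseteq> S \<and> X \<subseteq> T)" if "X \<in> P" for X
        using inf[OF that] \<open>M = {}\<close> False that by auto
      ultimately show ?thesis by simp
    qed
  next
    assume R: "is_meet P S T M \<or> M = {} \<and> (\<forall>X\<in>P. \<not> (X \<subseteq> S \<and> X \<subseteq> T))"
    have "X \<subseteq> M" if X: "X \<in> Q" "X \<subseteq> S" "X \<subseteq> T" for X
    proof (cases "X = {}")
      case False
      then have "X \<in> P" using V X by blast
      then show ?thesis using R X by (simp add: is_meet_def) blast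
    qed simp
    then show "is_meet Q S T M"
      using R Q_simps(1,3) by (auto simp only: is_meet_def)
  qed
qed

text \<open>The two sets can differ only by meets at an adjoined bottom, whose value is -1.
  Inserting -1 hides the difference and matches the default rank of a pair without meets.\<close>

lemma insert_meet_values:
  assumes "\<not> free_output P i" "\<not> free_output P j" "{} \<notin> P \<Longrightarrow> \<tau> {} = -1"
  shows "insert (-1) (meet_values Q \<tau> i j) = insert (-1) (meet_values P \<tau> i j)"
proof (intro equalityI subsetI)
  fix x assume "x \<in> insert (-1) (meet_values Q \<tau> i j)"
  then consider "x = -1" | M S T where "x = \<tau> M" "S \<in> label_nodes P i" "T \<in> label_nodes P j" "is_meet Q S T M"
    unfolding meet_values_def label_nodes_nonfree[OF assms(1)] label_nodes_nonfree[OF assms(2)] by blast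
  then show "x \<in> insert (-1) (meet_values P \<tau> i j)"
  proof cases
    case 2
    then have P: "S \<in> P" "T \<in> P" by (simp_all add: mem_label_nodes)
    show ?thesis
    proof (cases "is_meet P S T M")
      case False
      then have M: "M = {}" "\<forall>X\<in>P. \<not> (X \<subseteq> S \<and> X \<subseteq> T)"
        using 2(4) is_meet_ext_iff[OF P] by blast+
      then have "{} \<notin> P" by blast
      then show ?thesis using assms(3) M(1) 2(1) by simp
    qed (use 2 in \<open>unfold meet_values_def, blast\<close>)
  qed simp
next
  fix x assume "x \<in> insert (-1) (meet_values P \<tau> i j)"
  then consider "x = -1" | M S T where "x = \<tau> M" "S \<in> label_nodes P i" "T \<in> label_nodes P j" "is_meet P S T M"
    unfolding meet_values_def by blast
  then show "x \<in> insert (-1) (meet_values Q \<tau> i j)"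
  proof cases
    case 2
    then have P: "S \<in> P" "T \<in> P" by (simp_all add: mem_label_nodes)
    then have "is_meet Q S T M" using 2 is_meet_ext_iff[OF P] by blast
    then show ?thesis
      using 2 unfolding meet_values_def label_nodes_nonfree[OF assms(1)] label_nodes_nonfree[OF assms(2)]
      by blast
  qed simp
qed

end

text \<open>Here \<open>\<tau>\<close> extends the rank function of \<open>P\<close> to \<^term>\<open>ext_poset V P\<close>, and the coefficients of the
  expansion of \<open>F\<close> are the signs \<open>(-1)\<^sup>\<tau>\<close> on \<open>P\<close>. In the extended poset every index is a label: free
  outputs are those of an adjoined top.\<close>

locale type_poset =
  set_family V P for V P +
  fixes \<tau> :: "nat set \<Rightarrow> int" and F :: "nat set \<Rightarrow> bool"
  assumes F_empty: "F {}"
    and F_output: "\<And>i W. i \<in> V \<Longrightarrow> F {i} \<Longrightarrow> W \<subseteq> V \<Longrightarrow> F W \<Longrightarrow> F (insert i W)"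
    and F_input: "\<And>i W. i \<in> V \<Longrightarrow> \<not> F {i} \<Longrightarrow> W \<subseteq> V \<Longrightarrow> F (insert i W) \<Longrightarrow> F W"
    and expansion: "\<And>W. W \<subseteq> V \<Longrightarrow>
      (if F W then 1 else 0) = (\<Sum>T\<in>Pow V. if T \<inter> W = {} then weight P \<tau> T else 0)"
    and bottom: "\<tau> {} = (if {} \<in> P then 0 else -1)"
    and top: "V \<in> P \<longleftrightarrow> even (\<tau> V)"
    and cover: "\<And>S T. covered_by Q S T \<Longrightarrow> \<tau> T = \<tau> S + 1"
    and label_rank: "\<And>i S T. i \<in> V \<Longrightarrow> S \<in> label_nodes Q i \<Longrightarrow>
      T \<in> label_nodes Q i \<Longrightarrow> \<tau> S = \<tau> T"
    and label_parity: "\<And>i T. i \<in> V \<Longrightarrow> T \<in> label_nodes Q i \<Longrightarrow>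
      even (\<tau> T) \<longleftrightarrow> \<not> F {i}"
    and meets: "\<And>i j S T. i \<in> V \<Longrightarrow> j \<in> V \<Longrightarrow> S \<in> label_nodes Q i \<Longrightarrow>
      T \<in> label_nodes Q j \<Longrightarrow> \<exists>M. is_meet Q S T M"
    and pair_parity: "\<And>i j. i \<in> V \<Longrightarrow> j \<in> V \<Longrightarrow> \<not> F {i} \<Longrightarrow> F {j} \<Longrightarrow>
      F {i, j} \<longleftrightarrow> odd (Max (meet_values Q \<tau> i j))"
begin

abbreviation "r \<equiv> top_rank V P \<tau>"

lemma P_nonempty: "P \<noteq> {}"
proof
  assume "P = {}"
  then show False using expansion[of "{}"] F_empty by (simp add: weight_def)
qed

text \<open>Only covers are known to raise the rank. A minimal member above \<open>S\<close> and
  inside \<open>T\<close> covers \<open>S\<close>, and the remaining gap in cardinality has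
  shrunk.\<close>

lemma rank_strict_mono: "S \<in> Q \<Longrightarrow> T \<in> Q \<Longrightarrow> S \<subset> T \<Longrightarrow> \<tau> S < \<tau> T"
proof (induction "card T - card S" arbitrary: S rule: less_induct)
  case less
  have "\<exists>U\<in>{U\<in>Q. S \<subset> U}. U \<subseteq> T \<and> (\<forall>R\<in>{U\<in>Q. S \<subset> U}. \<not> R \<subset> U)"
    using less.prems finite_elt by (intro ex_minimal_below) auto
  then obtain U where "U \<in> {U\<in>Q. S \<subset> U}" "U \<subseteq> T" "\<forall>R\<in>{U\<in>Q. S \<subset> U}. \<not> R \<subset> U"
    by (elim bexE conjE) (rule that)
  then have U: "U \<in> Q" "S \<subset> U" "U \<subseteq> T" "\<forall>R\<in>Q. S \<subset> R \<longrightarrow> \<not> R \<subset> U" by simp_all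
  then have step: "\<tau> U = \<tau> S + 1"
    using less.prems by (intro cover) (auto simp: covered_by_def)
  show ?case
  proof (cases "U = T")
    case False
    have "card S < card U" using U finite_elt by (meson psubset_card_mono)
    moreover have "card U < card T"
      using U False finite_elt less.prems by (meson psubset_card_mono psubsetI)
    ultimately have "\<tau> U < \<tau> T" using U False less.prems by (intro less.hyps) auto
    then show ?thesis using step by simp
  qed (use step in simp)
qed

lemma empty_rank_le: "T \<in> Q \<Longrightarrow> \<tau> {} + (if T = {} then 0 else 1) \<le> \<tau> T"
  using rank_strict_mono[of "{}" T] Q_simps(1) by force

lemma rank_nonneg: "T \<in> P \<Longrightarrow> 0 \<le> \<tau> T"
  using empty_rank_le[of T] bottom Q_simps(7)[of T] by (auto split: if_splits)

lemma rank_ge: "T \<in> Q \<Longrightarrow> -1 \<le> \<tau> T"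
  using empty_rank_le[of T] bottom by (auto split: if_splits)

lemma rank_le: "T \<in> P \<Longrightarrow> \<tau> T \<le> r"
proof (cases "T = V")
  case False
  assume T: "T \<in> P"
  then have "T \<subset> V" using P_subset False by auto
  then have "\<tau> T < \<tau> V" using rank_strict_mono[of T V] Q_simps(2,3) T by auto
  then show ?thesis by (simp add: top_rank_def)
qed (simp add: top_rank_def)

lemma even_top_rank: "even r"
  using top by (auto simp: top_rank_def)

lemma top_rank_nonneg: "0 \<le> r"
  using P_nonempty rank_le rank_nonneg by force

text \<open>A nonempty minimal member covers the adjoined bottom, which has rank -1; dually, a
  maximal member other than \<open>V\<close> is covered by the adjoined top.\<close>

lemma minimal_rank: "T \<in> P \<Longrightarrow> \<forall>S\<in>P. \<not> S \<subset> T \<Longrightarrow> \<tau> T = 0"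
proof (cases "T = {}")
  case False
  assume T: "T \<in> P" "\<forall>S\<in>P. \<not> S \<subset> T"
  then have "{} \<notin> P" using False by auto
  have "{} \<subset> T" using False by auto
  then have "covered_by Q {} T"
    using T Q_simps(1,3) by (intro covered_by_extI) (simp_all add: subset_iff)
  then show ?thesis using cover[of "{}" T] bottom \<open>{} \<notin> P\<close> by simp
qed (use bottom in simp)

lemma maximal_rank: "T \<in> P \<Longrightarrow> \<forall>S\<in>P. \<not> T \<subset> S \<Longrightarrow> \<tau> T = r"
proof (cases "T = V")
  case False
  assume T: "T \<in> P" "\<forall>S\<in>P. \<not> T \<subset> S"
  then have V: "V \<notin> P" using False P_subset by auto
  have "T \<subset> V" using T P_subset False by auto
  then have "covered_by Q T V"
    using T(2) Q_simps(2,3) T(1) by (intro covered_by_extI) (simp_all add: subset_iff)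
  then show ?thesis using cover[of T V] V by (simp add: top_rank_def)
qed (auto simp: top_rank_def)

lemma cover_P: "covered_by P S T \<Longrightarrow> \<tau> T = \<tau> S + 1"
  using Q_simps(3) by (intro cover covered_by_extI) (auto simp only: covered_by_def subset_iff)

lemma free_top: "i \<in> V \<Longrightarrow> free_output P i \<Longrightarrow> V \<notin> P \<and> \<tau> V = r + 1"
  unfolding free_iff by (auto simp: top_rank_def)

text \<open>The only node of a free output is the adjoined top, whose rank \<open>r + 1\<close> is
  odd, whereas labels of inputs have even rank.\<close>

lemma nonfree_input: "i \<in> V \<Longrightarrow> \<not> F {i} \<Longrightarrow> \<not> free_output P i"
  using label_nodes_free[of i] label_parity[of i V] free_top[of i] even_top_rank by auto

lemma meet_values_nonempty: "i \<in> V \<Longrightarrow> j \<in> V \<Longrightarrow> meet_values Q \<tau> i j \<noteq> {}"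
proof -
  assume ij: "i \<in> V" "j \<in> V"
  then obtain S T where ST: "S \<in> label_nodes Q i" "T \<in> label_nodes Q j"
    using label_nodes_nonempty by blast
  obtain M where "is_meet Q S T M" using meets[OF ij ST] by blast
  then have "\<tau> M \<in> meet_values Q \<tau> i j" using ST unfolding meet_values_def by blast
  then show ?thesis by blast
qed

text \<open>The poset extended by bottom and top is unchanged under duality, while ranks shift by one.\<close>

lemma dual_type_poset:
  "type_poset V (P - {{}, V} \<union> ({{}, V} - P)) (\<lambda>T. \<tau> T + (if {} \<in> P then -1 else 1))
    (\<lambda>W. W = {} \<or> \<not> F W)" (is "type_poset V ?P ?\<tau> ?F")
proof -
  have Q: "ext_poset V ?P = Q" by (auto simp: ext_poset_def)
  \<comment> \<open>The bottom fixes the direction of the shift: a member \<open>{}\<close> of rank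
    0 is removed and must drop to -1, a missing one becomes a member and must rise to 0.\<close>
  define \<delta> :: int where "\<delta> = (if {} \<in> P then -1 else 1)"
  have odd: "odd \<delta>" by (simp add: \<delta>_def)
  have \<tau>: "?\<tau> T = \<tau> T + \<delta>" for T by (simp add: \<delta>_def)
  show ?thesis
  proof (unfold_locales, unfold Q \<tau>)
    show "finite V" "V \<noteq> {}" "{} = {} \<or> \<not> F {}" using finite_V V_nonempty by auto
    show "?P \<subseteq> Pow V" using P_subset by auto
  next
    fix i W assume "i \<in> V" "W \<subseteq> V" "{i} = {} \<or> \<not> F {i}" "W = {} \<or> \<not> F W"
    then show "insert i W = {} \<or> \<not> F (insert i W)" using F_input[of i W] by auto
  next
    fix i W assume "i \<in> V" "W \<subseteq> V" "\<not> ({i} = {} \<or> \<not> F {i})" "insert i W = {} \<or> \<not> F (insert i W)"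
    then show "W = {} \<or> \<not> F W" using F_output[of i W] by auto
  next
    fix W assume W: "W \<subseteq> V"
    \<comment> \<open>The dual is \<open>1 - f + p_n\<close>: coefficients change sign, the constant
      1 adds one at \<open>{}\<close> and the indicator of the zero string adds one at
      \<open>V\<close>.\<close>
    have w: "weight ?P (\<lambda>T. \<tau> T + \<delta>) T =
        - weight P \<tau> T + (if T = {} then 1 else 0) + (if T = V then 1 else 0)" if "T \<in> Pow V" for T
      using top bottom odd V_nonempty that by (auto simp: weight_def)
    have "(\<Sum>T\<in>Pow V. if T \<inter> W = {} then weight ?P (\<lambda>T. \<tau> T + \<delta>) T else 0) =
      (\<Sum>T\<in>Pow V. - (if T \<inter> W = {} then weight P \<tau> T else 0) +
        ((if T = {} then 1 else 0) + (if T = V then if V \<inter> W = {} then 1 else 0 else 0)))"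
      by (rule sum.cong) (auto simp: w)
    also have "\<dots> = - (if F W then 1 else 0) + (1 + (if V \<inter> W = {} then 1 else 0))"
      unfolding sum.distrib sum_negf expansion[OF W] using finite_V by simp
    also have "\<dots> = (if W = {} \<or> \<not> F W then 1 else 0)"
      using W F_empty by (auto simp: Int_absorb1)
    finally show "(if W = {} \<or> \<not> F W then 1 else 0) =
      (\<Sum>T\<in>Pow V. if T \<inter> W = {} then weight ?P (\<lambda>T. \<tau> T + \<delta>) T else 0)" by simp
  next
    show "\<tau> {} + \<delta> = (if {} \<in> ?P then 0 else -1)"
      using bottom V_nonempty by (auto simp: \<delta>_def)
    show "V \<in> ?P \<longleftrightarrow> even (\<tau> V + \<delta>)" using top odd by auto
  next
    fix S T assume "covered_by Q S T"
    then show "\<tau> T + \<delta> = \<tau> S + \<delta> + 1" using cover[of S T] by simp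
  next
    fix i S T assume "i \<in> V" "S \<in> label_nodes Q i" "T \<in> label_nodes Q i"
    then show "\<tau> S + \<delta> = \<tau> T + \<delta>" using label_rank[of i S T] by simp
  next
    fix i T assume "i \<in> V" "T \<in> label_nodes Q i"
    then show "even (\<tau> T + \<delta>) = (\<not> ({i} = {} \<or> \<not> F {i}))" using label_parity[of i T] odd by simp
  next
    fix i j S T
    assume "i \<in> V" "j \<in> V" "S \<in> label_nodes Q i" "T \<in> label_nodes Q j"
    then show "\<exists>M. is_meet Q S T M" using meets by blast
  next
    fix i j assume ij: "i \<in> V" "j \<in> V" "\<not> ({i} = {} \<or> \<not> F {i})" "{j} = {} \<or> \<not> F {j}"
    \<comment> \<open>Inputs and outputs trade places under duality, so the parity statement of the
      original is used for the pair \<open>j, i\<close>.\<close>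
    have "meet_values Q (\<lambda>T. \<tau> T + \<delta>) i j = (\<lambda>x. x + \<delta>) ` meet_values Q \<tau> j i"
      unfolding meet_values_commute[of Q \<tau> j i] by (auto simp: meet_values_def)
    moreover have "Max ((\<lambda>x. x + \<delta>) ` meet_values Q \<tau> j i) = Max (meet_values Q \<tau> j i) + \<delta>"
      using finite_meet_values meet_values_nonempty ij
      by (intro mono_Max_commute[symmetric]) (auto simp: mono_def)
    ultimately have "odd (Max (meet_values Q (\<lambda>T. \<tau> T + \<delta>) i j)) \<longleftrightarrow>
        even (Max (meet_values Q \<tau> j i))"
      using odd by simp
    also have "\<dots> \<longleftrightarrow> \<not> F {i, j}"
      using pair_parity[of j i] ij by (simp add: insert_commute)
    finally show "({i, j} = {} \<or> \<not> F {i, j}) \<longleftrightarrow>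
      odd (Max (meet_values Q (\<lambda>T. \<tau> T + \<delta>) i j))" by simp
  qed
qed

end

text \<open>The constant function is the monomial of the empty set. The poset is one point, and
  \<open>a\<close> is a free output labelled at an adjoined top of rank 1.\<close>

lemma singleton_type_poset: "type_poset {a} {{}} (\<lambda>T. if T = {} then 0 else 1) (\<lambda>W. True)"
proof -
  have Q: "ext_poset {a} {{}} = {{}, {a}}" by (auto simp: ext_poset_def)
  have L: "label_nodes {{}, {a}} i = (if i = a then {{a}} else {})" for i
    by (auto simp: mem_label_nodes)
  show ?thesis
  proof (unfold_locales, unfold Q)
    fix W assume "W \<subseteq> {a}"
    then show "(if True then 1 else 0) = (\<Sum>T\<in>Pow {a}. if T \<inter> W = {} then weight {{}} (\<lambda>T. if T = {} then 0 else 1) T else 0)"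
      by (auto simp: weight_def Pow_insert)
  next
    fix i j S T
    assume "i \<in> {a}" "j \<in> {a}" "S \<in> label_nodes {{}, {a}} i" "T \<in> label_nodes {{}, {a}} j"
    then show "\<exists>M. is_meet {{}, {a}} S T M" by (intro exI[of _ "{a}"]) (auto simp: L is_meet_def)
  qed (auto simp: L covered_by_def split: if_splits)
qed

section \<open>Tensor products\<close>

definition prod_poset :: "nat set set \<Rightarrow> nat set set \<Rightarrow> nat set set" where
  "prod_poset P1 P2 = {S \<union> T | S T. S \<in> P1 \<and> T \<in> P2}"

text \<open>Ranks add on the product, where coefficients multiply. The adjoined elements need
  separate values: one below the minimal rank 0, and one above the total rank.\<close>

definition prod_rank where
  "prod_rank V1 P1 \<tau>1 V2 P2 \<tau>2 U =
    (if U \<in> prod_poset P1 P2 then \<tau>1 (U \<inter> V1) + \<tau>2 (U \<inter> V2)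
     else if U = {} then -1 else top_rank V1 P1 \<tau>1 + top_rank V2 P2 \<tau>2 + 1 :: int)"

lemma prod_poset_commute: "prod_poset P1 P2 = prod_poset P2 P1"
  unfolding prod_poset_def by (metis Un_commute)

lemma prod_rank_commute: "prod_rank V1 P1 \<tau>1 V2 P2 \<tau>2 = prod_rank V2 P2 \<tau>2 V1 P1 \<tau>1"
  by (rule ext) (simp add: prod_rank_def prod_poset_commute add.commute)

locale type_poset_pair = A: type_poset V1 P1 \<tau>1 F1 + B: type_poset V2 P2 \<tau>2 F2
  for V1 P1 \<tau>1 F1 V2 P2 \<tau>2 F2 +
  assumes disjoint: "V1 \<inter> V2 = {}"
begin

text \<open>Facts about an index of the first factor are proved once and carried over to the second
  factor by this symmetry.\<close>

lemma swap: "type_poset_pair V2 P2 \<tau>2 F2 V1 P1 \<tau>1 F1"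
  using disjoint by unfold_locales auto

definition "V = V1 \<union> V2"
definition "P = prod_poset P1 P2"
definition "\<tau> = prod_rank V1 P1 \<tau>1 V2 P2 \<tau>2"
definition "F W \<longleftrightarrow> F1 (W \<inter> V1) \<and> F2 (W \<inter> V2)"

lemma swap_V: "type_poset_pair.V V2 V1 = V"
  and swap_P: "type_poset_pair.P P2 P1 = P"
  and swap_\<tau>: "type_poset_pair.\<tau> V2 P2 \<tau>2 V1 P1 \<tau>1 = \<tau>"
  and swap_F: "type_poset_pair.F V2 F2 V1 F1 = F"
  by (auto simp: fun_eq_iff V_def P_def \<tau>_def F_def type_poset_pair.V_def[OF swap]
    type_poset_pair.P_def[OF swap] type_poset_pair.\<tau>_def[OF swap] type_poset_pair.F_def[OF swap]
    prod_poset_commute[of P2 P1] prod_rank_commute[of V2 P2 \<tau>2 V1 P1 \<tau>1])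

lemmas swaps = swap_V swap_P swap_\<tau> swap_F

lemma mem_P: "U \<in> P \<longleftrightarrow> U \<inter> V1 \<in> P1 \<and> U \<inter> V2 \<in> P2 \<and> U \<subseteq> V"
proof
  assume "U \<in> P"
  then obtain S T where ST: "U = S \<union> T" "S \<in> P1" "T \<in> P2" by (auto simp: P_def prod_poset_def)
  then have "S \<subseteq> V1" "T \<subseteq> V2" using A.P_subset B.P_subset by auto
  then have "U \<inter> V1 = S" "U \<inter> V2 = T" using disjoint ST(1) by auto
  then show "U \<inter> V1 \<in> P1 \<and> U \<inter> V2 \<in> P2 \<and> U \<subseteq> V"
    using ST \<open>S \<subseteq> V1\<close> \<open>T \<subseteq> V2\<close> by (auto simp: V_def)
next
  assume U: "U \<inter> V1 \<in> P1 \<and> U \<inter> V2 \<in> P2 \<and> U \<subseteq> V"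
  then have "U = (U \<inter> V1) \<union> (U \<inter> V2)" by (auto simp: V_def)
  then show "U \<in> P" using U unfolding P_def prod_poset_def by blast
qed

lemma rank_P: "U \<in> P \<Longrightarrow> \<tau> U = \<tau>1 (U \<inter> V1) + \<tau>2 (U \<inter> V2)"
  by (simp add: \<tau>_def prod_rank_def P_def)

sublocale set_family V P
proof
  show "finite V" "V \<noteq> {}" using A.finite_V B.finite_V A.V_nonempty by (simp_all add: V_def)
  show "P \<subseteq> Pow V" using mem_P by blast
qed

lemma Int_simps: "S \<subseteq> V1 \<Longrightarrow> T \<subseteq> V2 \<Longrightarrow> (S \<union> T) \<inter> V1 = S"
  "S \<subseteq> V1 \<Longrightarrow> T \<subseteq> V2 \<Longrightarrow> (S \<union> T) \<inter> V2 = T"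
  using disjoint by auto

lemma Un_mem_P: "S \<in> P1 \<Longrightarrow> T \<in> P2 \<Longrightarrow> S \<union> T \<in> P"
  by (auto simp: P_def prod_poset_def)

lemma elt_subset: "S \<in> P1 \<Longrightarrow> S \<subseteq> V1" "T \<in> P2 \<Longrightarrow> T \<subseteq> V2"
  using A.P_subset B.P_subset by auto

lemma subset_iff_parts: "U \<subseteq> V \<Longrightarrow> U \<subseteq> W \<longleftrightarrow> U \<inter> V1 \<subseteq> W \<inter> V1 \<and> U \<inter> V2 \<subseteq> W \<inter> V2"
  unfolding V_def by auto

lemma eq_iff_parts: "U \<subseteq> V \<Longrightarrow> W \<subseteq> V \<Longrightarrow> U = W \<longleftrightarrow> U \<inter> V1 = W \<inter> V1 \<and> U \<inter> V2 = W \<inter> V2"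
  unfolding V_def by auto

lemma P_subsetD: "U \<in> P \<Longrightarrow> U \<subseteq> V"
  using P_subset by auto

section \<open>Minimal members, maximal members and covers of a product\<close>

lemma replace_part:
  assumes "U \<in> P" "S \<in> P1"
  shows "S \<union> (U \<inter> V2) \<in> P" "(S \<union> (U \<inter> V2)) \<inter> V1 = S" "(S \<union> (U \<inter> V2)) \<inter> V2 = U \<inter> V2"
  using assms Un_mem_P mem_P Int_simps[OF elt_subset(1)[OF assms(2)], of "U \<inter> V2"] by auto

lemma minimal_part:
  assumes "U \<in> P" "\<forall>S\<in>P. \<not> S \<subset> U"
  shows "\<forall>S\<in>P1. \<not> S \<subset> U \<inter> V1"
proof (intro ballI notI)
  fix S assume S: "S \<in> P1" "S \<subset> U \<inter> V1"
  note R = replace_part[OF assms(1) S(1)]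
  have "S \<union> (U \<inter> V2) \<subseteq> U" using S(2) by auto
  moreover have "S \<union> (U \<inter> V2) \<noteq> U" using R(2) S(2) by auto
  ultimately show False using assms(2) R(1) by auto
qed

lemma maximal_part:
  assumes "U \<in> P" "\<forall>S\<in>P. \<not> U \<subset> S"
  shows "\<forall>S\<in>P1. \<not> U \<inter> V1 \<subset> S"
proof (intro ballI notI)
  fix S assume S: "S \<in> P1" "U \<inter> V1 \<subset> S"
  note R = replace_part[OF assms(1) S(1)]
  have "U \<subseteq> S \<union> (U \<inter> V2)" using S(2) P_subsetD[OF assms(1)] by (auto simp: V_def)
  moreover have "S \<union> (U \<inter> V2) \<noteq> U" using R(2) S(2) by auto
  ultimately show False using assms(2) R(1) by auto
qed

text \<open>A cover moves in one factor only: raising just the first component of \<open>U\<close>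
  gives an element strictly above \<open>U\<close> and inside \<open>W\<close>, hence
  \<open>W\<close> itself.\<close>

lemma cover_part:
  assumes "covered_by P U W" "U \<inter> V1 \<noteq> W \<inter> V1"
  shows "U \<inter> V2 = W \<inter> V2" "covered_by P1 (U \<inter> V1) (W \<inter> V1)"
proof -
  have UW: "U \<in> P" "W \<in> P" "U \<subset> W" and no: "\<And>X. X \<in> P \<Longrightarrow> U \<subset> X \<Longrightarrow> X \<subset> W \<Longrightarrow> False"
    using assms(1) unfolding covered_by_def by blast+
  have sub: "U \<inter> V1 \<subset> W \<inter> V1" "U \<inter> V2 \<subseteq> W \<inter> V2" using UW(3) assms(2) by auto
  have U_eq: "U = (U \<inter> V1) \<union> (U \<inter> V2)" using P_subsetD[OF UW(1)] by (auto simp: V_def)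
  have mid: False if S: "S \<in> P1" "U \<inter> V1 \<subset> S" "S \<subseteq> W \<inter> V1" "S \<union> (U \<inter> V2) \<noteq> W" for S
  proof (rule no)
    note R = replace_part[OF UW(1) S(1)]
    show "S \<union> (U \<inter> V2) \<in> P" by (rule R)
    have "U \<subseteq> S \<union> (U \<inter> V2)" using U_eq S(2) by blast
    moreover have "U \<noteq> S \<union> (U \<inter> V2)" using R(2) S(2) by (metis psubset_eq)
    ultimately show "U \<subset> S \<union> (U \<inter> V2)" by (rule psubsetI)
    have "S \<union> (U \<inter> V2) \<subseteq> W" using S(3) sub(2) by blast
    then show "S \<union> (U \<inter> V2) \<subset> W" using S(4) by (rule psubsetI)
  qed
  have W1: "W \<inter> V1 \<in> P1" using UW(2) mem_P by blast
  show eq: "U \<inter> V2 = W \<inter> V2"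
    using mid[OF W1 sub(1) order_refl] replace_part(3)[OF UW(1) W1] by metis
  show "covered_by P1 (U \<inter> V1) (W \<inter> V1)"
    unfolding covered_by_def
  proof (intro conjI notI)
    assume "\<exists>S\<in>P1. U \<inter> V1 \<subset> S \<and> S \<subset> W \<inter> V1"
    then obtain S where S: "S \<in> P1" "U \<inter> V1 \<subset> S" "S \<subset> W \<inter> V1" by blast
    have "S \<union> (U \<inter> V2) \<noteq> W" using replace_part(2)[OF UW(1) S(1)] S(3) by (metis psubset_eq)
    then show False using mid S by (metis psubset_eq)
  qed (use UW sub mem_P in blast)+
qed

lemmas minimal_parts = minimal_part type_poset_pair.minimal_part[OF swap, unfolded swaps]
lemmas maximal_parts = maximal_part type_poset_pair.maximal_part[OF swap, unfolded swaps]
lemmas cover_parts = cover_part type_poset_pair.cover_part[OF swap, unfolded swaps]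

lemma minimal_rank_prod: "U \<in> P \<Longrightarrow> \<forall>S\<in>P. \<not> S \<subset> U \<Longrightarrow> \<tau> U = 0"
  using A.minimal_rank[of "U \<inter> V1"] B.minimal_rank[of "U \<inter> V2"] minimal_parts[of U] mem_P[of U]
    rank_P by simp

abbreviation "r \<equiv> A.r + B.r"

lemma maximal_rank_prod: "U \<in> P \<Longrightarrow> \<forall>S\<in>P. \<not> U \<subset> S \<Longrightarrow> \<tau> U = r"
  using A.maximal_rank[of "U \<inter> V1"] B.maximal_rank[of "U \<inter> V2"] maximal_parts[of U] mem_P[of U]
    rank_P by simp

lemma cover_rank_prod:
  assumes "covered_by P U W"
  shows "\<tau> W = \<tau> U + 1"
proof -
  have UW: "U \<in> P" "W \<in> P" "U \<noteq> W" using assms by (auto simp: covered_by_def)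
  show ?thesis
  proof (cases "U \<inter> V1 = W \<inter> V1")
    case False
    then show ?thesis
      using cover_parts(1,2)[OF assms False] A.cover_P UW rank_P by simp
  next
    case True
    then have False: "U \<inter> V2 \<noteq> W \<inter> V2" using UW eq_iff_parts P_subsetD by blast
    then show ?thesis
      using cover_parts(3,4)[OF assms False] B.cover_P UW rank_P by simp
  qed
qed

lemma nonmember_rank: "{} \<notin> P \<Longrightarrow> \<tau> {} = -1" "V \<notin> P \<Longrightarrow> \<tau> V = r + 1"
  using V_nonempty by (simp_all add: \<tau>_def prod_rank_def P_def)

lemma P_nonempty_prod: "P \<noteq> {}"
  using A.P_nonempty B.P_nonempty by (auto simp: P_def prod_poset_def)

text \<open>Besides covers within the product, an adjoined bottom is covered only by minimal
  members, of rank 0, and an adjoined top covers only maximal ones, of rank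
  \<open>r\<close>.\<close>

lemma cover_prod:
  assumes "covered_by Q U W"
  shows "\<tau> W = \<tau> U + 1"
proof -
  have UW: "U \<in> Q" "W \<in> Q" "U \<subset> W" and no: "\<And>X. X \<in> Q \<Longrightarrow> U \<subset> X \<Longrightarrow> X \<subset> W \<Longrightarrow> False"
    using assms unfolding covered_by_def by blast+
  have U: "U \<in> P \<or> U = {} \<and> {} \<notin> P"
    using UW(1) psubset_V[OF UW(2)] UW(3) Q_simps(7)[of U] by blast
  have W: "W \<in> P \<or> W = V \<and> V \<notin> P"
    using UW(2,3) Q_simps(7)[of W] by blast
  show ?thesis
  proof (cases "U \<in> P"; cases "W \<in> P")
    assume "U \<in> P" "W \<in> P"
    then have "covered_by P U W"
      using UW(3) no Q_simps(3) unfolding covered_by_def by blast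
    then show ?thesis by (rule cover_rank_prod)
  next
    assume P: "U \<in> P" "W \<notin> P"
    then have W: "W = V" "V \<notin> P" using W by auto
    have "\<not> U \<subset> X" if X: "X \<in> P" for X
    proof
      assume "U \<subset> X"
      moreover have "X \<subset> V" using X P_subsetD[OF X] W(2) by (metis psubsetI)
      ultimately show False using no[of X] X Q_simps(3) W(1) by blast
    qed
    then have "\<tau> U = r" using maximal_rank_prod P(1) by blast
    then show ?thesis using nonmember_rank(2)[OF W(2)] W(1) by simp
  next
    assume P: "U \<notin> P" "W \<in> P"
    then have U: "U = {}" "{} \<notin> P" using U by auto
    have "\<not> X \<subset> W" if X: "X \<in> P" for X
    proof
      assume "X \<subset> W"
      moreover have "{} \<subset> X" using X U(2) by (metis empty_subsetI psubsetI)
      ultimately show False using no[of X] X Q_simps(3) U(1) by blast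
    qed
    then have "\<tau> W = 0" using minimal_rank_prod P(2) by blast
    then show ?thesis using nonmember_rank(1)[OF U(2)] U(1) by simp
  next
    assume P: "U \<notin> P" "W \<notin> P"
    then have UW: "U = {}" "W = V" using U W by auto
    \<comment> \<open>The product is nonempty, so something lies strictly between an adjoined bottom
      and an adjoined top and this case cannot occur.\<close>
    obtain X where X: "X \<in> P" using P_nonempty_prod by blast
    then have "{} \<subset> X" "X \<subset> V" using P UW P_subsetD[OF X] by (metis empty_subsetI psubsetI)+
    then show ?thesis using no[of X] X Q_simps(3) UW by blast
  qed
qed

lemma top_prod: "V \<in> P \<longleftrightarrow> even (\<tau> V)"
proof (cases "V \<in> P")
  case True
  have "V \<inter> V1 = V1" "V \<inter> V2 = V2" by (auto simp: V_def)
  then show ?thesis using True rank_P[OF True] mem_P[of V] A.top B.top by auto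
next
  case False
  then show ?thesis using nonmember_rank(2)[OF False] A.even_top_rank B.even_top_rank by simp
qed

lemma bottom_prod: "\<tau> {} = (if {} \<in> P then 0 else -1)"
  using nonmember_rank(1) minimal_rank_prod[of "{}"] by simp

section \<open>Labels and meets in a product\<close>

lemma free_part: "i \<in> V1 \<Longrightarrow> free_output P i \<longleftrightarrow> free_output P1 i"
proof -
  assume i: "i \<in> V1"
  show ?thesis unfolding free_iff A.free_iff
  proof (intro iffI ballI notI)
    fix S assume free: "\<forall>U\<in>P. i \<notin> U" and S: "S \<in> P1" "i \<in> S"
    obtain T where "T \<in> P2" using B.P_nonempty by blast
    then show False using Un_mem_P[OF S(1)] free S(2) by blast
  next
    fix U assume "\<forall>S\<in>P1. i \<notin> S" "U \<in> P" "i \<in> U"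
    then show False using mem_P[of U] i by blast
  qed
qed

text \<open>Containing \<open>i\<close> constrains only the first component. The second component
  must therefore be minimal outright, of rank 0, so a label keeps the rank it has in its own
  factor.\<close>

lemma label_nodes_part:
  assumes i: "i \<in> V1"
  shows "U \<in> label_nodes P i \<longleftrightarrow>
    U \<in> P \<and> U \<inter> V1 \<in> label_nodes P1 i \<and> (\<forall>T\<in>P2. \<not> T \<subset> U \<inter> V2)"
proof
  assume "U \<in> label_nodes P i"
  then have U: "U \<in> P" "i \<in> U" and min: "\<And>X. X \<in> P \<Longrightarrow> i \<in> X \<Longrightarrow> X \<subset> U \<Longrightarrow> False"
    unfolding mem_label_nodes by blast+
  have parts: "U \<inter> V1 \<in> P1" "U \<inter> V2 \<in> P2" using U mem_P by blast+
  have U_eq: "U = (U \<inter> V1) \<union> (U \<inter> V2)" using P_subsetD[OF U(1)] by (auto simp: V_def)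
  have less: False if X: "S \<in> P1" "T \<in> P2" "i \<in> S" "S \<subseteq> U \<inter> V1" "T \<subseteq> U \<inter> V2" "S \<noteq> U \<inter> V1 \<or> T \<noteq> U \<inter> V2" for S T
  proof (rule min)
    show "S \<union> T \<in> P" "i \<in> S \<union> T" using X Un_mem_P by auto
    have "S \<union> T \<noteq> U" using Int_simps[OF elt_subset(1)[OF X(1)] elt_subset(2)[OF X(2)]] X(6) by metis
    moreover have "S \<union> T \<subseteq> U" using X(4,5) by blast
    ultimately show "S \<union> T \<subset> U" by (metis psubsetI)
  qed
  have "\<not> S \<subset> U \<inter> V1" if "S \<in> P1" "i \<in> S" for S
    using less[OF that(1) parts(2) that(2)] by (metis order_refl psubset_eq)
  moreover have "\<not> T \<subset> U \<inter> V2" if "T \<in> P2" for T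
    using less[OF parts(1) that] U(2) i by (metis IntI order_refl psubset_eq)
  ultimately show "U \<in> P \<and> U \<inter> V1 \<in> label_nodes P1 i \<and> (\<forall>T\<in>P2. \<not> T \<subset> U \<inter> V2)"
    using U parts i by (simp add: mem_label_nodes)
next
  assume R: "U \<in> P \<and> U \<inter> V1 \<in> label_nodes P1 i \<and> (\<forall>T\<in>P2. \<not> T \<subset> U \<inter> V2)"
  have "\<not> X \<subset> U" if X: "X \<in> P" "i \<in> X" for X
  proof
    assume "X \<subset> U"
    then have sub: "X \<inter> V1 \<subseteq> U \<inter> V1" "X \<inter> V2 \<subseteq> U \<inter> V2" "X \<noteq> U" by auto
    have "X \<inter> V1 = U \<inter> V1"
      using R X i sub(1) mem_P[of X] unfolding mem_label_nodes by (metis IntI psubsetI)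
    moreover have "X \<inter> V2 = U \<inter> V2"
      using R X sub(2) mem_P[of X] by (metis psubsetI)
    ultimately have "X = U" using eq_iff_parts[of X U] P_subsetD X(1) R by simp
    then show False using sub(3) by simp
  qed
  moreover have "U \<in> P" "i \<in> U" using R by (simp_all add: mem_label_nodes)
  ultimately show "U \<in> label_nodes P i" by (simp add: mem_label_nodes)
qed

text \<open>For a free output the node is the top of the product, which is higher than the top of
  the factor by the rank of the other factor. That rank is even, so label parity is
  preserved.\<close>

lemma label_value:
  assumes i: "i \<in> V1" and U: "U \<in> label_nodes Q i"
  obtains S where "S \<in> label_nodes (ext_poset V1 P1) i"
    "\<tau> U = \<tau>1 S + (if free_output P1 i then B.r else 0)"
proof (cases "free_output P1 i")
  case True
  have iV: "i \<in> V" using i by (simp add: V_def)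
  have free: "free_output P i" using True free_part[OF i] by simp
  then have "U = V" using U label_nodes_free[OF iV] by simp
  moreover have "V \<notin> P" using free[unfolded free_iff] iV by blast
  ultimately have "\<tau> U = \<tau>1 V1 + B.r"
    using nonmember_rank(2) A.free_top[OF i True] by simp
  then show ?thesis using that True A.label_nodes_free[OF i True] by simp
next
  case False
  then have nf: "\<not> free_output P i" using free_part[OF i] by simp
  then have U: "U \<in> P" "U \<inter> V1 \<in> label_nodes P1 i" "\<forall>T\<in>P2. \<not> T \<subset> U \<inter> V2"
    using U label_nodes_nonfree[OF nf] label_nodes_part[OF i] by simp_all
  moreover have "\<tau>2 (U \<inter> V2) = 0" using B.minimal_rank[of "U \<inter> V2"] U mem_P[of U] by simp
  ultimately show ?thesis using that False A.label_nodes_nonfree[OF False] rank_P by simp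
qed

lemma F_singleton: "i \<in> V1 \<Longrightarrow> F {i} \<longleftrightarrow> F1 {i}"
proof -
  assume "i \<in> V1"
  then have "{i} \<inter> V1 = {i}" "{i} \<inter> V2 = {}" using disjoint by auto
  then show ?thesis using B.F_empty by (simp add: F_def)
qed

lemma label_rank_part:
  assumes "i \<in> V1" "S \<in> label_nodes Q i" "T \<in> label_nodes Q i"
  shows "\<tau> S = \<tau> T"
proof -
  obtain S' where S': "S' \<in> label_nodes (ext_poset V1 P1) i"
    "\<tau> S = \<tau>1 S' + (if free_output P1 i then B.r else 0)"
    by (rule label_value[OF assms(1,2)])
  obtain T' where T': "T' \<in> label_nodes (ext_poset V1 P1) i"
    "\<tau> T = \<tau>1 T' + (if free_output P1 i then B.r else 0)"
    by (rule label_value[OF assms(1,3)])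
  show ?thesis using A.label_rank[OF assms(1) S'(1) T'(1)] S'(2) T'(2) by simp
qed

lemma label_parity_part:
  assumes "i \<in> V1" "T \<in> label_nodes Q i"
  shows "even (\<tau> T) \<longleftrightarrow> \<not> F {i}"
proof -
  obtain S where S: "S \<in> label_nodes (ext_poset V1 P1) i"
    "\<tau> T = \<tau>1 S + (if free_output P1 i then B.r else 0)"
    by (rule label_value[OF assms])
  show ?thesis
    using A.label_parity[OF assms(1) S(1)] S(2) B.even_top_rank F_singleton[OF assms(1)] by simp
qed

lemmas label_rank_parts = label_rank_part type_poset_pair.label_rank_part[OF swap, unfolded swaps]
lemmas label_parity_parts = label_parity_part type_poset_pair.label_parity_part[OF swap, unfolded swaps]

text \<open>Both second components are minimal, so a common lower bound forces them to coincide; the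
  meet is then decided in the first factor alone.\<close>

lemma is_meet_part:
  assumes U: "U \<in> P" "\<forall>T\<in>P2. \<not> T \<subset> U \<inter> V2" and W: "W \<in> P" "\<forall>T\<in>P2. \<not> T \<subset> W \<inter> V2"
  shows "is_meet P U W M \<longleftrightarrow> M \<subseteq> V \<and> U \<inter> V2 = M \<inter> V2 \<and> W \<inter> V2 = M \<inter> V2 \<and>
    is_meet P1 (U \<inter> V1) (W \<inter> V1) (M \<inter> V1)"
proof
  assume M: "is_meet P U W M"
  then have MP: "M \<in> P" "M \<subseteq> U" "M \<subseteq> W" by (simp_all add: is_meet_def)
  have M2: "M \<inter> V2 = U \<inter> V2" "M \<inter> V2 = W \<inter> V2"
    using U(2) W(2) MP mem_P[of M] by (metis Int_mono order_refl psubsetI)+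
  have "S \<subseteq> M \<inter> V1" if S: "S \<in> P1" "S \<subseteq> U \<inter> V1" "S \<subseteq> W \<inter> V1" for S
  proof -
    note R = replace_part[OF MP(1) S(1)]
    have "S \<union> (M \<inter> V2) \<subseteq> U" "S \<union> (M \<inter> V2) \<subseteq> W" using S M2 by blast+
    then have "S \<union> (M \<inter> V2) \<subseteq> M" using M R(1) unfolding is_meet_def by blast
    then show ?thesis using R(2) by blast
  qed
  moreover have "M \<inter> V1 \<in> P1" "M \<inter> V1 \<subseteq> U \<inter> V1" "M \<inter> V1 \<subseteq> W \<inter> V1" "M \<subseteq> V"
    using MP mem_P[of M] by auto
  ultimately show "M \<subseteq> V \<and> U \<inter> V2 = M \<inter> V2 \<and> W \<inter> V2 = M \<inter> V2 \<and>
    is_meet P1 (U \<inter> V1) (W \<inter> V1) (M \<inter> V1)"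
    using M2 by (simp only: is_meet_def) simp
next
  assume R: "M \<subseteq> V \<and> U \<inter> V2 = M \<inter> V2 \<and> W \<inter> V2 = M \<inter> V2 \<and>
    is_meet P1 (U \<inter> V1) (W \<inter> V1) (M \<inter> V1)"
  then have N: "M \<inter> V1 \<in> P1" "M \<inter> V1 \<subseteq> U \<inter> V1" "M \<inter> V1 \<subseteq> W \<inter> V1"
    "\<And>S. S \<in> P1 \<Longrightarrow> S \<subseteq> U \<inter> V1 \<Longrightarrow> S \<subseteq> W \<inter> V1 \<Longrightarrow> S \<subseteq> M \<inter> V1"
    by (simp_all only: is_meet_def)
  have "M \<in> P" using N(1) R U(1) mem_P[of M] mem_P[of U] by simp
  moreover have "M \<subseteq> U" "M \<subseteq> W"
    using N(2,3) R subset_iff_parts[of M U] subset_iff_parts[of M W] by simp_all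
  moreover have "X \<subseteq> M" if X: "X \<in> P" "X \<subseteq> U" "X \<subseteq> W" for X
  proof -
    have "X \<inter> V1 \<subseteq> M \<inter> V1" using N(4)[of "X \<inter> V1"] X mem_P[of X] by (simp add: le_infI1)
    moreover have "X \<inter> V2 \<subseteq> U \<inter> V2" using X(2) by auto
    then have "X \<inter> V2 \<subseteq> M \<inter> V2" using R by simp
    ultimately show ?thesis using subset_iff_parts[OF P_subsetD[OF X(1)], of M] by simp
  qed
  ultimately show "is_meet P U W M" by (simp add: is_meet_def)
qed

lemma meets_part:
  assumes ij: "i \<in> V1" "j \<in> V1"
    and nf: "\<not> free_output P i" "\<not> free_output P j"
    and U: "U \<in> label_nodes P i" and W: "W \<in> label_nodes P j"
  shows "\<exists>M. is_meet Q U W M"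
proof -
  have nf1: "\<not> free_output P1 i" "\<not> free_output P1 j" using nf free_part ij by simp_all
  note U = U[unfolded label_nodes_part[OF ij(1)]] and W = W[unfolded label_nodes_part[OF ij(2)]]
  have UW: "U \<in> P" "W \<in> P" and L: "U \<inter> V1 \<in> label_nodes A.Q i" "W \<inter> V1 \<in> label_nodes A.Q j"
    using U W A.label_nodes_nonfree nf1 by simp_all
  have UW1: "U \<inter> V1 \<in> P1" "W \<inter> V1 \<in> P1" using UW mem_P by simp_all
  have min: "\<forall>T\<in>P2. \<not> T \<subset> U \<inter> V2" "\<forall>T\<in>P2. \<not> T \<subset> W \<inter> V2" using U W by simp_all
  show ?thesis
  proof (cases "\<exists>M. is_meet P U W M")
    case True
    then show ?thesis using is_meet_ext_iff[OF UW] by blast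
  next
    case none: False
    have "\<not> (X \<subseteq> U \<and> X \<subseteq> W)" if X: "X \<in> P" for X
    proof
      assume sub: "X \<subseteq> U \<and> X \<subseteq> W"
      have X12: "X \<inter> V1 \<in> P1" "X \<inter> V2 \<in> P2" using X mem_P[of X] by simp_all
      have X2: "X \<inter> V2 = U \<inter> V2" "X \<inter> V2 = W \<inter> V2"
        using min X12(2) sub by (metis Int_mono order_refl psubsetI)+
      obtain N where N: "is_meet A.Q (U \<inter> V1) (W \<inter> V1) N" using A.meets[OF ij L] by blast
      have "X \<inter> V1 \<subseteq> U \<inter> V1 \<and> X \<inter> V1 \<subseteq> W \<inter> V1" using sub by blast
      \<comment> \<open>The first component of \<open>X\<close> is a common lower bound inside
        \<open>P1\<close>, so the meet in the extended factor is already one in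
        \<open>P1\<close>.\<close>
      then have N: "is_meet P1 (U \<inter> V1) (W \<inter> V1) N"
        using N A.is_meet_ext_iff[OF UW1, of N] X12(1) by blast
      then have NP: "N \<in> P1" by (simp add: is_meet_def)
      note R = replace_part[OF X NP]
      have "is_meet P U W (N \<union> (X \<inter> V2))"
        unfolding is_meet_part[OF UW(1) min(1) UW(2) min(2)] R(2,3) using P_subsetD[OF R(1)] X2 N by simp
      then show False using none by blast
    qed
    then have "is_meet Q U W {}" using is_meet_ext_iff[OF UW, of "{}"] by blast
    then show ?thesis by blast
  qed
qed

text \<open>In each factor one of the two sets is minimal. This determines both components of any
  common lower bound, which is therefore unique, minimal, and of rank 0.\<close>

lemma is_meet_cross:
  assumes U: "U \<in> P" "\<forall>T\<in>P2. \<not> T \<subset> U \<inter> V2" and W: "W \<in> P" "\<forall>S\<in>P1. \<not> S \<subset> W \<inter> V1"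
    and X: "X \<in> P" "X \<subseteq> U" "X \<subseteq> W"
  shows "is_meet P U W X \<and> \<tau> X = 0"
proof -
  have part: "Y \<inter> V1 = W \<inter> V1" "Y \<inter> V2 = U \<inter> V2" if Y: "Y \<in> P" "Y \<subseteq> U" "Y \<subseteq> W" for Y
    using U(2) W(2) Y mem_P[of Y] by (metis Int_mono order_refl psubsetI)+
  have "Y \<subseteq> X" if Y: "Y \<in> P" "Y \<subseteq> U" "Y \<subseteq> W" for Y
    using subset_iff_parts[OF P_subsetD[OF Y(1)], of X] part[OF Y] part[OF X] by simp
  then have "is_meet P U W X" using X by (simp add: is_meet_def)
  moreover have "\<tau>1 (X \<inter> V1) = 0" "\<tau>2 (X \<inter> V2) = 0"
    using part[OF X] W U A.minimal_rank[of "W \<inter> V1"] B.minimal_rank[of "U \<inter> V2"]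
      mem_P[of W] mem_P[of U] by simp_all
  ultimately show ?thesis using rank_P[OF X(1)] by simp
qed

lemma label_nodes_part_swap:
  assumes "j \<in> V2"
  shows "U \<in> label_nodes P j \<longleftrightarrow>
    U \<in> P \<and> U \<inter> V2 \<in> label_nodes P2 j \<and> (\<forall>T\<in>P1. \<not> T \<subset> U \<inter> V1)"
  using type_poset_pair.label_nodes_part[OF swap assms, unfolded swaps] .

lemma meets_cross:
  assumes ij: "i \<in> V1" "j \<in> V2" and U: "U \<in> label_nodes P i" and W: "W \<in> label_nodes P j"
  shows "\<exists>M. is_meet Q U W M"
proof -
  note U = U[unfolded label_nodes_part[OF ij(1)]] and W = W[unfolded label_nodes_part_swap[OF ij(2)]]
  have UW: "U \<in> P" "W \<in> P" using U W by simp_all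
  show ?thesis
  proof (cases "\<exists>X\<in>P. X \<subseteq> U \<and> X \<subseteq> W")
    case True
    then obtain X where X: "X \<in> P" "X \<subseteq> U" "X \<subseteq> W" by blast
    have "is_meet P U W X" using is_meet_cross[OF _ _ _ _ X] U W by blast
    then show ?thesis using is_meet_ext_iff[OF UW] by blast
  next
    case False
    then have "is_meet Q U W {}" using is_meet_ext_iff[OF UW, of "{}"] by blast
    then show ?thesis by blast
  qed
qed

lemma meets_nonfree:
  assumes "i \<in> V" "j \<in> V" "\<not> free_output P i" "\<not> free_output P j"
    and "U \<in> label_nodes P i" "W \<in> label_nodes P j"
  shows "\<exists>M. is_meet Q U W M"
proof -
  consider "i \<in> V1" "j \<in> V1" | "i \<in> V1" "j \<in> V2" | "i \<in> V2" "j \<in> V1" | "i \<in> V2" "j \<in> V2"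
    using assms(1,2) by (auto simp: V_def)
  then show ?thesis
  proof cases
    case 1
    then show ?thesis using meets_part assms by blast
  next
    case 2
    then show ?thesis using meets_cross assms by blast
  next
    case 3
    then show ?thesis using meets_cross[OF 3(2,1) assms(6,5)] is_meet_commute by blast
  next
    case 4
    then show ?thesis
      using type_poset_pair.meets_part[OF swap 4, unfolded swaps] assms by blast
  qed
qed

lemma meets_prod:
  assumes ij: "i \<in> V" "j \<in> V" and U: "U \<in> label_nodes Q i" and W: "W \<in> label_nodes Q j"
  shows "\<exists>M. is_meet Q U W M"
proof (cases "free_output P i \<or> free_output P j")
  case True
  then show ?thesis
  proof
    assume "free_output P j"
    then have "W = V" using W label_nodes_free[OF ij(2)] by simp
    then show ?thesis using is_meet_V label_nodes_subset[OF U] by blast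
  next
    assume "free_output P i"
    then have "U = V" using U label_nodes_free[OF ij(1)] by simp
    moreover have "is_meet Q W V W" using is_meet_V label_nodes_subset[OF W] by blast
    ultimately have "is_meet Q U W W" by (simp only: is_meet_commute[of Q V W])
    then show ?thesis by blast
  qed
next
  case False
  then have nf: "\<not> free_output P i" "\<not> free_output P j" by simp_all
  show ?thesis
    using meets_nonfree[OF ij nf] U W
    unfolding label_nodes_nonfree[OF nf(1)] label_nodes_nonfree[OF nf(2)] by simp
qed

section \<open>The rank of a pair in a product\<close>

lemma rank_ge_prod: "U \<in> Q \<Longrightarrow> -1 \<le> \<tau> U"
proof (cases "U \<in> P")
  case True
  then show ?thesis using A.rank_nonneg[of "U \<inter> V1"] B.rank_nonneg[of "U \<inter> V2"] rank_P[OF True] mem_P[of U] by simp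
next
  case False
  assume "U \<in> Q"
  then have "U = {} \<or> U = V" using False Q_simps(7)[of U] by blast
  then show ?thesis
    using False nonmember_rank A.top_rank_nonneg B.top_rank_nonneg by (elim disjE) simp_all
qed

lemma meet_values_nonempty_prod:
  assumes "i \<in> V" "j \<in> V"
  shows "meet_values Q \<tau> i j \<noteq> {}"
proof -
  obtain S T where ST: "S \<in> label_nodes Q i" "T \<in> label_nodes Q j"
    using label_nodes_nonempty assms by blast
  obtain M where "is_meet Q S T M" using meets_prod[OF assms ST] by blast
  then have "\<tau> M \<in> meet_values Q \<tau> i j" using ST by (intro meet_valuesI) simp_all
  then show ?thesis by blast
qed

text \<open>All ranks are at least -1, so the value inserted for comparing a poset with its
  extension does not affect the maximum.\<close>

lemma Max_meet_values_prod:
  assumes "i \<in> V" "j \<in> V"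
  shows "Max (meet_values Q \<tau> i j) = Max (insert (-1) (meet_values Q \<tau> i j))"
proof -
  obtain x where x: "x \<in> meet_values Q \<tau> i j" using meet_values_nonempty_prod[OF assms] by blast
  then obtain U where "U \<in> Q" "x = \<tau> U" using meet_values_subset[of \<tau> i j] by blast
  then have "-1 \<le> x" using rank_ge_prod by simp
  then have "-1 \<le> Max (meet_values Q \<tau> i j)" using Max_ge[OF finite_meet_values x] by simp
  then show ?thesis using x finite_meet_values by (subst Max_insert) auto
qed

lemma ex_minimal: "\<exists>S\<in>P1. \<forall>R\<in>P1. \<not> R \<subset> S"
proof -
  obtain S where "S \<in> P1" using A.P_nonempty by blast
  moreover then have "finite S" using A.finite_elt A.Q_simps(3) by blast
  ultimately show ?thesis by (rule ex_minimal_below[THEN bexE]) (elim conjE, rule bexI)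
qed

text \<open>A meet has a minimal second component and thus the rank of its first. Conversely,
  joining one fixed minimal member \<open>B\<close> of the other factor to both nodes and to their
  meet lifts every meet without adding rank.\<close>

lemma meet_values_part:
  assumes ij: "i \<in> V1" "j \<in> V1"
  shows "meet_values P \<tau> i j = meet_values P1 \<tau>1 i j"
proof (intro equalityI subsetI)
  fix x assume "x \<in> meet_values P \<tau> i j"
  then obtain M U W where x: "x = \<tau> M" and U: "U \<in> label_nodes P i" and W: "W \<in> label_nodes P j"
    and M: "is_meet P U W M" unfolding meet_values_def by blast
  note U = U[unfolded label_nodes_part[OF ij(1)]] and W = W[unfolded label_nodes_part[OF ij(2)]]
  have R: "U \<inter> V2 = M \<inter> V2" "is_meet P1 (U \<inter> V1) (W \<inter> V1) (M \<inter> V1)"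
    using M is_meet_part[of U W M] U W by simp_all
  have "M \<in> P" using M by (simp add: is_meet_def)
  moreover have "\<tau>2 (M \<inter> V2) = 0" using R(1) U B.minimal_rank[of "U \<inter> V2"] mem_P[of U] by simp
  ultimately have "\<tau> M = \<tau>1 (M \<inter> V1)" using rank_P by simp
  then show "x \<in> meet_values P1 \<tau>1 i j" using x U W R(2) by (intro meet_valuesI) simp_all
next
  fix x assume "x \<in> meet_values P1 \<tau>1 i j"
  then obtain N S T where x: "x = \<tau>1 N" and S: "S \<in> label_nodes P1 i" and T: "T \<in> label_nodes P1 j"
    and N: "is_meet P1 S T N" unfolding meet_values_def by blast
  have P1: "S \<in> P1" "T \<in> P1" "N \<in> P1" using S T N by (simp_all add: mem_label_nodes is_meet_def)
  obtain B where B: "B \<in> P2" "\<forall>R\<in>P2. \<not> R \<subset> B"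
    using type_poset_pair.ex_minimal[OF swap] by blast
  note I = Int_simps[OF elt_subset(1) elt_subset(2)[OF B(1)]]
  have mem: "S \<union> B \<in> P" "T \<union> B \<in> P" "N \<union> B \<in> P" using Un_mem_P P1 B(1) by blast+
  have L: "S \<union> B \<in> label_nodes P i" "T \<union> B \<in> label_nodes P j"
    unfolding label_nodes_part[OF ij(1)] label_nodes_part[OF ij(2)]
    using mem I P1 S T B by simp_all
  have "is_meet P (S \<union> B) (T \<union> B) (N \<union> B)"
    using is_meet_part[of "S \<union> B" "T \<union> B" "N \<union> B"] mem I P1 B N P_subsetD[OF mem(3)] by simp
  moreover have "x = \<tau> (N \<union> B)"
    using rank_P[OF mem(3)] I P1 x B.minimal_rank[OF B] by simp
  ultimately show "x \<in> meet_values P \<tau> i j" using L by (intro meet_valuesI) simp_all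
qed

text \<open>What matters is that a meet exists for some choice of nodes: the rank is then 0 and not
  the odd default -1.\<close>

lemma meet_values_cross:
  assumes ij: "i \<in> V1" "j \<in> V2" and nf: "\<not> free_output P i" "\<not> free_output P j"
  shows "meet_values P \<tau> i j = {0}"
proof (intro equalityI subsetI)
  fix x assume "x \<in> meet_values P \<tau> i j"
  then obtain M U W where x: "x = \<tau> M" and U: "U \<in> label_nodes P i" and W: "W \<in> label_nodes P j"
    and M: "is_meet P U W M" unfolding meet_values_def by blast
  have "M \<in> P" "M \<subseteq> U" "M \<subseteq> W" using M by (simp_all add: is_meet_def)
  then show "x \<in> {0}"
    using is_meet_cross[of U W M] U[unfolded label_nodes_part[OF ij(1)]]
      W[unfolded label_nodes_part_swap[OF ij(2)]] x by simp
next
  fix x :: int assume "x \<in> {0}"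
  obtain U W where U: "U \<in> label_nodes P i" and W: "W \<in> label_nodes P j"
    using nf unfolding free_output_def by blast
  note U' = U[unfolded label_nodes_part[OF ij(1)]] and W' = W[unfolded label_nodes_part_swap[OF ij(2)]]
  have UW: "U \<inter> V1 \<in> P1" "U \<inter> V2 \<in> P2" "W \<inter> V1 \<in> P1" "W \<inter> V2 \<in> P2"
    using U' W' mem_P[of U] mem_P[of W] by simp_all
  \<comment> \<open>The component of a node in the factor without its label may be any minimal
    member. Choosing each of them below the other node creates the common lower bound
    \<open>A \<union> B\<close>.\<close>
  obtain A where A: "A \<in> P1" "A \<subseteq> U \<inter> V1" "\<forall>R\<in>P1. \<not> R \<subset> A"
    using ex_minimal_below[OF UW(1)] A.finite_V by blast
  obtain B where B: "B \<in> P2" "B \<subseteq> W \<inter> V2" "\<forall>R\<in>P2. \<not> R \<subset> B"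
    using ex_minimal_below[OF UW(4)] B.finite_V by blast
  note I1 = Int_simps[OF elt_subset(1)[OF A(1)]] and I2 = Int_simps[OF _ elt_subset(2)[OF B(1)]]
  define W2 where "W2 = A \<union> (W \<inter> V2)"
  have W2: "W2 \<in> P" "W2 \<inter> V1 = A" "W2 \<inter> V2 = W \<inter> V2"
    using Un_mem_P A(1) UW(4) I1[of "W \<inter> V2"] by (simp_all add: W2_def)
  define U2 where "U2 = (U \<inter> V1) \<union> B"
  have U2: "U2 \<in> P" "U2 \<inter> V1 = U \<inter> V1" "U2 \<inter> V2 = B"
    using Un_mem_P B(1) UW(1) I2[of "U \<inter> V1"] by (simp_all add: U2_def)
  have L: "U2 \<in> label_nodes P i" "W2 \<in> label_nodes P j"
    unfolding label_nodes_part[OF ij(1)] label_nodes_part_swap[OF ij(2)]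
    using U2 W2 U' W' A B by simp_all
  have "A \<union> B \<in> P" "A \<union> B \<subseteq> U2" "A \<union> B \<subseteq> W2"
    using Un_mem_P A B by (auto simp only: U2_def W2_def)
  then have "is_meet P U2 W2 (A \<union> B) \<and> \<tau> (A \<union> B) = 0"
    using is_meet_cross[of U2 W2 "A \<union> B"] U2 W2 A B by simp
  then show "x \<in> meet_values P \<tau> i j"
    using L \<open>x \<in> {0}\<close> by (intro meet_valuesI[where S = U2 and T = W2 and M = "A \<union> B"]) simp_all
qed

text \<open>Against a free output the meets are the nodes of the input \<open>i\<close> themselves,
  and these have even rank.\<close>

lemma even_Max_free:
  assumes "i \<in> V" "j \<in> V" "free_output P j" "\<not> F {i}"
  shows "even (Max (meet_values Q \<tau> i j))"
proof -
  have "Max (meet_values Q \<tau> i j) \<in> \<tau> ` label_nodes Q i"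
    using Max_in[OF finite_meet_values meet_values_nonempty_prod[OF assms(1,2)]]
    unfolding meet_values_free_image[OF assms(2,3)] .
  then show ?thesis
    using label_parity_parts[of i] assms(1,4) by (auto simp: V_def)
qed

lemma nonfree_input_part: "i \<in> V1 \<Longrightarrow> \<not> F {i} \<Longrightarrow> \<not> free_output P i"
  using A.nonfree_input free_part F_singleton by simp

lemma pair_parity_part:
  assumes ij: "i \<in> V1" "j \<in> V1" "\<not> F {i}" "F {j}"
  shows "F {i, j} \<longleftrightarrow> odd (Max (meet_values Q \<tau> i j))"
proof -
  have F: "F {i, j} \<longleftrightarrow> F1 {i, j}"
  proof -
    have "{i, j} \<inter> V1 = {i, j}" "{i, j} \<inter> V2 = {}" using ij disjoint by auto
    then show ?thesis using B.F_empty by (simp add: F_def)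
  qed
  have ijV: "i \<in> V" "j \<in> V" using ij by (simp_all add: V_def)
  have F1: "\<not> F1 {i}" "F1 {j}" using ij F_singleton by simp_all
  have A: "F1 {i, j} \<longleftrightarrow> odd (Max (meet_values A.Q \<tau>1 i j))"
    by (rule A.pair_parity[OF ij(1,2) F1])
  show ?thesis
  proof (cases "free_output P j")
    case True
    then have "free_output P1 j" using free_part ij by simp
    then have "Max (meet_values A.Q \<tau>1 i j) \<in> \<tau>1 ` label_nodes A.Q i"
      using Max_in[OF A.finite_meet_values A.meet_values_nonempty[OF ij(1,2)]]
        A.meet_values_free_image[OF ij(2)] by simp
    then have "even (Max (meet_values A.Q \<tau>1 i j))"
      using A.label_parity[OF ij(1)] F1 by auto
    then show ?thesis using even_Max_free[OF ijV True ij(3)] F A by simp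
  next
    case False
    have nf: "\<not> free_output P i" using nonfree_input_part ij by simp
    have nf1: "\<not> free_output P1 i" "\<not> free_output P1 j" using nf False free_part ij by simp_all
    \<comment> \<open>\<open>{}\<close> can be a member of the factor and yet be adjoined in the
      product, so the two extensions are compared only through \<open>P\<close> and
      \<open>P1\<close>, with -1 absorbing either bottom.\<close>
    have "insert (-1) (meet_values Q \<tau> i j) = insert (-1) (meet_values P1 \<tau>1 i j)"
      using insert_meet_values[where \<tau> = \<tau>, OF nf False nonmember_rank(1)]
        meet_values_part[OF ij(1,2)] by simp
    also have "\<dots> = insert (-1) (meet_values A.Q \<tau>1 i j)"
      using A.insert_meet_values[where \<tau> = \<tau>1, OF nf1] A.bottom by simp
    finally have "Max (meet_values Q \<tau> i j) = Max (insert (-1) (meet_values A.Q \<tau>1 i j))"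
      using Max_meet_values_prod[OF ijV] by (simp only:)
    also have "\<dots> = Max (meet_values A.Q \<tau>1 i j)"
    proof -
      obtain U where "U \<in> A.Q" "Max (meet_values A.Q \<tau>1 i j) = \<tau>1 U"
        using Max_in[OF A.finite_meet_values A.meet_values_nonempty[OF ij(1,2)]]
          A.meet_values_subset[of \<tau>1 i j] by blast
      then have "-1 \<le> Max (meet_values A.Q \<tau>1 i j)" using A.rank_ge by simp
      then show ?thesis
        using A.finite_meet_values A.meet_values_nonempty[OF ij(1,2)] by (subst Max_insert) auto
    qed
    finally show ?thesis using F A by simp
  qed
qed

lemma pair_parity_cross:
  assumes ij: "i \<in> V1" "j \<in> V2" "\<not> F {i}" "F {j}"
  shows "F {i, j} \<longleftrightarrow> odd (Max (meet_values Q \<tau> i j))"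
proof -
  have "{i, j} \<inter> V1 = {i}" using ij disjoint by auto
  moreover have "\<not> F1 {i}" using ij(3) F_singleton[OF ij(1)] by simp
  ultimately have F: "\<not> F {i, j}" by (simp add: F_def)
  have ijV: "i \<in> V" "j \<in> V" using ij by (simp_all add: V_def)
  have "even (Max (meet_values Q \<tau> i j))"
  proof (cases "free_output P j")
    case True
    then show ?thesis using even_Max_free[OF ijV True ij(3)] by simp
  next
    case False
    have nf: "\<not> free_output P i" using nonfree_input_part ij by simp
    have "insert (-1) (meet_values Q \<tau> i j) = {-1, 0}"
      using insert_meet_values[where \<tau> = \<tau>, OF nf False nonmember_rank(1)]
        meet_values_cross[OF ij(1,2) nf False] by simp
    then have "Max (meet_values Q \<tau> i j) = Max {-1, 0}"
      using Max_meet_values_prod[OF ijV] by (simp only:)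
    then show ?thesis by simp
  qed
  then show ?thesis using F by simp
qed

lemma pair_parity_prod:
  assumes "i \<in> V" "j \<in> V" "\<not> F {i}" "F {j}"
  shows "F {i, j} \<longleftrightarrow> odd (Max (meet_values Q \<tau> i j))"
  using assms pair_parity_part pair_parity_cross
    type_poset_pair.pair_parity_part[OF swap, unfolded swaps, of i j]
    type_poset_pair.pair_parity_cross[OF swap, unfolded swaps, of i j]
  by (auto simp only: V_def Un_iff)

section \<open>Monotonicity and expansion of a product\<close>

lemma F_output_part:
  assumes "i \<in> V1" "F {i}" "W \<subseteq> V" "F W"
  shows "F (insert i W)"
proof -
  have "insert i W \<inter> V1 = insert i (W \<inter> V1)" "insert i W \<inter> V2 = W \<inter> V2"
    using assms(1) disjoint by auto
  moreover have "F1 {i}" using assms(1,2) F_singleton by simp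
  ultimately show ?thesis using A.F_output[of i "W \<inter> V1"] assms by (simp add: F_def)
qed

lemma F_input_part:
  assumes "i \<in> V1" "\<not> F {i}" "W \<subseteq> V" "F (insert i W)"
  shows "F W"
proof -
  have "insert i W \<inter> V1 = insert i (W \<inter> V1)" "insert i W \<inter> V2 = W \<inter> V2"
    using assms(1) disjoint by auto
  moreover have "\<not> F1 {i}" using assms(1,2) F_singleton by simp
  ultimately show ?thesis using A.F_input[of i "W \<inter> V1"] assms by (simp add: F_def)
qed

lemma weight_prod:
  assumes "S \<subseteq> V1" "T \<subseteq> V2"
  shows "weight P \<tau> (S \<union> T) = weight P1 \<tau>1 S * weight P2 \<tau>2 T"
proof -
  have I: "(S \<union> T) \<inter> V1 = S" "(S \<union> T) \<inter> V2 = T" using Int_simps[OF assms] by simp_all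
  have "S \<union> T \<subseteq> V" using assms by (auto simp: V_def)
  then have "S \<union> T \<in> P \<longleftrightarrow> S \<in> P1 \<and> T \<in> P2" using mem_P[of "S \<union> T"] I by simp
  moreover have "\<tau> (S \<union> T) = \<tau>1 S + \<tau>2 T" if "S \<union> T \<in> P" using rank_P[OF that] I by simp
  ultimately show ?thesis by (auto simp: weight_def)
qed

text \<open>Under \<open>U = S \<union> T\<close> both the sign of \<open>U\<close> and the
  condition of avoiding \<open>W\<close> factorise over the two carriers.\<close>

lemma expansion_prod:
  assumes "W \<subseteq> V"
  shows "(if F W then 1 else 0) = (\<Sum>T\<in>Pow V. if T \<inter> W = {} then weight P \<tau> T else 0)"
proof -
  let ?g1 = "\<lambda>S. if S \<inter> (W \<inter> V1) = {} then weight P1 \<tau>1 S else 0"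
  let ?g2 = "\<lambda>T. if T \<inter> (W \<inter> V2) = {} then weight P2 \<tau>2 T else 0"
  have "(if F W then 1 else 0) = (if F1 (W \<inter> V1) then 1 else 0) * (if F2 (W \<inter> V2) then 1 else (0::int))"
    by (simp add: F_def)
  also have "\<dots> = (\<Sum>S\<in>Pow V1. ?g1 S) * (\<Sum>T\<in>Pow V2. ?g2 T)"
    using A.expansion[of "W \<inter> V1"] B.expansion[of "W \<inter> V2"] by simp
  also have "\<dots> = (\<Sum>(S, T)\<in>Pow V1 \<times> Pow V2. ?g1 S * ?g2 T)"
    by (simp add: sum_product sum.cartesian_product)
  also have "\<dots> = (\<Sum>U\<in>Pow V. if U \<inter> W = {} then weight P \<tau> U else 0)"
  proof (rule sum.reindex_bij_witness[where i = "\<lambda>U. (U \<inter> V1, U \<inter> V2)" and j = "\<lambda>(S, T). S \<union> T"])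
    fix p assume "p \<in> Pow V1 \<times> Pow V2"
    then obtain S T where p: "p = (S, T)" "S \<subseteq> V1" "T \<subseteq> V2" by auto
    then show "((case p of (S, T) \<Rightarrow> S \<union> T) \<inter> V1, (case p of (S, T) \<Rightarrow> S \<union> T) \<inter> V2) = p"
      using Int_simps by simp
    show "(case p of (S, T) \<Rightarrow> S \<union> T) \<in> Pow V" using p by (auto simp: V_def)
    have "(S \<union> T) \<inter> W = {} \<longleftrightarrow> S \<inter> (W \<inter> V1) = {} \<and> T \<inter> (W \<inter> V2) = {}" using p by blast
    then show "(if (case p of (S, T) \<Rightarrow> S \<union> T) \<inter> W = {} then weight P \<tau> (case p of (S, T) \<Rightarrow> S \<union> T) else 0) =
        (case p of (S, T) \<Rightarrow> ?g1 S * ?g2 T)"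
      using p weight_prod[of S T] by simp
  qed (auto simp: V_def)
  finally show ?thesis .
qed

lemma type_poset_prod: "type_poset V P \<tau> F"
proof unfold_locales
  show "F {}" using A.F_empty B.F_empty by (simp add: F_def)
next
  fix i W assume "i \<in> V" "F {i}" "W \<subseteq> V" "F W"
  then show "F (insert i W)"
    using F_output_part type_poset_pair.F_output_part[OF swap, unfolded swaps, of i W] by (auto simp only: V_def Un_iff)
next
  fix i W assume "i \<in> V" "\<not> F {i}" "W \<subseteq> V" "F (insert i W)"
  then show "F W"
    using F_input_part type_poset_pair.F_input_part[OF swap, unfolded swaps, of i W] by (auto simp only: V_def Un_iff)
next
  show "\<tau> {} = (if {} \<in> P then 0 else -1)" by (rule bottom_prod)
  show "V \<in> P \<longleftrightarrow> even (\<tau> V)" by (rule top_prod)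
next
  fix i S T assume "i \<in> V" "S \<in> label_nodes Q i" "T \<in> label_nodes Q i"
  then show "\<tau> S = \<tau> T" using label_rank_parts[of i S T] unfolding V_def by blast
next
  fix i T assume "i \<in> V" "T \<in> label_nodes Q i"
  then show "even (\<tau> T) \<longleftrightarrow> \<not> F {i}" using label_parity_parts[of i T] unfolding V_def by blast
qed (fact expansion_prod cover_prod meets_prod pair_parity_prod)+

end

section \<open>From type functions to structure posets\<close>

text \<open>Type functions on arbitrary finite carriers, read on supports of strings. Disjoint union
  replaces concatenation, relabelling is derived, and the last rule makes values off subsets of
  \<open>V\<close> irrelevant.\<close>

inductive type_set_fun :: "nat set \<Rightarrow> (nat set \<Rightarrow> bool) \<Rightarrow> bool" where
  one: "type_set_fun {a} (\<lambda>W. True)"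
| dual: "type_set_fun V F \<Longrightarrow> type_set_fun V (\<lambda>W. W = {} \<or> \<not> F W)"
| tensor: "type_set_fun V F \<Longrightarrow> type_set_fun V' F' \<Longrightarrow> V \<inter> V' = {} \<Longrightarrow>
    type_set_fun (V \<union> V') (\<lambda>W. F (W \<inter> V) \<and> F' (W \<inter> V'))"
| cong: "type_set_fun V F \<Longrightarrow> (\<And>W. W \<subseteq> V \<Longrightarrow> F W = G W) \<Longrightarrow> type_set_fun V G"

lemma type_poset_cong:
  assumes "type_poset V P \<tau> F" "\<And>W. W \<subseteq> V \<Longrightarrow> F W = G W"
  shows "type_poset V P \<tau> G"
proof -
  interpret type_poset V P \<tau> F by fact
  have eq: "G W = F W" if "W \<subseteq> V" for W using assms(2) that by simp
  show ?thesis
  proof unfold_locales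
    show "G {}" using F_empty eq by simp
  next
    fix i W assume "i \<in> V" "G {i}" "W \<subseteq> V" "G W"
    then show "G (insert i W)" using F_output[of i W] by (simp add: eq)
  next
    fix i W assume "i \<in> V" "\<not> G {i}" "W \<subseteq> V" "G (insert i W)"
    then show "G W" using F_input[of i W] by (simp add: eq)
  next
    fix W assume "W \<subseteq> V"
    then show "(if G W then 1 else 0) = (\<Sum>T\<in>Pow V. if T \<inter> W = {} then weight P \<tau> T else 0)"
      using expansion eq by simp
  next
    fix i T assume "i \<in> V" "T \<in> label_nodes Q i"
    then show "even (\<tau> T) \<longleftrightarrow> \<not> G {i}" using label_parity[of i T] by (simp add: eq)
  next
    fix i j assume "i \<in> V" "j \<in> V" "\<not> G {i}" "G {j}"
    then show "G {i, j} \<longleftrightarrow> odd (Max (meet_values Q \<tau> i j))"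
      using pair_parity[of i j] by (simp add: eq)
  qed (fact bottom top cover label_rank meets)+
qed

lemma type_set_fun_type_poset: "type_set_fun V F \<Longrightarrow> \<exists>P \<tau>. type_poset V P \<tau> F"
proof (induction rule: type_set_fun.induct)
  case one
  show ?case using singleton_type_poset by blast
next
  case (dual V F)
  then show ?case using type_poset.dual_type_poset by blast
next
  case (tensor V F V' F')
  then obtain P \<tau> P' \<tau>' where "type_poset V P \<tau> F" "type_poset V' P' \<tau>' F'" by blast
  then interpret type_poset_pair V P \<tau> F V' P' \<tau>' F'
    using tensor.hyps by (simp add: type_poset_pair_def type_poset_pair_axioms_def)
  show ?case using type_poset_prod unfolding V_def F_def by blast
next
  case (cong V F G)
  then show ?case using type_poset_cong by blast
qed

text \<open>Injective relabelling covers both the action of permutations and the shift that makes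
  the carriers of two tensor factors disjoint.\<close>

lemma type_set_fun_image:
  assumes "type_set_fun V F" "inj_on h V"
  shows "type_set_fun (h ` V) (\<lambda>W. F (h -` W \<inter> V))"
  using assms
proof (induction rule: type_set_fun.induct)
  case (one a)
  show ?case using type_set_fun.one[of "h a"] by simp
next
  case (dual V F)
  from type_set_fun.dual[OF dual.IH[OF dual.prems]] show ?case
    by (rule type_set_fun.cong) auto
next
  case (tensor V F V' F')
  have inj: "inj_on h V" "inj_on h V'" using tensor.prems by (auto intro: inj_on_subset)
  have "h ` V \<inter> h ` V' = {}" using tensor.hyps(3) tensor.prems by (auto simp: inj_on_def)
  from type_set_fun.tensor[OF tensor.IH(1)[OF inj(1)] tensor.IH(2)[OF inj(2)] this]
  have T: "type_set_fun (h ` (V \<union> V'))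
    (\<lambda>W. F (h -` (W \<inter> h ` V) \<inter> V) \<and> F' (h -` (W \<inter> h ` V') \<inter> V'))"
    by (simp add: image_Un)
  have "h -` (W \<inter> h ` V) \<inter> V = (h -` W \<inter> (V \<union> V')) \<inter> V"
    "h -` (W \<inter> h ` V') \<inter> V' = (h -` W \<inter> (V \<union> V')) \<inter> V'" for W by auto
  then show ?case using T by simp
next
  case (cong V F G)
  from cong.IH[OF cong.prems] show ?case
    by (rule type_set_fun.cong) (simp add: cong.hyps)
qed

section \<open>Strings as indicators of their supports\<close>

definition ind_str :: "nat \<Rightarrow> nat set \<Rightarrow> str" where
  "ind_str n W = (\<lambda>k\<in>{1..n}. if k \<in> W then 1 else 0)"

lemma ind_str_in_strings [simp]: "ind_str n W \<in> strings n"
  by (simp add: ind_str_def strings_def)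

lemma strings_eq_ind_str:
  assumes "s \<in> strings n"
  shows "s = ind_str n {k\<in>{1..n}. s k = 1}"
proof
  fix k
  show "s k = ind_str n {k\<in>{1..n}. s k = 1} k"
  proof (cases "k \<in> {1..n}")
    case True
    then have "s k \<in> {0, 1}" using PiE_mem[OF assms[unfolded strings_def]] by blast
    then show ?thesis using True unfolding ind_str_def by (elim insertE) simp_all
  next
    case False
    then have "s k = undefined" using PiE_arb[OF assms[unfolded strings_def]] by blast
    then show ?thesis using False unfolding ind_str_def by (simp only: restrict_apply if_False)
  qed
qed

lemma zero_str_ind: "zero_str n = ind_str n {}"
  and unit_str_ind: "unit_str n i = ind_str n {i}"
  unfolding zero_str_def unit_str_def ind_str_def by simp_all

lemma ind_str_eq_iff: "ind_str n W = ind_str n W' \<longleftrightarrow> W \<inter> {1..n} = W' \<inter> {1..n}"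
proof
  assume eq: "ind_str n W = ind_str n W'"
  have "k \<in> W \<longleftrightarrow> k \<in> W'" if "k \<in> {1..n}" for k
  proof -
    have "(if k \<in> W then 1 else 0) = (if k \<in> W' then 1 else (0::nat))"
      using fun_cong[OF eq, of k] that unfolding ind_str_def by (simp only: restrict_apply')
    then show ?thesis by (metis zero_neq_one)
  qed
  then show "W \<inter> {1..n} = W' \<inter> {1..n}" by blast
next
  assume eq: "W \<inter> {1..n} = W' \<inter> {1..n}"
  show "ind_str n W = ind_str n W'" unfolding ind_str_def
  proof (rule restrict_ext)
    fix k assume "k \<in> {1..n}"
    then have "k \<in> W \<longleftrightarrow> k \<in> W'" using eq by blast
    then show "(if k \<in> W then 1 else 0) = (if k \<in> W' then 1 else 0)" by simp
  qed
qed

lemma type_fun_type_set_fun: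
  "type_fun n f \<Longrightarrow> type_set_fun {1..n} (\<lambda>W. f (ind_str n W) = 1)"
proof (induction rule: type_fun.induct)
  case one
  have "type_set_fun {1..1} (\<lambda>W. True)" using type_set_fun.one[of 1] by simp
  then show ?case by (rule type_set_fun.cong) (simp add: one_fun_def)
next
  case (dual n f)
  from type_set_fun.dual[OF dual.IH] show ?case
  proof (rule type_set_fun.cong)
    fix W assume "W \<subseteq> {1..n}"
    then have z: "ind_str n W = zero_str n \<longleftrightarrow> W = {}"
      by (auto simp: zero_str_ind ind_str_eq_iff)
    have "f (ind_str n W) = 0 \<or> f (ind_str n W) = 1" "f (zero_str n) = 1"
      using bool_funsD[OF type_fun_bool_funs[OF dual.hyps]] by simp_all
    then show "(W = {} \<or> f (ind_str n W) \<noteq> 1) = (dual_fun n f (ind_str n W) = 1)"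
      using z by (auto simp: dual_fun_def point_fun_def zero_str_ind)
  qed
next
  case (perm n f \<sigma>)
  have inv: "inv \<sigma> permutes {1..n}" using permutes_inv perm.hyps(2) by blast
  \<comment> \<open>The action precomposes a string with \<open>inv \<sigma>\<close>, so its support
    is pulled back along that map; relabelling by the same map produces this pullback.\<close>
  have "type_set_fun (inv \<sigma> ` {1..n}) (\<lambda>W. f (ind_str n (inv \<sigma> -` W \<inter> {1..n})) = 1)"
    using type_set_fun_image[OF perm.IH] permutes_inj_on[OF inv] by blast
  then have *: "type_set_fun {1..n} (\<lambda>W. f (ind_str n (inv \<sigma> -` W \<inter> {1..n})) = 1)"
    using permutes_image[OF inv] by simp
  have "inv \<sigma> k \<in> {1..n}" if "k \<in> {1..n}" for k
    using permutes_in_image[OF inv] that by blast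
  then have "perm_str n \<sigma> (ind_str n W) = ind_str n (inv \<sigma> -` W \<inter> {1..n})" for W
    unfolding perm_str_def ind_str_def by (intro restrict_ext) simp
  then show ?case using * by (simp add: perm_fun_def)
next
  case (tensor m f n g)
  \<comment> \<open>Sites of the second factor follow those of the first, hence the shift by
    \<open>m\<close>.\<close>
  have img: "(+) m ` {1..n} = {m + 1..m + n}" by simp
  have "type_set_fun {m + 1..m + n} (\<lambda>W. g (ind_str n ((+) m -` W \<inter> {1..n})) = 1)"
    using type_set_fun_image[OF tensor.IH(2), of "(+) m"] unfolding img by simp
  from type_set_fun.tensor[OF tensor.IH(1) this]
  have "type_set_fun ({1..m} \<union> {m + 1..m + n}) (\<lambda>W. f (ind_str m (W \<inter> {1..m})) = 1 \<and>
    g (ind_str n ((+) m -` (W \<inter> {m + 1..m + n}) \<inter> {1..n})) = 1)" by simp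
  moreover have "{1..m} \<union> {m + 1..m + n} = {1..m + n}" by auto
  ultimately have "type_set_fun {1..m + n} (\<lambda>W. f (ind_str m (W \<inter> {1..m})) = 1 \<and>
    g (ind_str n ((+) m -` (W \<inter> {m + 1..m + n}) \<inter> {1..n})) = 1)" by simp
  then show ?case
  proof (rule type_set_fun.cong)
    fix W assume "W \<subseteq> {1..m + n}"
    have 1: "restrict (ind_str (m + n) W) {1..m} = ind_str m (W \<inter> {1..m})"
      unfolding ind_str_def by (auto simp: fun_eq_iff restrict_def)
    have 2: "(\<lambda>k\<in>{1..n}. ind_str (m + n) W (m + k)) = ind_str n ((+) m -` (W \<inter> {m + 1..m + n}) \<inter> {1..n})"
      unfolding ind_str_def by (auto simp: fun_eq_iff restrict_def)
    have "f (ind_str m W') = 0 \<or> f (ind_str m W') = 1" "g (ind_str n W') = 0 \<or> g (ind_str n W') = 1" for W'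
      using bool_funsD(1)[OF type_fun_bool_funs[OF tensor.hyps(1)], of "ind_str m W'"]
        bool_funsD(1)[OF type_fun_bool_funs[OF tensor.hyps(2)], of "ind_str n W'"] by simp_all
    then show "(f (ind_str m (W \<inter> {1..m})) = 1 \<and> g (ind_str n ((+) m -` (W \<inter> {m + 1..m + n}) \<inter> {1..n})) = 1) =
      (tensor_fun m n f g (ind_str (m + n) W) = 1)"
      unfolding tensor_fun_def by (simp only: restrict_apply' ind_str_in_strings 1 2)
        (metis mult_1 mult_zero_left mult_zero_right zero_neq_one)
  qed
qed

section \<open>Expansion coefficients and the structure poset\<close>

lemma mono_fun_ind_str:
  assumes "T \<subseteq> {1..n}"
  shows "mono_fun T (ind_str n W) = (if T \<inter> W = {} then 1 else 0)"
proof -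
  have "mono_fun T (ind_str n W) = (\<Prod>i\<in>T. if i \<in> W then 0 else 1)"
    unfolding mono_fun_def using assms by (intro prod.cong) (auto simp: ind_str_def)
  also have "\<dots> = (if T \<inter> W = {} then 1 else 0)"
  proof (cases "T \<inter> W = {}")
    case True
    then show ?thesis by (simp, intro prod.neutral) auto
  next
    case False
    moreover have "finite T" using assms finite_subset by blast
    ultimately show ?thesis by (auto simp: prod_zero_iff)
  qed
  finally show ?thesis .
qed

text \<open>Evaluating at the indicator of the complement of \<open>T\<close> keeps exactly the coefficients
  of the subsets of \<open>T\<close>.\<close>

lemma expansion_unique:
  fixes c :: "nat set \<Rightarrow> real"
  assumes zero: "\<And>W. W \<subseteq> {1..n} \<Longrightarrow> (\<Sum>T\<in>Pow {1..n}. c T * mono_fun T (ind_str n W)) = 0"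
  shows "T \<subseteq> {1..n} \<Longrightarrow> c T = 0"
proof (induction "card T" arbitrary: T rule: less_induct)
  case less
  have fin: "finite T" using less.prems finite_subset by blast
  have "0 = (\<Sum>S\<in>Pow {1..n}. c S * mono_fun S (ind_str n ({1..n} - T)))"
    by (rule zero[symmetric]) simp
  also have "\<dots> = (\<Sum>S\<in>Pow {1..n}. if S = T then c S else 0)"
  proof (rule sum.cong)
    fix S assume "S \<in> Pow {1..n}"
    then have S: "S \<subseteq> {1..n}" by simp
    show "c S * mono_fun S (ind_str n ({1..n} - T)) = (if S = T then c S else 0)"
    proof (cases "S \<subset> T")
      case True
      then have "card S < card T" using fin psubset_card_mono by blast
      then have "c S = 0" using less.hyps S by blast
      then show ?thesis using True by auto
    next
      case False
      then have "S \<inter> ({1..n} - T) = {} \<longleftrightarrow> S = T" using S less.prems by blast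
      then show ?thesis using mono_fun_ind_str[OF S] by simp
    qed
  qed simp
  finally show ?case using less.prems by simp
qed

lemma coeff_eqI:
  assumes supp: "\<And>T. \<not> T \<subseteq> {1..n} \<Longrightarrow> c T = 0"
    and exp: "\<And>W. W \<subseteq> {1..n} \<Longrightarrow> f (ind_str n W) = (\<Sum>T\<in>Pow {1..n}. c T * mono_fun T (ind_str n W))"
  shows "coeff n f = c"
  unfolding coeff_def
proof (rule the_equality)
  show "(\<forall>T. \<not> T \<subseteq> {1..n} \<longrightarrow> c T = 0) \<and>
    (\<forall>s\<in>strings n. f s = (\<Sum>T\<in>Pow {1..n}. c T * mono_fun T s))"
  proof (intro conjI allI impI ballI)
    fix s assume "s \<in> strings n"
    from strings_eq_ind_str[OF this] obtain W where "s = ind_str n W" "W \<subseteq> {1..n}" by blast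
    then show "f s = (\<Sum>T\<in>Pow {1..n}. c T * mono_fun T s)" using exp by simp
  qed (use supp in simp)
next
  fix d :: "nat set \<Rightarrow> real"
  assume d: "(\<forall>T. \<not> T \<subseteq> {1..n} \<longrightarrow> d T = 0) \<and>
    (\<forall>s\<in>strings n. f s = (\<Sum>T\<in>Pow {1..n}. d T * mono_fun T s))"
  have "d T - c T = 0" if "T \<subseteq> {1..n}" for T
  proof (rule expansion_unique[OF _ that])
    fix W assume W: "W \<subseteq> {1..n}"
    have "f (ind_str n W) = (\<Sum>T\<in>Pow {1..n}. d T * mono_fun T (ind_str n W))" using d by simp
    then show "(\<Sum>T\<in>Pow {1..n}. (d T - c T) * mono_fun T (ind_str n W)) = 0"
      using exp[OF W] by (simp add: left_diff_distrib sum_subtractf)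
  qed
  then show "d = c" using d supp by (intro ext) (metis eq_iff_diff_eq_0)
qed

context type_poset begin

text \<open>By uniqueness of the expansion its coefficients are the signs
  \<open>weight P \<tau>\<close>, which vanish exactly off \<open>P\<close>.\<close>

lemma poset_eq:
  assumes V: "V = {1..n}" and F: "\<And>W. W \<subseteq> {1..n} \<Longrightarrow> f (ind_str n W) = (if F W then 1 else 0)"
  shows "poset n f = P"
proof -
  have "coeff n f = (\<lambda>T. real_of_int (weight P \<tau> T))"
  proof (rule coeff_eqI)
    fix T assume "\<not> T \<subseteq> {1..n}"
    then show "real_of_int (weight P \<tau> T) = 0" using P_subset V by (auto simp: weight_def)
  next
    fix W assume W: "W \<subseteq> {1..n}"
    have "f (ind_str n W) = real_of_int (if F W then 1 else 0)" using F[OF W] by simp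
    also have "\<dots> = real_of_int (\<Sum>T\<in>Pow {1..n}. if T \<inter> W = {} then weight P \<tau> T else 0)"
      using expansion W V by simp
    also have "\<dots> = (\<Sum>T\<in>Pow {1..n}. real_of_int (weight P \<tau> T) * mono_fun T (ind_str n W))"
      unfolding of_int_sum by (rule sum.cong) (simp_all add: mono_fun_ind_str)
    finally show "f (ind_str n W) = (\<Sum>T\<in>Pow {1..n}. real_of_int (weight P \<tau> T) * mono_fun T (ind_str n W))" .
  qed
  then show ?thesis using P_subset V unfolding poset_def by (auto simp: weight_def split: if_splits)
qed

section \<open>Ranks given by definite descriptions\<close>

lemma ex_cover_below:
  assumes "T \<in> P" "S \<in> P" "S \<subset> T"
  shows "\<exists>S. covered_by P S T"
proof -
  have "finite {S\<in>P. S \<subset> T}" "{S\<in>P. S \<subset> T} \<noteq> {}" using assms Q_simps(6) by auto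
  from finite_has_maximal[OF this] obtain U where "U \<in> {S\<in>P. S \<subset> T}"
    and max: "\<forall>R\<in>{S\<in>P. S \<subset> T}. U \<subseteq> R \<longrightarrow> U = R" by blast
  then have U: "U \<in> P" "U \<subset> T" by simp_all
  have "\<not> (U \<subset> R \<and> R \<subset> T)" if "R \<in> P" for R using max that by (metis (mono_tags) mem_Collect_eq psubset_eq)
  then show ?thesis using U assms(1) unfolding covered_by_def by blast
qed

text \<open>A member that is not minimal covers another one, so the values on minimal members and
  the steps along covers determine the rank by induction on cardinality.\<close>

lemma rank_fun_eq: "T \<in> P \<Longrightarrow> rank_fun P T = nat (\<tau> T)"
proof -
  assume T: "T \<in> P"
  have "rank_fun P = (\<lambda>T. if T \<in> P then nat (\<tau> T) else 0)"
    unfolding rank_fun_def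
  proof (rule the_equality, intro conjI allI impI ballI)
    fix S T assume c: "covered_by P S T"
    then have "S \<in> P" "T \<in> P" by (auto simp: covered_by_def)
    then show "(if T \<in> P then nat (\<tau> T) else 0) = (if S \<in> P then nat (\<tau> S) else 0) + 1"
      using cover_P[OF c] rank_nonneg[of S] by simp
  next
    fix T assume "T \<in> P" "\<not> (\<exists>S\<in>P. S \<subset> T)"
    then show "(if T \<in> P then nat (\<tau> T) else 0) = 0" using minimal_rank[of T] by auto
  next
    fix \<rho> :: "nat set \<Rightarrow> nat"
    assume \<rho>: "(\<forall>T. T \<notin> P \<longrightarrow> \<rho> T = 0) \<and> (\<forall>T\<in>P. \<not> (\<exists>S\<in>P. S \<subset> T) \<longrightarrow> \<rho> T = 0) \<and>
      (\<forall>S T. covered_by P S T \<longrightarrow> \<rho> T = \<rho> S + 1)"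
    have "\<rho> T = nat (\<tau> T)" if "T \<in> P" for T
      using that
    proof (induction "card T" arbitrary: T rule: less_induct)
      case less
      show ?case
      proof (cases "\<exists>S\<in>P. S \<subset> T")
        case False
        then show ?thesis using \<rho> less.prems minimal_rank[of T] by auto
      next
        case True
        then obtain S where S: "covered_by P S T" using ex_cover_below less.prems by blast
        then have "S \<in> P" "S \<subset> T" by (auto simp: covered_by_def)
        then have "\<rho> S = nat (\<tau> S)"
          using less.hyps finite_elt Q_simps(3) less.prems psubset_card_mono by blast
        then show ?thesis using \<rho> S cover_P[OF S] rank_nonneg[OF \<open>S \<in> P\<close>] by simp
      qed
    qed
    then show "\<rho> = (\<lambda>T. if T \<in> P then nat (\<tau> T) else 0)" using \<rho> by (intro ext) simp
  qed simp
  then show ?thesis using T by simp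
qed

text \<open>A maximal chain starts at a minimal member, ends at a maximal one and climbs by covers,
  so it skips no rank. With ranks injective on chains this fixes the length of maximal
  chains.\<close>

lemma maxchain_image:
  assumes C: "subset.maxchain P C"
  shows "\<tau> ` C = {0..r}"
proof -
  have CP: "C \<subseteq> P" and chain: "\<And>S T. S \<in> C \<Longrightarrow> T \<in> C \<Longrightarrow> S \<subset> T \<or> S = T \<or> T \<subset> S"
    using C by (auto simp: subset.maxchain_def subset.chain_def)
  have ext: "X \<in> C" if "X \<in> P" "\<And>S. S \<in> C \<Longrightarrow> S \<subseteq> X \<or> X \<subseteq> S" for X
  proof (rule ccontr)
    assume "X \<notin> C"
    have "subset.chain P (insert X C)"
      using C that unfolding subset_chain_insert subset.maxchain_def by blast
    then show False using C \<open>X \<notin> C\<close> unfolding subset.maxchain_def by blast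
  qed
  have finC: "finite C" using CP Q_simps(6) finite_subset by blast
  have fin: "finite S" if "S \<in> C" for S using that CP Q_simps(3) finite_elt by blast
  have all: "int k \<le> r \<Longrightarrow> int k \<in> \<tau> ` C" for k
  proof (induction k)
    case 0
    obtain X where "X \<in> P" using P_nonempty by blast
    have "C \<noteq> {}" using ext[OF \<open>X \<in> P\<close>] by blast
    then obtain S where S: "S \<in> C" and min: "\<forall>R\<in>C. R \<subseteq> S \<longrightarrow> S = R"
      using finite_has_minimal[OF finC] by blast
    have "\<not> R \<subset> S" if R: "R \<in> P" for R
    proof
      assume RS: "R \<subset> S"
      have "R \<in> C"
      proof (rule ext[OF R])
        fix T assume "T \<in> C"
        then have "S \<subseteq> T" using chain[OF S \<open>T \<in> C\<close>] min by blast
        then show "T \<subseteq> R \<or> R \<subseteq> T" using RS by blast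
      qed
      then show False using min RS by blast
    qed
    then have "\<tau> S = 0" using minimal_rank[of S] S CP by blast
    then show ?case using S by (intro image_eqI[of _ _ S]) simp_all
  next
    case (Suc k)
    then have "int k \<in> \<tau> ` C" by simp
    then obtain S where "int k = \<tau> S" "S \<in> C" by (rule imageE)
    then have S: "S \<in> C" "\<tau> S = int k" by simp_all
    then have "\<tau> S \<noteq> r" using Suc.prems by simp
    \<comment> \<open>A greatest element of the chain could not be exceeded in \<open>P\<close>, as
      the chain would extend; it would be maximal and so of rank \<open>r\<close>.\<close>
    have "\<exists>T\<in>C. S \<subset> T"
    proof (rule ccontr)
      assume no: "\<not> (\<exists>T\<in>C. S \<subset> T)"
      have below: "T \<subseteq> S" if T: "T \<in> C" for T
        using chain[OF S(1) T]
      proof (elim disjE)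
        assume "S \<subset> T"
        then show ?thesis using no T by blast
      qed (simp_all add: psubset_eq)
      have "\<not> S \<subset> R" if R: "R \<in> P" for R
      proof
        assume "S \<subset> R"
        have "R \<in> C"
        proof (rule ext[OF R])
          fix T assume "T \<in> C"
          then show "T \<subseteq> R \<or> R \<subseteq> T" using below \<open>S \<subset> R\<close> by blast
        qed
        then show False using no \<open>S \<subset> R\<close> by blast
      qed
      then show False using maximal_rank[of S] S CP \<open>\<tau> S \<noteq> r\<close> by blast
    qed
    then have "finite {T\<in>C. S \<subset> T}" "{T\<in>C. S \<subset> T} \<noteq> {}" using finC by auto
    from finite_has_minimal[OF this] obtain T where "T \<in> {T\<in>C. S \<subset> T}"
      and min: "\<forall>R\<in>{T\<in>C. S \<subset> T}. R \<subseteq> T \<longrightarrow> T = R" by blast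
    then have T: "T \<in> C" "S \<subset> T" by simp_all
    have "covered_by P S T"
      unfolding covered_by_def
    proof (intro conjI notI)
      assume "\<exists>U\<in>P. S \<subset> U \<and> U \<subset> T"
      then obtain U where U: "U \<in> P" "S \<subset> U" "U \<subset> T" by blast
      have "U \<in> C"
      proof (rule ext[OF U(1)])
        fix R assume R: "R \<in> C"
        consider "R \<subseteq> S" | "S \<subset> R" using chain[OF S(1) R] by blast
        then show "R \<subseteq> U \<or> U \<subseteq> R"
        proof cases
          case 2
          then have "T \<subseteq> R" using chain[OF T(1) R] min R by blast
          then show ?thesis using U by blast
        qed (use U in blast)
      qed
      then have "T = U" using min U by blast
      then show False using U by blast
    qed (use S T CP in blast)+
    then have "\<tau> T = int (Suc k)" using cover_P S(2) by simp
    then show ?case using T(1) by (intro image_eqI[of _ _ T]) simp_all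
  qed
  show ?thesis
  proof (intro equalityI subsetI)
    fix x assume "x \<in> \<tau> ` C"
    then obtain S where "S \<in> P" "x = \<tau> S" using CP by blast
    then show "x \<in> {0..r}" using rank_nonneg rank_le by simp
  next
    fix x assume "x \<in> {0..r}"
    then show "x \<in> \<tau> ` C" using all[of "nat x"] by simp
  qed
qed

lemma poset_rank_eq: "poset_rank P = nat r"
  unfolding poset_rank_def
proof (rule the_equality)
  have card: "card C = nat r + 1" if C: "subset.maxchain P C" for C
  proof -
    have CP: "C \<subseteq> P" and chain: "\<And>S T. S \<in> C \<Longrightarrow> T \<in> C \<Longrightarrow> S \<subset> T \<or> S = T \<or> T \<subset> S"
      using C by (auto simp: subset.maxchain_def subset.chain_def)
    have "inj_on \<tau> C"
    proof (rule inj_onI)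
      fix S T assume ST: "S \<in> C" "T \<in> C" "\<tau> S = \<tau> T"
      then have "S \<in> Q" "T \<in> Q" using CP Q_simps(3) by blast+
      then show "S = T" using chain[OF ST(1,2)] rank_strict_mono[of S T] rank_strict_mono[of T S] ST(3) by auto
    qed
    then have "card C = card {0..r}" using card_image maxchain_image[OF C] by fastforce
    then show ?thesis using top_rank_nonneg by simp
  qed
  then show "\<forall>C. subset.maxchain P C \<longrightarrow> card C = nat r + 1" by blast
  fix k assume "\<forall>C. subset.maxchain P C \<longrightarrow> card C = k + 1"
  \<comment> \<open>Without a maximal chain the describing condition would hold vacuously for every
    number.\<close>
  moreover obtain C where "subset.maxchain P C" using subset.Hausdorff by blast
  ultimately show "k = nat r" using card by force
qed

text \<open>The cases of the definition are the ways in which the maximum over the extension arises: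
  at the node of \<open>i\<close> when \<open>j\<close> is free, at an adjoined bottom when
  \<open>P\<close> offers no meet, and at a meet in \<open>P\<close> otherwise.\<close>

lemma pair_rank_parity:
  assumes V: "V = {1..n}" and F: "\<And>W. W \<subseteq> {1..n} \<Longrightarrow> f (ind_str n W) = (if F W then 1 else 0)"
    and ij: "i \<in> V" "j \<in> V" "\<not> F {i}" "F {j}"
  shows "even (pair_rank n f i j) \<longleftrightarrow> \<not> F {i, j}"
proof -
  have P: "poset n f = P" by (rule poset_eq[OF V F])
  have nf: "\<not> free_output P i" using nonfree_input ij by blast
  have odd: "F {i, j} \<longleftrightarrow> odd (Max (meet_values Q \<tau> i j))" by (rule pair_parity[OF ij])
  have meet_ranks: "int ` meet_ranks P i j = meet_values P \<tau> i j"
  proof -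
    have "rank_fun P M = nat (\<tau> M) \<and> 0 \<le> \<tau> M" if "is_meet P S T M" for S T M
      using that rank_fun_eq rank_nonneg by (simp add: is_meet_def)
    then have "int (rank_fun P M) = \<tau> M" if "is_meet P S T M" for S T M
      using that by simp
    then show ?thesis unfolding meet_ranks_def meet_values_def by (force simp: image_iff)
  qed
  show ?thesis
  proof (cases "free_output P j")
    case True
    obtain S where S: "S \<in> label_nodes P i" using nf unfolding free_output_def by blast
    then have SP: "S \<in> P" and SQ: "S \<in> label_nodes Q i"
      using label_nodes_nonfree[OF nf] by (simp_all add: mem_label_nodes)
    have const: "rank_fun P T = nat (\<tau> S)" if "T \<in> label_nodes P i" for T
      using rank_fun_eq[of T] label_rank[OF ij(1) _ SQ, of T] that label_nodes_nonfree[OF nf]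
      by (simp add: mem_label_nodes)
    have "(THE r. \<forall>T\<in>label_nodes P i. rank_fun P T = r) = nat (\<tau> S)"
      using const S by (intro the_equality) auto
    then have i: "index_rank P i = nat (\<tau> S)" using nf by (simp add: index_rank_def)
    have j: "index_rank P j = nat r + 1" using True by (simp add: index_rank_def poset_rank_eq)
    have "nat (\<tau> S) \<le> nat r" using rank_le[OF SP] by simp
    moreover have "meet_ranks P i j = {}"
      using True by (simp add: meet_ranks_def free_output_def)
    ultimately have "pair_rank n f i j = int (nat (\<tau> S))"
      using True by (simp add: pair_rank_def P i j)
    then have pr: "pair_rank n f i j = \<tau> S" using rank_nonneg[OF SP] by simp
    have "Max (meet_values Q \<tau> i j) \<in> \<tau> ` label_nodes Q i"
      using Max_in[OF finite_meet_values meet_values_nonempty[OF ij(1,2)]]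
        meet_values_free_image[OF ij(2) True] by simp
    then obtain T where "T \<in> label_nodes Q i" "Max (meet_values Q \<tau> i j) = \<tau> T" by blast
    then have "Max (meet_values Q \<tau> i j) = \<tau> S" using label_rank[OF ij(1) _ SQ, of T] by simp
    then show ?thesis using odd pr by simp
  next
    case nfj: False
    have eq: "insert (-1) (meet_values Q \<tau> i j) = insert (-1) (int ` meet_ranks P i j)"
      unfolding meet_ranks using insert_meet_values[where \<tau> = \<tau>, OF nf nfj] bottom by simp
    have fin: "finite (meet_ranks P i j)"
      using finite_meet_values[of \<tau> i j] eq by (metis finite_imageD finite_insert inj_on_of_nat)
    have Max: "Max (meet_values Q \<tau> i j) = Max (insert (-1) (int ` meet_ranks P i j))"
    proof -
      obtain U where "U \<in> Q" "Max (meet_values Q \<tau> i j) = \<tau> U"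
        using Max_in[OF finite_meet_values meet_values_nonempty[OF ij(1,2)]]
          meet_values_subset[of \<tau> i j] by blast
      then have "-1 \<le> Max (meet_values Q \<tau> i j)" using rank_ge by simp
      then have "Max (meet_values Q \<tau> i j) = Max (insert (-1) (meet_values Q \<tau> i j))"
        using finite_meet_values meet_values_nonempty[OF ij(1,2)] by (subst Max_insert) auto
      then show ?thesis unfolding eq .
    qed
    show ?thesis
    proof (cases "meet_ranks P i j = {}")
      case True
      \<comment> \<open>Only -1 remains after the insertion, so the default value agrees with the
        maximum over the extension.\<close>
      then have "pair_rank n f i j = -1" using nf nfj by (simp add: pair_rank_def P)
      then show ?thesis using odd Max True by simp
    next
      case False
      have "Max (int ` meet_ranks P i j) = int (Max (meet_ranks P i j))"
        using fin False by (intro mono_Max_commute[symmetric]) (auto simp: mono_def)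
      then have "Max (insert (-1) (int ` meet_ranks P i j)) = int (Max (meet_ranks P i j))"
        using fin False by (subst Max_insert) auto
      moreover have "pair_rank n f i j = int (Max (meet_ranks P i j))"
        using False by (simp add: pair_rank_def P)
      ultimately show ?thesis using odd Max by simp
    qed
  qed
qed

end

text \<open>Everything the operator part needs; the poset enters it only through
  \<open>pair_rank\<close>.\<close>

lemma type_fun_combinatorics:
  assumes "type_fun n f"
  obtains F where "\<And>W. f (ind_str n W) = (if F W then 1 else 0)" "F {}"
    "\<And>i W. i \<in> {1..n} \<Longrightarrow> \<not> F {i} \<Longrightarrow> W \<subseteq> {1..n} \<Longrightarrow> F (insert i W) \<Longrightarrow> F W"
    "\<And>i j. i \<in> {1..n} \<Longrightarrow> j \<in> {1..n} \<Longrightarrow> \<not> F {i} \<Longrightarrow> F {j} \<Longrightarrow>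
      even (pair_rank n f i j) \<longleftrightarrow> \<not> F {i, j}"
proof -
  define F where "F W \<longleftrightarrow> f (ind_str n W) = 1" for W
  have f: "f (ind_str n W) = (if F W then 1 else 0)" for W
    using bool_funsD(1)[OF type_fun_bool_funs[OF assms], of "ind_str n W"] by (auto simp: F_def)
  have "type_set_fun {1..n} F"
    using type_fun_type_set_fun[OF assms] unfolding F_def by simp
  then obtain P \<tau> where "type_poset {1..n} P \<tau> F" using type_set_fun_type_poset by blast
  then interpret type_poset "{1..n}" P \<tau> F .
  show ?thesis using that[OF f F_empty] F_input pair_rank_parity[OF refl f] by blast
qed

section \<open>Operators on composite systems\<close>

lemma sum_fun_apply2: "(\<Sum>k\<in>A. g k) x y = (\<Sum>k\<in>A. g k x y)"
  by (induction A rule: infinite_finite_induct) (simp_all add: zero_fun_def plus_fun_def)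

section \<open>Product bases\<close>

lemma finite_basis: "finite S \<Longrightarrow> finite (basis d S)"
  by (simp add: basis_def finite_PiE)

lemma basis_memD: "x \<in> basis d S \<Longrightarrow> k \<in> S \<Longrightarrow> x k < d k"
  by (auto simp: basis_def PiE_iff)

lemma basis_arb: "x \<in> basis d S \<Longrightarrow> k \<notin> S \<Longrightarrow> x k = undefined"
  unfolding basis_def by (rule PiE_arb)

lemma basisI: "(\<And>k. k \<in> S \<Longrightarrow> x k < d k) \<Longrightarrow> (\<And>k. k \<notin> S \<Longrightarrow> x k = undefined) \<Longrightarrow> x \<in> basis d S"
  unfolding basis_def by (rule PiE_I) simp_all

lemma basis_eqI: "x \<in> basis d S \<Longrightarrow> y \<in> basis d S \<Longrightarrow> (\<And>k. k \<in> S \<Longrightarrow> x k = y k) \<Longrightarrow> x = y"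
  unfolding basis_def by (rule PiE_ext)

lemma restrict_basis: "x \<in> basis d S \<Longrightarrow> T \<subseteq> S \<Longrightarrow> restrict x T \<in> basis d T"
  by (rule basisI) (auto intro: basis_memD)

lemma override_basis: "x \<in> basis d S \<Longrightarrow> z \<in> basis d T \<Longrightarrow> override_on x z T \<in> basis d (S \<union> T)"
  by (rule basisI) (auto simp: override_on_def intro: basis_memD basis_arb)

lemma upd_basis: "x \<in> basis d S \<Longrightarrow> i \<in> S \<Longrightarrow> b < d i \<Longrightarrow> x(i := b) \<in> basis d S"
  by (rule basisI) (auto intro: basis_memD basis_arb)

lemma restrict_override:
  assumes "x \<in> basis d S" "z \<in> basis d T" "S \<inter> T = {}"
  shows "restrict (override_on x z T) S = x" "restrict (override_on x z T) T = z"
proof -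
  show "restrict (override_on x z T) S = x"
  proof (rule ext)
    fix k show "restrict (override_on x z T) S k = x k"
      using assms(3) basis_arb[OF assms(1), of k] by (cases "k \<in> S") (auto simp: override_on_def)
  qed
  show "restrict (override_on x z T) T = z"
  proof (rule ext)
    fix k show "restrict (override_on x z T) T k = z k"
      using basis_arb[OF assms(2), of k] by (cases "k \<in> T") (auto simp: override_on_def)
  qed
qed

lemma override_restrict:
  assumes "w \<in> basis d (S \<union> T)"
  shows "override_on (restrict w S) (restrict w T) T = w"
proof (rule ext)
  fix k show "override_on (restrict w S) (restrict w T) T k = w k"
    using basis_arb[OF assms, of k] by (cases "k \<in> T"; cases "k \<in> S") (auto simp: override_on_def)
qed

lemma sum_basis_Un:
  assumes "S \<inter> T = {}"
  shows "(\<Sum>x\<in>basis d S. \<Sum>z\<in>basis d T. g (override_on x z T)) = (\<Sum>w\<in>basis d (S \<union> T). g w)"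
proof -
  have "(\<Sum>x\<in>basis d S. \<Sum>z\<in>basis d T. g (override_on x z T)) =
    (\<Sum>(x, z)\<in>basis d S \<times> basis d T. g (override_on x z T))"
    by (simp add: sum.cartesian_product)
  also have "\<dots> = (\<Sum>w\<in>basis d (S \<union> T). g w)"
  proof (rule sum.reindex_bij_witness[where j = "\<lambda>(x, z). override_on x z T"
        and i = "\<lambda>w. (restrict w S, restrict w T)"])
    fix p assume "p \<in> basis d S \<times> basis d T"
    then obtain x z where p: "p = (x, z)" "x \<in> basis d S" "z \<in> basis d T" by auto
    show "(restrict (case p of (x, z) \<Rightarrow> override_on x z T) S, restrict (case p of (x, z) \<Rightarrow> override_on x z T) T) = p"
      using restrict_override[OF p(2,3) assms] p(1) by simp
    show "(case p of (x, z) \<Rightarrow> override_on x z T) \<in> basis d (S \<union> T)"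
      using override_basis p by simp
    show "g (case p of (x, z) \<Rightarrow> override_on x z T) = (case p of (x, z) \<Rightarrow> g (override_on x z T))"
      using p(1) by simp
  next
    fix w assume w: "w \<in> basis d (S \<union> T)"
    show "(case (restrict w S, restrict w T) of (x, z) \<Rightarrow> override_on x z T) = w"
      using override_restrict[OF w] by simp
    show "(restrict w S, restrict w T) \<in> basis d S \<times> basis d T"
      using restrict_basis[OF w] by simp
  qed
  finally show ?thesis .
qed

lemma sum_basis_prod:
  fixes g :: "nat \<Rightarrow> nat \<Rightarrow> 'a::comm_semiring_1"
  assumes "finite S"
  shows "(\<Sum>x\<in>basis d S. \<Prod>k\<in>S. g k (x k)) = (\<Prod>k\<in>S. \<Sum>b<d k. g k b)"
  unfolding basis_def using assms by (intro prod_sum_PiE[symmetric]) simp_all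

lemma card_basis: "finite S \<Longrightarrow> card (basis (\<lambda>_. 2) S) = 2 ^ card S"
  by (simp add: basis_def card_PiE)

section \<open>Positive operators\<close>

lemma sum_nonneg_Reals: "(\<And>x. x \<in> A \<Longrightarrow> g x \<in> (nonneg_Reals :: complex set)) \<Longrightarrow> (\<Sum>x\<in>A. g x) \<in> nonneg_Reals"
  by (induction A rule: infinite_finite_induct) simp_all

lemma positive_opr_sum:
  assumes "\<And>z. z \<in> Z \<Longrightarrow> positive_opr J (A z)"
  shows "positive_opr J (\<lambda>x y. \<Sum>z\<in>Z. A z x y)"
proof -
  have "(\<Sum>x\<in>J. \<Sum>y\<in>J. cnj (v x) * (\<Sum>z\<in>Z. A z x y) * v y) \<in> nonneg_Reals" for v
  proof -
    have "(\<Sum>x\<in>J. \<Sum>y\<in>J. cnj (v x) * (\<Sum>z\<in>Z. A z x y) * v y) =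
      (\<Sum>x\<in>J. \<Sum>y\<in>J. \<Sum>z\<in>Z. cnj (v x) * A z x y * v y)"
      by (simp add: sum_distrib_left sum_distrib_right)
    also have "\<dots> = (\<Sum>x\<in>J. \<Sum>z\<in>Z. \<Sum>y\<in>J. cnj (v x) * A z x y * v y)"
      by (intro sum.cong refl) (rule sum.swap)
    also have "\<dots> = (\<Sum>z\<in>Z. \<Sum>x\<in>J. \<Sum>y\<in>J. cnj (v x) * A z x y * v y)"
      by (rule sum.swap)
    also have "\<dots> \<in> nonneg_Reals"
      by (rule sum_nonneg_Reals) (use assms in \<open>simp add: positive_opr_def\<close>)
    finally show ?thesis .
  qed
  moreover have "(\<lambda>x y. \<Sum>z\<in>Z. A z x y) \<in> operators J"
    using assms by (auto simp: positive_opr_def operators_def intro!: sum.neutral)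
  ultimately show ?thesis by (simp add: positive_opr_def)
qed

lemma positive_opr_scale:
  assumes "positive_opr J A" "0 \<le> r"
  shows "positive_opr J (\<lambda>x y. of_real r * A x y)"
proof -
  have "(\<Sum>x\<in>J. \<Sum>y\<in>J. cnj (v x) * (of_real r * A x y) * v y) =
    of_real r * (\<Sum>x\<in>J. \<Sum>y\<in>J. cnj (v x) * A x y * v y)" for v
    by (simp add: sum_distrib_left mult_ac)
  then show ?thesis using assms by (auto simp: positive_opr_def operators_def)
qed

text \<open>The quadratic form of \<open>B\<close> at \<open>v\<close> is that of \<open>A\<close>
  at \<open>v\<close> transported along \<open>g\<close> and extended by zero. Compressions,
  embeddings and placements of blocks are all of this form.\<close>

lemma positive_opr_pullback:
  assumes A: "positive_opr J A" and fin: "finite J" "finite K" and K': "K' \<subseteq> K" "inj_on g K'" "g ` K' \<subseteq> J"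
    and B: "\<And>x y. B x y = (if x \<in> K' \<and> y \<in> K' then A (g x) (g y) else 0)"
  shows "positive_opr K B"
proof -
  have "(\<Sum>x\<in>K. \<Sum>y\<in>K. cnj (v x) * B x y * v y) \<in> nonneg_Reals" for v
  proof -
    define w where "w p = (if p \<in> g ` K' then v (inv_into K' g p) else 0)" for p
    have w: "w (g x) = v x" if "x \<in> K'" for x
      using that K'(2) by (simp add: w_def)
    have "(\<Sum>x\<in>K. \<Sum>y\<in>K. cnj (v x) * B x y * v y) = (\<Sum>x\<in>K'. \<Sum>y\<in>K. cnj (v x) * B x y * v y)"
      using fin(2) K'(1) B by (intro sum.mono_neutral_right) auto
    also have "\<dots> = (\<Sum>x\<in>K'. \<Sum>y\<in>K'. cnj (v x) * B x y * v y)"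
      using fin(2) K'(1) B by (intro sum.cong refl sum.mono_neutral_right) auto
    also have "\<dots> = (\<Sum>x\<in>K'. \<Sum>y\<in>K'. cnj (w (g x)) * A (g x) (g y) * w (g y))"
      using B w by (intro sum.cong refl) simp
    also have "\<dots> = (\<Sum>x\<in>K'. \<Sum>q\<in>g ` K'. cnj (w (g x)) * A (g x) q * w q)"
      by (simp add: sum.reindex[OF K'(2)])
    also have "\<dots> = (\<Sum>p\<in>g ` K'. \<Sum>q\<in>g ` K'. cnj (w p) * A p q * w q)"
      by (simp add: sum.reindex[OF K'(2), of "\<lambda>p. \<Sum>q\<in>g ` K'. cnj (w p) * A p q * w q"])
    also have "\<dots> = (\<Sum>p\<in>g ` K'. \<Sum>q\<in>J. cnj (w p) * A p q * w q)"
      using fin(1) K'(3) by (intro sum.cong refl sum.mono_neutral_left) (auto simp: w_def)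
    also have "\<dots> = (\<Sum>p\<in>J. \<Sum>q\<in>J. cnj (w p) * A p q * w q)"
      using fin(1) K'(3) by (intro sum.mono_neutral_left) (auto simp: w_def)
    also have "\<dots> \<in> nonneg_Reals" using A by (simp add: positive_opr_def)
    finally show ?thesis .
  qed
  moreover have "B \<in> operators K" using K'(1) B by (auto simp: operators_def)
  ultimately show ?thesis by (simp add: positive_opr_def)
qed

lemma positive_opr_diagonal:
  assumes "finite J" "\<And>x. x \<in> J \<Longrightarrow> 0 \<le> r x"
    and B: "\<And>x y. B x y = (if x \<in> J \<and> x = y then of_real (r x) else 0)"
  shows "positive_opr J B"
proof -
  have "(\<Sum>x\<in>J. \<Sum>y\<in>J. cnj (v x) * B x y * v y) \<in> nonneg_Reals" for v
  proof (rule sum_nonneg_Reals)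
    fix x assume x: "x \<in> J"
    have "(\<Sum>y\<in>J. cnj (v x) * B x y * v y) = (\<Sum>y\<in>J. if y = x then of_real (r x) * (cnj (v x) * v x) else 0)"
      using B x by (intro sum.cong) auto
    also have "\<dots> = of_real (r x) * (cnj (v x) * v x)" using assms(1) x by simp
    also have "cnj (v x) * v x = of_real ((cmod (v x))\<^sup>2)"
      by (simp only: complex_norm_square mult.commute)
    finally show "(\<Sum>y\<in>J. cnj (v x) * B x y * v y) \<in> nonneg_Reals"
      using assms(2)[OF x] by (simp flip: of_real_mult of_real_power)
  qed
  moreover have "B \<in> operators J" using B by (auto simp: operators_def)
  ultimately show ?thesis by (simp add: positive_opr_def)
qed

section \<open>Choi operators and partial traces\<close>

lemma choi_entry:
  assumes "finite S" "x \<in> basis d (S \<union> T)" "y \<in> basis d (S \<union> T)"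
  shows "choi d S T \<Phi> x y =
    \<Phi> (unit_opr (restrict x S) (restrict y S)) (restrict x T) (restrict y T)"
proof -
  let ?k = "restrict x S" and ?l = "restrict y S"
  have kl: "?k \<in> basis d S" "?l \<in> basis d S" using restrict_basis assms by blast+
  have "choi d S T \<Phi> x y = (\<Sum>k\<in>basis d S. \<Sum>l\<in>basis d S.
      if k = ?k then if l = ?l then \<Phi> (unit_opr k l) (restrict x T) (restrict y T) else 0 else 0)"
    unfolding choi_def sum_fun_apply2 using assms
    by (intro sum.cong refl) (auto simp: tensor_opr_def unit_opr_def)
  also have "\<dots> = (\<Sum>k\<in>basis d S. if k = ?k then \<Sum>l\<in>basis d S.
      if l = ?l then \<Phi> (unit_opr k l) (restrict x T) (restrict y T) else 0 else 0)"
    by (intro sum.cong refl) simp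
  also have "\<dots> = \<Phi> (unit_opr ?k ?l) (restrict x T) (restrict y T)"
    using kl finite_basis[OF assms(1)] by simp
  finally show ?thesis .
qed

lemma choi_zero: "x \<notin> basis d (S \<union> T) \<or> y \<notin> basis d (S \<union> T) \<Longrightarrow> choi d S T \<Phi> x y = 0"
  unfolding choi_def sum_fun_apply2 by (intro sum.neutral ballI) (auto simp: tensor_opr_def)

lemma ptrace_operators: "ptrace_opr d S T A \<in> operators (basis d S)"
  by (auto simp: ptrace_opr_def operators_def)

lemma ptrace_add: "ptrace_opr d S T (A + B) = ptrace_opr d S T A + ptrace_opr d S T B"
  by (intro ext) (simp add: ptrace_opr_def plus_fun_def sum.distrib)

lemma ptrace_scale: "ptrace_opr d S T (scale_opr c A) = scale_opr c (ptrace_opr d S T A)"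
  by (intro ext) (simp add: ptrace_opr_def scale_opr_def sum_distrib_left)

lemma trace_ptrace:
  assumes "S \<inter> T = {}"
  shows "trace_opr (basis d S) (ptrace_opr d S T A) = trace_opr (basis d (S \<union> T)) A"
  unfolding trace_opr_def sum_basis_Un[OF assms, symmetric] by (simp add: ptrace_opr_def)

lemma ptrace_elem_tensor:
  assumes ST: "S \<inter> T = {}" "S \<union> T = {1..n}" and xy: "x \<in> basis d S" "y \<in> basis d S"
  shows "ptrace_opr d S T (elem_tensor n d A) x y =
    (\<Prod>k\<in>S. A k (x k) (y k)) * (\<Prod>k\<in>T. trace_opr {..<d k} (A k))"
proof -
  have fin: "finite S" "finite T" using ST(2) by (metis finite_Un finite_atLeastAtMost)+
  have entry: "elem_tensor n d A (override_on x z T) (override_on y z T) =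
      (\<Prod>k\<in>S. A k (x k) (y k)) * (\<Prod>k\<in>T. A k (z k) (z k))" if z: "z \<in> basis d T" for z
  proof -
    have "override_on x z T \<in> basis d {1..n}" "override_on y z T \<in> basis d {1..n}"
      using override_basis[OF _ z, of _ S] xy unfolding ST(2) by simp_all
    then have "elem_tensor n d A (override_on x z T) (override_on y z T) =
      (\<Prod>k\<in>S \<union> T. A k (override_on x z T k) (override_on y z T k))"
      by (simp add: elem_tensor_def ST(2))
    also have "\<dots> = (\<Prod>k\<in>S. A k (override_on x z T k) (override_on y z T k)) *
        (\<Prod>k\<in>T. A k (override_on x z T k) (override_on y z T k))"
      using fin ST(1) by (rule prod.union_disjoint)
    also have "\<dots> = (\<Prod>k\<in>S. A k (x k) (y k)) * (\<Prod>k\<in>T. A k (z k) (z k))"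
      using ST(1) by (intro arg_cong2[where f = times] prod.cong refl) (auto simp: override_on_def)
    finally show ?thesis .
  qed
  have "ptrace_opr d S T (elem_tensor n d A) x y =
      (\<Sum>z\<in>basis d T. (\<Prod>k\<in>S. A k (x k) (y k)) * (\<Prod>k\<in>T. A k (z k) (z k)))"
    using xy entry by (simp add: ptrace_opr_def)
  also have "\<dots> = (\<Prod>k\<in>S. A k (x k) (y k)) * (\<Sum>z\<in>basis d T. \<Prod>k\<in>T. A k (z k) (z k))"
    by (simp add: sum_distrib_left)
  also have "(\<Sum>z\<in>basis d T. \<Prod>k\<in>T. A k (z k) (z k)) = (\<Prod>k\<in>T. trace_opr {..<d k} (A k))"
    unfolding trace_opr_def by (rule sum_basis_prod[OF fin(2), where g = "\<lambda>k b. A k b b"])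
  finally show ?thesis .
qed

text \<open>The partial trace of \<open>C\<close> over \<open>T\<close> has the identity as its tensor factor at site \<open>i\<close>.\<close>

definition identity_at :: "(nat \<Rightarrow> nat) \<Rightarrow> nat set \<Rightarrow> nat set \<Rightarrow> nat \<Rightarrow> midx opr \<Rightarrow> bool" where
  "identity_at d S T i C \<longleftrightarrow> (\<forall>x\<in>basis d S. \<forall>y\<in>basis d S. ptrace_opr d S T C x y =
    (if x i = y i then ptrace_opr d S T C (x(i := 0)) (y(i := 0)) else 0))"

text \<open>The condition is linear in \<open>C\<close>, so it suffices to check it on the product
  operators that span the string spaces.\<close>

lemma subspace_identity_at: "real_opr.subspace {C. identity_at d S T i C}"
proof (rule real_opr.subspaceI)
  show "0 \<in> {C. identity_at d S T i C}"
    by (simp add: identity_at_def ptrace_opr_def)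
next
  fix A B assume "A \<in> {C. identity_at d S T i C}" "B \<in> {C. identity_at d S T i C}"
  then show "A + B \<in> {C. identity_at d S T i C}"
    by (simp add: identity_at_def ptrace_add)
next
  fix c A assume "A \<in> {C. identity_at d S T i C}"
  then show "scale_opr_real c A \<in> {C. identity_at d S T i C}"
    unfolding scale_opr_real_def identity_at_def ptrace_scale mem_Collect_eq
    by (simp add: scale_opr_def)
qed

text \<open>A traceless factor at a discarded site makes the partial trace vanish. If there is none,
  the string is zero on \<open>T\<close>, hence at \<open>i\<close>, where the factor is then a
  multiple of the identity.\<close>

lemma identity_at_elem_tensor:
  assumes ST: "S \<inter> T = {}" "S \<union> T = {1..n}" and i: "i \<in> S" "0 < d i"
    and A: "\<forall>k\<in>{1..n}. A k \<in> local_space (d k) (s k)"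
    and s: "(\<forall>k\<in>T. s k = 0) \<longrightarrow> s i = 0"
  shows "identity_at d S T i (elem_tensor n d A)"
  unfolding identity_at_def
proof (intro ballI)
  fix x y assume xy: "x \<in> basis d S" "y \<in> basis d S"
  then have xy0: "x(i := 0) \<in> basis d S" "y(i := 0) \<in> basis d S" using upd_basis i by blast+
  have fin: "finite S" "finite T" using ST(2) by (metis finite_Un finite_atLeastAtMost)+
  note P = ptrace_elem_tensor[OF ST xy, of A] ptrace_elem_tensor[OF ST xy0, of A]
  show "ptrace_opr d S T (elem_tensor n d A) x y =
    (if x i = y i then ptrace_opr d S T (elem_tensor n d A) (x(i := 0)) (y(i := 0)) else 0)"
  proof (cases "\<forall>k\<in>T. s k = 0")
    case False
    then obtain k where k: "k \<in> T" "s k \<noteq> 0" by blast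
    then have "A k \<in> local_space (d k) (s k)" using A ST(2) by blast
    then have "trace_opr {..<d k} (A k) = 0" using k by (simp add: local_space_def)
    then have "(\<Prod>k\<in>T. trace_opr {..<d k} (A k)) = 0" using k fin(2) by (intro prod_zero) auto
    then show ?thesis unfolding P by simp
  next
    case True
    then have "s i = 0" using s by blast
    moreover have "A i \<in> local_space (d i) (s i)" using A ST(2) i(1) by blast
    ultimately obtain r where "A i = scale_opr_real r (id_opr {..<d i})"
      by (auto simp: local_space_def)
    then have Ai: "A i a b = (if a = b then of_real r else 0)" if "a < d i" for a b
      using that by (simp add: scale_opr_real_def scale_opr_def id_opr_def)
    have xi: "x i < d i" using basis_memD xy(1) i(1) by blast
    have "(\<Prod>k\<in>S. A k (x k) (y k)) = A i (x i) (y i) * (\<Prod>k\<in>S - {i}. A k (x k) (y k))"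
      using fin(1) i(1) by (rule prod.remove)
    moreover have "(\<Prod>k\<in>S. A k ((x(i := 0)) k) ((y(i := 0)) k)) =
        A i 0 0 * (\<Prod>k\<in>S - {i}. A k (x k) (y k))"
      using prod.remove[OF fin(1) i(1), of "\<lambda>k. A k ((x(i := 0)) k) ((y(i := 0)) k)"] by simp
    ultimately show ?thesis
      unfolding P using Ai[OF xi, of "y i"] Ai[OF i(2), of 0] by simp
  qed
qed

lemma identity_at_fun_space:
  assumes ST: "S \<inter> T = {}" "S \<union> T = {1..n}" and i: "i \<in> S" "0 < d i"
    and s: "\<And>s. s \<in> strings n \<Longrightarrow> f s = 1 \<Longrightarrow> \<forall>k\<in>T. s k = 0 \<Longrightarrow> s i = 0"
    and C: "C \<in> fun_space n d f"
  shows "identity_at d S T i C"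
proof -
  obtain X where C: "C = (\<Sum>s\<in>{s \<in> strings n. f s = 1}. X s)"
    and X: "\<forall>s\<in>strings n. f s = 1 \<longrightarrow> X s \<in> string_space n d s"
    using C by (auto simp: fun_space_def)
  have "X t \<in> {C. identity_at d S T i C}" if t: "t \<in> {s \<in> strings n. f s = 1}" for t
  proof -
    have "string_space n d t \<subseteq> {C. identity_at d S T i C}"
      unfolding string_space_def
    proof (rule real_opr.span_minimal[OF _ subspace_identity_at], clarify)
      fix A assume "\<forall>i\<in>{1..n}. A i \<in> local_space (d i) (t i)"
      then show "identity_at d S T i (elem_tensor n d A)"
        using identity_at_elem_tensor[where d = d and s = t and A = A, OF ST i] s[of t] t by blast
    qed
    then show ?thesis using X t by blast
  qed
  then show ?thesis
    unfolding C using real_opr.subspace_sum[OF subspace_identity_at] by blast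
qed

section \<open>Channels without signalling\<close>

text \<open>The witness for no signalling from \<open>i\<close> feeds the fixed basis state \<open>0\<close> into input \<open>i\<close> and
  discards all outputs but \<open>j\<close>.\<close>

definition embed_at :: "(nat \<Rightarrow> nat) \<Rightarrow> nat set \<Rightarrow> nat \<Rightarrow> midx opr \<Rightarrow> midx opr" where
  "embed_at d S i A = (\<lambda>x y. if x \<in> basis d S \<and> y \<in> basis d S \<and> x i = 0 \<and> y i = 0
     then A (restrict x (S - {i})) (restrict y (S - {i})) else 0)"

definition reduced_map ::
    "(nat \<Rightarrow> nat) \<Rightarrow> nat set \<Rightarrow> nat set \<Rightarrow> nat \<Rightarrow> nat \<Rightarrow> (midx opr \<Rightarrow> midx opr) \<Rightarrow> midx opr \<Rightarrow> midx opr" where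
  "reduced_map d S T i j \<Phi> A = ptrace_opr d {j} (T - {j}) (\<Phi> (embed_at d S i A))"

lemma embed_at_operators: "embed_at d S i A \<in> operators (basis d S)"
  by (auto simp: embed_at_def operators_def)

lemma embed_at_add: "embed_at d S i (A + B) = embed_at d S i A + embed_at d S i B"
  by (intro ext) (simp add: embed_at_def plus_fun_def)

lemma embed_at_scale: "embed_at d S i (scale_opr c A) = scale_opr c (embed_at d S i A)"
  by (intro ext) (simp add: embed_at_def scale_opr_def)

lemma restrict_upd:
  assumes "u \<in> basis d (S - {i})"
  shows "restrict (u(i := b)) (S - {i}) = u"
proof (rule ext)
  fix k show "restrict (u(i := b)) (S - {i}) k = u k"
    using basis_arb[OF assms, of k] by (cases "k \<in> S - {i}") auto
qed

lemma upd_restrict: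
  assumes "x \<in> basis d S" "x i = b" "i \<in> S"
  shows "(restrict x (S - {i}))(i := b) = x"
proof (rule ext)
  fix k show "((restrict x (S - {i}))(i := b)) k = x k"
    using basis_arb[OF assms(1), of k] assms(2,3) by (cases "k \<in> S"; cases "k = i") auto
qed

lemma upd_basis_insert:
  assumes "u \<in> basis d (S - {i})" "i \<in> S" "b < d i"
  shows "u(i := b) \<in> basis d S"
proof (rule basisI)
  fix k assume "k \<in> S"
  then show "(u(i := b)) k < d k" using basis_memD[OF assms(1), of k] assms(3) by (cases "k = i") auto
next
  fix k assume "k \<notin> S"
  then show "(u(i := b)) k = undefined" using basis_arb[OF assms(1), of k] assms(2) by (cases "k = i") auto
qed

lemma trace_embed_at:
  assumes "finite S" "i \<in> S" "0 < d i"
  shows "trace_opr (basis d S) (embed_at d S i A) = trace_opr (basis d (S - {i})) A"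
proof -
  have "trace_opr (basis d S) (embed_at d S i A) =
      (\<Sum>x\<in>{x \<in> basis d S. x i = 0}. A (restrict x (S - {i})) (restrict x (S - {i})))"
    unfolding trace_opr_def
    by (intro sum.mono_neutral_cong_right finite_basis assms(1)) (auto simp: embed_at_def)
  also have "\<dots> = (\<Sum>u\<in>basis d (S - {i}). A u u)"
  proof (rule sum.reindex_bij_witness[where i = "\<lambda>u. u(i := 0)" and j = "\<lambda>x. restrict x (S - {i})"])
    fix x assume "x \<in> {x \<in> basis d S. x i = 0}"
    then have x: "x \<in> basis d S" "x i = 0" by simp_all
    show "(restrict x (S - {i}))(i := 0) = x" using upd_restrict[OF x assms(2)] .
    show "restrict x (S - {i}) \<in> basis d (S - {i})" using restrict_basis[OF x(1)] by blast
  next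
    fix u assume u: "u \<in> basis d (S - {i})"
    show "restrict (u(i := 0)) (S - {i}) = u" using restrict_upd[OF u] .
    show "u(i := 0) \<in> {x \<in> basis d S. x i = 0}" using upd_basis_insert[where d = d, OF u assms(2,3)] by simp
  qed simp
  finally show ?thesis by (simp add: trace_opr_def)
qed

lemma embed_unit:
  assumes uv: "u \<in> basis d (S - {i})" "v \<in> basis d (S - {i})" and i: "i \<in> S" "0 < d i"
  shows "embed_at d S i (unit_opr u v) = unit_opr (u(i := 0)) (v(i := 0))"
proof (intro ext)
  fix x y
  have eq: "w \<in> basis d S \<and> w i = 0 \<and> restrict w (S - {i}) = u' \<longleftrightarrow> w = u'(i := 0)"
    if u': "u' \<in> basis d (S - {i})" for w u'
  proof
    assume "w \<in> basis d S \<and> w i = 0 \<and> restrict w (S - {i}) = u'"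
    then show "w = u'(i := 0)" using upd_restrict[of w d S i 0] i(1) by auto
  next
    assume "w = u'(i := 0)"
    then show "w \<in> basis d S \<and> w i = 0 \<and> restrict w (S - {i}) = u'"
      using upd_basis_insert[where d = d, OF u' i] restrict_upd[OF u'] by simp
  qed
  show "embed_at d S i (unit_opr u v) x y = unit_opr (u(i := 0)) (v(i := 0)) x y"
    unfolding embed_at_def unit_opr_def using eq[OF uv(1), of x] eq[OF uv(2), of y] by auto
qed

text \<open>For complete positivity the amplified map is factored into an embedding, the amplified
  \<open>\<Phi>\<close> and a sum of compressions, each of which preserves positivity.\<close>

lemma channel_reduced_map:
  assumes \<Phi>: "channel d S T \<Phi>" and fin: "finite S" "finite T" and ij: "i \<in> S" "0 < d i" "j \<in> T"
  shows "channel d (S - {i}) {j} (reduced_map d S T i j \<Phi>)"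
  unfolding channel_def
proof (intro conjI ballI allI impI)
  fix A show "reduced_map d S T i j \<Phi> A \<in> operators (basis d {j})"
    unfolding reduced_map_def by (rule ptrace_operators)
next
  fix A B
  show "reduced_map d S T i j \<Phi> (A + B) = reduced_map d S T i j \<Phi> A + reduced_map d S T i j \<Phi> B"
    using \<Phi> embed_at_operators unfolding reduced_map_def embed_at_add channel_def ptrace_add[symmetric]
    by metis
next
  fix c A
  show "reduced_map d S T i j \<Phi> (scale_opr c A) = scale_opr c (reduced_map d S T i j \<Phi> A)"
    using \<Phi> embed_at_operators unfolding reduced_map_def embed_at_scale channel_def ptrace_scale[symmetric]
    by metis
next
  fix A
  have "trace_opr (basis d {j}) (reduced_map d S T i j \<Phi> A) =
      trace_opr (basis d T) (\<Phi> (embed_at d S i A))"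
    unfolding reduced_map_def using trace_ptrace[of "{j}" "T - {j}"] ij(3) by (simp add: insert_absorb)
  also have "\<dots> = trace_opr (basis d S) (embed_at d S i A)"
    using \<Phi> embed_at_operators unfolding channel_def by metis
  also have "\<dots> = trace_opr (basis d (S - {i})) A"
    by (rule trace_embed_at[where d = d, OF fin(1) ij(1,2)])
  finally show "trace_opr (basis d {j}) (reduced_map d S T i j \<Phi> A) = trace_opr (basis d (S - {i})) A" .
next
  fix k :: nat and X :: "(nat \<times> midx) opr"
  assume X: "positive_opr ({..<k} \<times> basis d (S - {i})) X"
  define K' where "K' = {..<k} \<times> {x \<in> basis d S. x i = 0}"
  define g where "g = (\<lambda>(a::nat, x::midx). (a, restrict x (S - {i})))"
  \<comment> \<open>Blockwise, \<open>Y\<close> is \<open>X\<close> with the basis state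
    \<open>0\<close> inserted at input \<open>i\<close>.\<close>
  define Y where "Y p q = (if p \<in> K' \<and> q \<in> K' then X (g p) (g q) else 0)" for p q :: "nat \<times> midx"
  have "positive_opr ({..<k} \<times> basis d S) Y"
  proof (rule positive_opr_pullback[OF X _ _ _ _ _ Y_def])
    show "inj_on g K'"
    proof (rule inj_onI)
      fix p q assume pq: "p \<in> K'" "q \<in> K'" "g p = g q"
      obtain a x b y where eq: "p = (a, x)" "q = (b, y)" by (cases p, cases q)
      have "x = (restrict x (S - {i}))(i := 0)" "y = (restrict y (S - {i}))(i := 0)"
        using pq(1,2) upd_restrict[of _ d S i 0] ij(1) eq by (auto simp: K'_def)
      then show "p = q" using pq(3) eq unfolding g_def by (metis case_prod_conv prod.inject)
    qed
    show "g ` K' \<subseteq> {..<k} \<times> basis d (S - {i})"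
      unfolding g_def K'_def using restrict_basis by fastforce
  qed (use fin finite_basis in \<open>auto simp: K'_def\<close>)
  then have Z: "positive_opr ({..<k} \<times> basis d T) (ampl \<Phi> Y)" (is "positive_opr _ ?Z")
    using \<Phi> unfolding channel_def by blast
  have block: "embed_at d S i (\<lambda>x y. X (a, x) (b, y)) = (\<lambda>x y. Y (a, x) (b, y))" if "a < k" "b < k" for a b
    using that by (intro ext) (simp add: embed_at_def Y_def K'_def g_def)
  have outside: "X (a, x) (b, y) = 0" if "\<not> (a < k \<and> b < k)" for a b x y
    using X that by (auto simp: positive_opr_def operators_def)
  \<comment> \<open>Block indices outside the ancilla give zero blocks of \<open>X\<close>, and
    linearity makes \<open>\<Phi>\<close> vanish on them.\<close>
  have \<Phi>0: "\<Phi> (\<lambda>x y. 0) = (\<lambda>x y. 0)"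
  proof -
    have "(\<lambda>x y. 0) \<in> operators (basis d S)" by (simp add: operators_def)
    then have "\<Phi> (scale_opr 0 (\<lambda>x y. 0)) = scale_opr 0 (\<Phi> (\<lambda>x y. 0))"
      using \<Phi> unfolding channel_def by blast
    then show ?thesis by (simp add: scale_opr_def)
  qed
  define h where "h z p = (fst p, override_on (snd p) z (T - {j}))" for z :: midx and p :: "nat \<times> midx"
  \<comment> \<open>The partial trace is the sum over \<open>z\<close> of compressions to the states
    whose discarded outputs equal \<open>z\<close>.\<close>
  define W where "W z p q = (if p \<in> {..<k} \<times> basis d {j} \<and> q \<in> {..<k} \<times> basis d {j}
    then ?Z (h z p) (h z q) else 0)" for z :: midx and p q :: "nat \<times> midx"
  have W: "positive_opr ({..<k} \<times> basis d {j}) (W z)" if z: "z \<in> basis d (T - {j})" for z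
  proof (rule positive_opr_pullback[where g = "h z", OF Z _ _ order_refl _ _ W_def])
    show "inj_on (h z) ({..<k} \<times> basis d {j})"
    proof (rule inj_onI)
      fix p q assume pq: "p \<in> {..<k} \<times> basis d {j}" "q \<in> {..<k} \<times> basis d {j}"
        "h z p = h z q"
      have "restrict (override_on (snd p) z (T - {j})) {j} = snd p"
        "restrict (override_on (snd q) z (T - {j})) {j} = snd q"
        using restrict_override(1)[OF _ z, of _ "{j}"] pq(1,2) by (simp_all only: mem_Times_iff Diff_disjoint)
      then show "p = q" using pq(3) unfolding h_def by (metis Pair_inject prod.collapse)
    qed
    have "{j} \<union> (T - {j}) = T" using ij(3) by blast
    then show "h z ` ({..<k} \<times> basis d {j}) \<subseteq> {..<k} \<times> basis d T"
      using override_basis[OF _ z, of _ "{j}"] by (simp only: h_def image_subset_iff mem_Times_iff fst_conv snd_conv) simp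
  qed (use fin finite_basis in auto)
  have "ampl (reduced_map d S T i j \<Phi>) X = (\<lambda>p q. \<Sum>z\<in>basis d (T - {j}). W z p q)"
  proof (intro ext)
    fix p q :: "nat \<times> midx"
    obtain a x b y where pq: "p = (a, x)" "q = (b, y)" by (cases p, cases q)
    show "ampl (reduced_map d S T i j \<Phi>) X p q = (\<Sum>z\<in>basis d (T - {j}). W z p q)"
    proof (cases "a < k \<and> b < k")
      case True
      then show ?thesis
        unfolding pq ampl_def reduced_map_def
        by (auto simp: block ptrace_opr_def W_def h_def ampl_def intro!: sum.neutral[symmetric])
    next
      case False
      have "embed_at d S i (\<lambda>x y. X (a, x) (b, y)) = (\<lambda>x y. 0)"
        using outside[OF False] by (intro ext) (simp add: embed_at_def)
      then show ?thesis
        using False unfolding pq ampl_def reduced_map_def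
        by (auto simp: \<Phi>0 ptrace_opr_def W_def)
    qed
  qed
  then show "positive_opr ({..<k} \<times> basis d {j}) (ampl (reduced_map d S T i j \<Phi>) X)"
    using positive_opr_sum[of "basis d (T - {j})" _ W] W by simp
qed

text \<open>The identity factor reduces every entry to one with coordinate 0 at \<open>i\<close>,
  and those entries are exactly the Choi entries of the reduced map.\<close>

lemma no_signalling_of_identity_at:
  assumes \<Phi>: "channel d S T \<Phi>" and fin: "finite S" "finite T" and ST: "S \<inter> T = {}"
    and ij: "i \<in> S" "0 < d i" "j \<in> T"
    and C: "identity_at d (S \<union> {j}) (T - {j}) i (choi d S T \<Phi>)"
  shows "no_signalling_channel d S T \<Phi> i j"
proof -
  let ?\<Psi> = "reduced_map d S T i j \<Phi>" and ?R = "(S - {i}) \<union> {j}"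
  have "ptrace_opr d (S \<union> {j}) (T - {j}) (choi d S T \<Phi>) x y =
      tensor_opr d {i} ?R (id_opr (basis d {i})) (choi d (S - {i}) {j} ?\<Psi>) x y" for x y
  proof -
    have un: "{i} \<union> ?R = S \<union> {j}" using ij(1) by blast
    show ?thesis
    proof (cases "x \<in> basis d (S \<union> {j}) \<and> y \<in> basis d (S \<union> {j})")
      case False
      then show ?thesis unfolding tensor_opr_def un ptrace_opr_def by auto
    next
      case True
      then have xy: "x \<in> basis d (S \<union> {j})" "y \<in> basis d (S \<union> {j})" by simp_all
      have id: "id_opr (basis d {i}) (restrict x {i}) (restrict y {i}) = (if x i = y i then 1 else 0)"
      proof -
        have "restrict x {i} \<in> basis d {i}" using restrict_basis[OF xy(1)] ij(1) by blast
        moreover have "restrict x {i} = restrict y {i} \<longleftrightarrow> x i = y i"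
          by (metis restrict_apply' restrict_ext singletonD singletonI)
        ultimately show ?thesis by (simp add: id_opr_def)
      qed
      have sub: "?R \<subseteq> S \<union> {j}" "S - {i} \<subseteq> S \<union> {j}" "{j} \<subseteq> S \<union> {j}" by auto
      have R: "restrict x ?R \<in> basis d ?R" "restrict y ?R \<in> basis d ?R"
        by (rule restrict_basis[OF xy(1) sub(1)], rule restrict_basis[OF xy(2) sub(1)])
      have rr: "restrict (restrict w ?R) (S - {i}) = restrict w (S - {i})"
        "restrict (restrict w ?R) {j} = restrict w {j}" for w :: midx
        unfolding restrict_restrict by (rule arg_cong[where f = "restrict w"], blast)+
      have u: "restrict x (S - {i}) \<in> basis d (S - {i})" "restrict y (S - {i}) \<in> basis d (S - {i})"
        by (rule restrict_basis[OF xy(1) sub(2)], rule restrict_basis[OF xy(2) sub(2)])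
      have uj: "restrict x {j} \<in> basis d {j}" "restrict y {j} \<in> basis d {j}"
        by (rule restrict_basis[OF xy(1) sub(3)], rule restrict_basis[OF xy(2) sub(3)])
      let ?u = "(restrict x (S - {i}))(i := 0)" and ?v = "(restrict y (S - {i}))(i := 0)"
      have "choi d (S - {i}) {j} ?\<Psi> (restrict x ?R) (restrict y ?R) =
          ?\<Psi> (unit_opr (restrict x (S - {i})) (restrict y (S - {i}))) (restrict x {j}) (restrict y {j})"
        unfolding choi_entry[OF finite_Diff[OF fin(1)] R] rr ..
      also have "\<dots> = (\<Sum>z\<in>basis d (T - {j}). \<Phi> (unit_opr ?u ?v)
          (override_on (restrict x {j}) z (T - {j})) (override_on (restrict y {j}) z (T - {j})))"
        unfolding reduced_map_def embed_unit[where d = d, OF u ij(1,2)] by (simp add: ptrace_opr_def uj)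
      also have "\<dots> = ptrace_opr d (S \<union> {j}) (T - {j}) (choi d S T \<Phi>) (x(i := 0)) (y(i := 0))"
      proof -
        have xy0: "x(i := 0) \<in> basis d (S \<union> {j})" "y(i := 0) \<in> basis d (S \<union> {j})"
          using upd_basis[where d = d, OF _ _ ij(2), of _ "S \<union> {j}"] xy ij(1) by simp_all
        have j: "j \<notin> S" "j \<noteq> i" using ij ST by auto
        have un: "S \<union> {j} \<union> (T - {j}) = S \<union> T" using ij(3) by blast
        have entry: "choi d S T \<Phi> (override_on (x(i := 0)) z (T - {j})) (override_on (y(i := 0)) z (T - {j})) =
          \<Phi> (unit_opr ?u ?v) (override_on (restrict x {j}) z (T - {j})) (override_on (restrict y {j}) z (T - {j}))"
          if z: "z \<in> basis d (T - {j})" for z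
        proof -
          have mem: "override_on (x(i := 0)) z (T - {j}) \<in> basis d (S \<union> T)"
            "override_on (y(i := 0)) z (T - {j}) \<in> basis d (S \<union> T)"
            using override_basis[OF xy0(1) z] override_basis[OF xy0(2) z] unfolding un .
          have S: "restrict (override_on (w(i := 0)) z (T - {j})) S = (restrict w (S - {i}))(i := 0)" for w :: midx
          proof (rule ext)
            fix k
            show "restrict (override_on (w(i := 0)) z (T - {j})) S k = ((restrict w (S - {i}))(i := 0)) k"
              using ST ij(1) by (cases "k \<in> S"; cases "k = i") (auto simp: override_on_def)
          qed
          have T: "restrict (override_on (w(i := 0)) z (T - {j})) T = override_on (restrict w {j}) z (T - {j})" for w :: midx
          proof (rule ext)
            fix k
            show "restrict (override_on (w(i := 0)) z (T - {j})) T k = override_on (restrict w {j}) z (T - {j}) k"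
              using j(2) ij(3) by (cases "k \<in> T"; cases "k = j") (auto simp: override_on_def)
          qed
          show ?thesis unfolding choi_entry[OF fin(1) mem] S T ..
        qed
        show ?thesis using xy0 entry by (simp add: ptrace_opr_def)
      qed
      finally have "tensor_opr d {i} ?R (id_opr (basis d {i})) (choi d (S - {i}) {j} ?\<Psi>) x y =
        (if x i = y i then ptrace_opr d (S \<union> {j}) (T - {j}) (choi d S T \<Phi>) (x(i := 0)) (y(i := 0)) else 0)"
        unfolding tensor_opr_def un id using xy by simp
      then show ?thesis using C xy unfolding identity_at_def by simp
    qed
  qed
  then have "ptrace_opr d (S \<union> {j}) (T - {j}) (choi d S T \<Phi>) =
      tensor_opr d {i} ?R (id_opr (basis d {i})) (choi d (S - {i}) {j} ?\<Psi>)"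
    by (intro ext)
  moreover have "channel d (S - {i}) {j} ?\<Psi>"
    by (rule channel_reduced_map[where d = d, OF \<Phi> fin ij])
  ultimately show ?thesis unfolding no_signalling_channel_def by blast
qed

section \<open>A signalling classical channel\<close>

text \<open>Measurement in the product basis followed by preparation of a basis state, with
  \<open>w x p\<close> the transition probability from \<open>x\<close> to \<open>p\<close>.\<close>

definition classical_map ::
    "(nat \<Rightarrow> nat) \<Rightarrow> nat set \<Rightarrow> nat set \<Rightarrow> (midx \<Rightarrow> midx \<Rightarrow> real) \<Rightarrow> midx opr \<Rightarrow> midx opr" where
  "classical_map d S T w X = (\<lambda>p q. if p \<in> basis d T \<and> p = q
     then \<Sum>x\<in>basis d S. of_real (w x p) * X x x else 0)"

lemma channel_classical_map:
  assumes fin: "finite S" "finite T" and w: "\<And>x p. 0 \<le> w x p"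
    and sum: "\<And>x. x \<in> basis d S \<Longrightarrow> (\<Sum>p\<in>basis d T. w x p) = 1"
  shows "channel d S T (classical_map d S T w)"
  unfolding channel_def
proof (intro conjI ballI allI impI)
  fix A show "classical_map d S T w A \<in> operators (basis d T)"
    by (auto simp: classical_map_def operators_def)
next
  fix A B show "classical_map d S T w (A + B) = classical_map d S T w A + classical_map d S T w B"
    by (intro ext) (auto simp: classical_map_def plus_fun_def sum.distrib distrib_left)
next
  fix c A show "classical_map d S T w (scale_opr c A) = scale_opr c (classical_map d S T w A)"
    by (intro ext) (auto simp: classical_map_def scale_opr_def sum_distrib_left mult_ac)
next
  fix A
  have "trace_opr (basis d T) (classical_map d S T w A) =
      (\<Sum>p\<in>basis d T. \<Sum>x\<in>basis d S. of_real (w x p) * A x x)"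
    unfolding trace_opr_def by (intro sum.cong) (simp_all add: classical_map_def)
  also have "\<dots> = (\<Sum>x\<in>basis d S. \<Sum>p\<in>basis d T. of_real (w x p) * A x x)"
    by (rule sum.swap)
  also have "\<dots> = (\<Sum>x\<in>basis d S. of_real (\<Sum>p\<in>basis d T. w x p) * A x x)"
    by (simp add: sum_distrib_right)
  also have "\<dots> = trace_opr (basis d S) A"
    unfolding trace_opr_def by (intro sum.cong) (simp_all add: sum)
  finally show "trace_opr (basis d T) (classical_map d S T w A) = trace_opr (basis d S) A" .
next
  fix k :: nat and X :: "(nat \<times> midx) opr"
  assume X: "positive_opr ({..<k} \<times> basis d S) X"
  \<comment> \<open>For \<open>r = (x, t)\<close>, \<open>B r\<close> takes the block of
    \<open>X\<close> at input \<open>x\<close> and places it at output \<open>t\<close>; the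
    amplified map is the combination of these with weights \<open>w x t\<close>.\<close>
  define B where "B r p q = (if p \<in> {..<k} \<times> {snd r} \<and> q \<in> {..<k} \<times> {snd r}
    then X (fst p, fst r) (fst q, fst r) else 0)" for r :: "midx \<times> midx" and p q :: "nat \<times> midx"
  have "positive_opr ({..<k} \<times> basis d T) (\<lambda>p q. of_real (w (fst r) (snd r)) * B r p q)"
    if r: "r \<in> basis d S \<times> basis d T" for r
  proof (rule positive_opr_scale)
    show "positive_opr ({..<k} \<times> basis d T) (B r)"
    proof (rule positive_opr_pullback[where g = "\<lambda>p. (fst p, fst r)", OF X _ _ _ _ _ B_def])
      show "inj_on (\<lambda>p. (fst p, fst r)) ({..<k} \<times> {snd r})" by (auto simp: inj_on_def)
    qed (use r fin finite_basis in auto)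
  qed (rule w)
  then have "positive_opr ({..<k} \<times> basis d T)
      (\<lambda>p q. \<Sum>r\<in>basis d S \<times> basis d T. of_real (w (fst r) (snd r)) * B r p q)"
    by (rule positive_opr_sum)
  moreover have "ampl (classical_map d S T w) X p q =
      (\<Sum>r\<in>basis d S \<times> basis d T. of_real (w (fst r) (snd r)) * B r p q)" for p q
  proof -
    obtain a u b v where pq: "p = (a, u)" "q = (b, v)" by (cases p, cases q)
    have outside: "X (a, x) (b, y) = 0" if "\<not> (a < k \<and> b < k)" for x y
      using X that by (auto simp: positive_opr_def operators_def)
    have "(\<Sum>r\<in>basis d S \<times> basis d T. of_real (w (fst r) (snd r)) * B r p q) =
      (\<Sum>x\<in>basis d S. \<Sum>t\<in>basis d T. if t = u then
        (if u = v then of_real (w x u) * X (a, x) (b, x) else 0) else 0)"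
      unfolding sum.cartesian_product
      by (intro sum.cong refl) (auto simp: B_def pq outside)
    also have "\<dots> = (\<Sum>x\<in>basis d S. if u \<in> basis d T then
        (if u = v then of_real (w x u) * X (a, x) (b, x) else 0) else 0)"
      using finite_basis[OF fin(2)] by simp
    also have "\<dots> = ampl (classical_map d S T w) X p q"
      by (auto simp: pq ampl_def classical_map_def intro!: sum.neutral)
    finally show ?thesis ..
  qed
  ultimately show "positive_opr ({..<k} \<times> basis d T) (ampl (classical_map d S T w) X)"
    by (simp add: positive_opr_def operators_def)
qed

lemma choi_classical_map:
  assumes "finite S"
  shows "choi d S T (classical_map d S T w) x y =
    (if x \<in> basis d (S \<union> T) \<and> x = y then of_real (w (restrict x S) (restrict x T)) else 0)"
proof (cases "x \<in> basis d (S \<union> T) \<and> y \<in> basis d (S \<union> T)")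
  case False
  then show ?thesis using choi_zero by auto
next
  case True
  then have xy: "x \<in> basis d (S \<union> T)" "y \<in> basis d (S \<union> T)" by simp_all
  have mem: "restrict x S \<in> basis d S" "restrict x T \<in> basis d T"
    using restrict_basis[OF xy(1)] by simp_all
  have eq: "x = y \<longleftrightarrow> restrict x S = restrict y S \<and> restrict x T = restrict y T"
    using override_restrict[OF xy(1)] override_restrict[OF xy(2)] by metis
  have "choi d S T (classical_map d S T w) x y = (if restrict x T = restrict y T
      then \<Sum>u\<in>basis d S. if u = restrict x S then
        (if restrict x S = restrict y S then of_real (w u (restrict x T)) else 0) else 0 else 0)"
    unfolding choi_entry[OF assms xy] classical_map_def unit_opr_def using mem(2)
    by (auto intro!: sum.cong)
  also have "\<dots> = (if x = y then of_real (w (restrict x S) (restrict x T)) else 0)"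
    using mem(1) finite_basis[OF assms] by (auto simp: eq)
  finally show ?thesis using xy by simp
qed

text \<open>The diagonal of the Pauli operator \<open>Z\<close>.\<close>

definition pm :: "nat \<Rightarrow> real" where
  "pm b = (if b = 0 then 1 else -1)"

lemma sum_lessThan_2:
  fixes g :: "nat \<Rightarrow> 'a::comm_monoid_add"
  shows "(\<Sum>b<2. g b) = g 0 + g 1"
  by (simp add: numeral_2_eq_2)

text \<open>The sum over the basis factorises over sites, and site \<open>j\<close> contributes
  \<open>1 - 1\<close>.\<close>

lemma sum_pm:
  assumes "finite T" "j \<in> T"
  shows "(\<Sum>x\<in>basis (\<lambda>_. 2) T. pm (x j)) = 0"
proof -
  have "(\<Sum>x\<in>basis (\<lambda>_. 2) T. pm (x j)) =
      (\<Sum>x\<in>basis (\<lambda>_. 2) T. \<Prod>k\<in>T. if k = j then pm (x k) else 1)"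
    using assms by simp
  also have "\<dots> = (\<Prod>k\<in>T. \<Sum>b<2. if k = j then pm b else 1)"
    by (rule sum_basis_prod[OF assms(1), where g = "\<lambda>k b. if k = j then pm b else 1"])
  also have "\<dots> = 0"
    using assms by (intro prod_zero bexI[of _ j]) (simp_all add: sum_lessThan_2 pm_def)
  finally show ?thesis .
qed

lemma sum_pm_pm:
  assumes "finite T" "i \<in> T" "j \<in> T" "i \<noteq> j"
  shows "(\<Sum>x\<in>basis (\<lambda>_. 2) T. pm (x i) * pm (x j)) = 0"
proof -
  let ?g = "\<lambda>k b. (if k = i then pm b else 1) * (if k = j then pm b else 1)"
  have "(\<Sum>x\<in>basis (\<lambda>_. 2) T. pm (x i) * pm (x j)) =
      (\<Sum>x\<in>basis (\<lambda>_. 2) T. \<Prod>k\<in>T. ?g k (x k))"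
    using assms by (simp add: prod.distrib)
  also have "\<dots> = (\<Prod>k\<in>T. \<Sum>b<2. ?g k b)"
    by (rule sum_basis_prod[OF assms(1), where g = ?g])
  also have "\<dots> = 0"
    using assms by (intro prod_zero bexI[of _ j]) (simp_all add: sum_lessThan_2 pm_def)
  finally show ?thesis .
qed

definition diagonal_opr :: "(nat \<Rightarrow> complex) \<Rightarrow> nat opr" where
  "diagonal_opr D = (\<lambda>a b. if a < 2 \<and> a = b then D a else 0)"

lemma elem_tensor_diagonal:
  "elem_tensor n (\<lambda>_. 2) (\<lambda>k. diagonal_opr (D k)) x y =
    (if x \<in> basis (\<lambda>_. 2) {1..n} \<and> x = y then \<Prod>k\<in>{1..n}. D k (x k) else 0)"
proof (cases "x \<in> basis (\<lambda>_. 2) {1..n} \<and> y \<in> basis (\<lambda>_. 2) {1..n}")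
  case False
  then show ?thesis by (auto simp: elem_tensor_def)
next
  case True
  then have xy: "x \<in> basis (\<lambda>_. 2) {1..n}" "y \<in> basis (\<lambda>_. 2) {1..n}" by simp_all
  show ?thesis
  proof (cases "x = y")
    case eq: True
    have "(\<Prod>k\<in>{1..n}. diagonal_opr (D k) (x k) (x k)) = (\<Prod>k\<in>{1..n}. D k (x k))"
      using basis_memD[OF xy(1)] by (intro prod.cong refl) (simp add: diagonal_opr_def)
    then show ?thesis using xy eq by (simp add: elem_tensor_def)
  next
    case False
    then obtain k where k: "k \<in> {1..n}" "x k \<noteq> y k" using basis_eqI[OF xy] by blast
    then have "(\<Prod>k\<in>{1..n}. diagonal_opr (D k) (x k) (y k)) = 0"
      by (intro prod_zero bexI[of _ k]) (simp_all add: diagonal_opr_def)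
    then show ?thesis using xy False by (simp add: elem_tensor_def)
  qed
qed

lemma diagonal_local_space:
  "diagonal_opr (\<lambda>_. 1) \<in> local_space 2 0"
  "diagonal_opr (\<lambda>b. of_real (pm b)) \<in> local_space 2 1"
proof -
  have "diagonal_opr (\<lambda>_. 1) = scale_opr_real 1 (id_opr {..<2})"
    by (intro ext) (simp add: diagonal_opr_def scale_opr_real_def scale_opr_def id_opr_def)
  then show "diagonal_opr (\<lambda>_. 1) \<in> local_space 2 0"
    unfolding local_space_def if_P[OF refl] by blast
  have "trace_opr {..<2} (diagonal_opr (\<lambda>b. of_real (pm b))) = 0"
    by (simp add: trace_opr_def sum_lessThan_2 diagonal_opr_def pm_def)
  then show "diagonal_opr (\<lambda>b. of_real (pm b)) \<in> local_space 2 1"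
    by (auto simp: local_space_def operators_def hermitian_opr_def diagonal_opr_def)
qed

lemma finite_strings: "finite (strings n)"
  unfolding strings_def by (intro finite_PiE) auto

lemma signalling_of_pair:
  assumes ij: "i \<in> inputs n f" "j \<in> outputs n f"
    and part: "inputs n f \<union> outputs n f = {1..n}" "inputs n f \<inter> outputs n f = {}"
    and f: "f (ind_str n {}) = 1" "f (ind_str n {i, j}) = 1"
  shows "\<not> no_signalling n f i j"
proof
  define d :: "nat \<Rightarrow> nat" where "d = (\<lambda>_. 2)"
  define S T where "S = inputs n f" and "T = outputs n f"
  \<comment> \<open>This normalises the transition probabilities over the \<open>2 ^ card T\<close>
    output states.\<close>
  define c :: real where "c = 1 / 2 ^ card T"
  \<comment> \<open>On bits the weight vanishes unless \<open>p j = x i\<close> and is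
    \<open>2 * c\<close> otherwise: output \<open>j\<close> copies input \<open>i\<close>, and the
    other outputs are uniformly random.\<close>
  define w where "w x p = c * (1 + pm (x i) * pm (p j))" for x p :: midx
  define \<Phi> where "\<Phi> = classical_map d S T w"
  have fin: "finite S" "finite T" by (auto simp: S_def T_def inputs_def outputs_def)
  have ij': "i \<in> S" "j \<in> T" "i \<in> {1..n}" "j \<in> {1..n}" "i \<noteq> j" "i \<notin> T" "j \<notin> S"
    using ij part by (auto simp: S_def T_def)
  have ST: "S \<union> T = {1..n}" "S \<inter> T = {}" using part by (simp_all add: S_def T_def)
  have c: "0 < c" by (simp add: c_def)
  have "0 \<le> w x p" for x p using c by (auto simp: w_def pm_def)
  moreover have "(\<Sum>p\<in>basis d T. w x p) = 1" for x
  proof -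
    have "(\<Sum>p\<in>basis d T. w x p) = c * (real (card (basis d T)) + pm (x i) * (\<Sum>p\<in>basis d T. pm (p j)))"
      unfolding w_def by (simp add: sum_distrib_left[symmetric] sum.distrib)
    then show ?thesis
      using sum_pm[OF fin(2) ij'(2)] card_basis[OF fin(2)] by (simp add: d_def c_def)
  qed
  ultimately have ch: "channel d S T \<Phi>"
    unfolding \<Phi>_def using channel_classical_map[OF fin] by blast
  have w_restrict: "w (restrict x S) (restrict x T) = c * (1 + pm (x i) * pm (x j))" for x
    using ij' by (simp add: w_def)
  have C: "choi d S T \<Phi> x y =
      (if x \<in> basis d {1..n} \<and> x = y then of_real (c * (1 + pm (x i) * pm (x j))) else 0)" for x y
    unfolding \<Phi>_def choi_classical_map[OF fin(1)] ST(1) w_restrict ..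
  define D1 :: "nat \<Rightarrow> nat \<Rightarrow> complex" where "D1 = (\<lambda>k b. 1)"
  define D2 :: "nat \<Rightarrow> nat \<Rightarrow> complex" where
    "D2 = (\<lambda>k. if k = i \<or> k = j then (\<lambda>b. of_real (pm b)) else (\<lambda>b. 1))"
  define E where "E D = elem_tensor n d (\<lambda>k. diagonal_opr (D k))" for D :: "nat \<Rightarrow> nat \<Rightarrow> complex"
  have D2: "(\<Prod>k\<in>{1..n}. D2 k (x k)) = of_real (pm (x i)) * of_real (pm (x j))" for x :: midx
  proof -
    have "(\<Prod>k\<in>{1..n}. D2 k (x k)) =
      (\<Prod>k\<in>{1..n}. (if k = i then of_real (pm (x k)) else 1) * (if k = j then of_real (pm (x k)) else 1))"
      using ij'(5) by (intro prod.cong) (auto simp: D2_def)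
    also have "\<dots> = of_real (pm (x i)) * of_real (pm (x j))"
      using ij'(3,4) by (simp add: prod.distrib)
    finally show ?thesis .
  qed
  have C_sum: "choi d S T \<Phi> = scale_opr_real c (E D1) + scale_opr_real c (E D2)"
    unfolding fun_eq_iff plus_fun_def scale_opr_real_def scale_opr_def E_def d_def
      elem_tensor_diagonal C[unfolded d_def] D2
    by (simp add: D1_def distrib_left)
  let ?t = "ind_str n {}" and ?u = "ind_str n {i, j}"
  have neq: "?t \<noteq> ?u" using ij'(3) by (auto simp: ind_str_eq_iff)
  \<comment> \<open>The identity belongs to the zero string and the operator with \<open>Z\<close>
    at \<open>i\<close> and \<open>j\<close> to the indicator of \<open>{i, j}\<close>;
    \<open>f\<close> is 1 at both.\<close>
  define X where "X s = (if s = ?t then scale_opr_real c (E D1) else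
    if s = ?u then scale_opr_real c (E D2) else 0)" for s :: str
  have X: "X s \<in> string_space n d s" for s
  proof -
    have "E D1 \<in> string_space n d ?t"
      unfolding string_space_def E_def D1_def d_def
    proof (rule real_opr.span_base, clarsimp, intro exI[of _ "\<lambda>k. diagonal_opr (\<lambda>b. 1)"] conjI refl ballI)
      fix k assume "k \<in> {Suc 0..n}"
      then have "ind_str n {} k = 0" by (simp add: ind_str_def)
      then show "diagonal_opr (\<lambda>b. 1) \<in> local_space 2 (ind_str n {} k)" using diagonal_local_space by simp
    qed
    moreover have "E D2 \<in> string_space n d ?u"
      unfolding string_space_def E_def d_def
    proof (rule real_opr.span_base, clarsimp, intro exI[of _ "\<lambda>k. diagonal_opr (D2 k)"] conjI refl ballI)
      fix k assume "k \<in> {Suc 0..n}"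
      then have "ind_str n {i, j} k = (if k = i \<or> k = j then 1 else 0)" by (simp add: ind_str_def)
      then show "diagonal_opr (D2 k) \<in> local_space 2 (ind_str n {i, j} k)"
        using diagonal_local_space by (simp add: D2_def)
    qed
    ultimately show ?thesis
      unfolding X_def string_space_def
      using real_opr.span_scale real_opr.span_zero by auto
  qed
  have "(\<Sum>s\<in>{s \<in> strings n. f s = 1}. X s) = (\<Sum>s\<in>{?t, ?u}. X s)"
    using f finite_strings by (intro sum.mono_neutral_right) (auto simp: X_def)
  also have "\<dots> = choi d S T \<Phi>" using neq C_sum by (simp add: X_def)
  finally have "choi d S T \<Phi> \<in> fun_space n d f"
    unfolding fun_space_def using X by (intro CollectI exI[of _ X]) simp
  moreover have "positive_opr (basis d {1..n}) (choi d S T \<Phi>)"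
    by (rule positive_opr_diagonal[OF _ _ C]) (use c in \<open>auto simp: finite_basis pm_def\<close>)
  moreover have "trace_opr (basis d {1..n}) (choi d S T \<Phi>) = of_nat (\<Prod>i\<in>S. d i)"
  proof -
    have "trace_opr (basis d {1..n}) (choi d S T \<Phi>) =
        of_real (\<Sum>x\<in>basis d {1..n}. c * (1 + pm (x i) * pm (x j)))"
      unfolding trace_opr_def C by simp
    also have "(\<Sum>x\<in>basis d {1..n}. c * (1 + pm (x i) * pm (x j))) =
        c * (real (card (basis d {1..n})) + (\<Sum>x\<in>basis d {1..n}. pm (x i) * pm (x j)))"
      by (simp add: sum_distrib_left[symmetric] sum.distrib)
    \<comment> \<open>The correlation term sums to zero because \<open>i\<close> and
      \<open>j\<close> are distinct sites; what remains will give the dimension of the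
      inputs.\<close>
    also have "\<dots> = c * 2 ^ card {1..n}"
      using sum_pm_pm[of "{1..n}" i j] ij' card_basis[of "{1..n}"] by (simp add: d_def)
    also have "card {1..n} = card S + card T" using ST fin by (metis card_Un_disjoint)
    also have "c * 2 ^ (card S + card T) = 2 ^ card S" by (simp add: c_def power_add)
    finally show ?thesis by (simp add: d_def)
  qed
  ultimately have T1: "choi d S T \<Phi> \<in> T1 n d f" by (simp add: T1_def S_def)
  assume "no_signalling n f i j"
  then have "no_signalling_channel d S T \<Phi> i j"
    unfolding no_signalling_def using ch T1 unfolding S_def T_def by (simp add: d_def)
  then obtain \<Psi> where \<Psi>: "ptrace_opr d (S \<union> {j}) (T - {j}) (choi d S T \<Phi>) =
    tensor_opr d {i} (S - {i} \<union> {j}) (id_opr (basis d {i})) (choi d (S - {i}) {j} \<Psi>)"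
    unfolding no_signalling_channel_def by blast
  \<comment> \<open>The two basis states \<open>x 0\<close> and \<open>x 1\<close> differ only at
    input \<open>i\<close>. An identity factor at \<open>i\<close> would give them equal diagonal
    entries, whereas these are proportional to \<open>1 + pm b\<close>, that is, to 2 and 0.\<close>
  define x :: "nat \<Rightarrow> midx" where "x b = (\<lambda>k\<in>S \<union> {j}. if k = i then b else 0)" for b
  have x: "x b \<in> basis d (S \<union> {j})" if "b < 2" for b
    by (rule basisI) (use that in \<open>auto simp: x_def d_def\<close>)
  have un: "{i} \<union> (S - {i} \<union> {j}) = S \<union> {j}" "S \<union> {j} \<union> (T - {j}) = {1..n}" using ij' ST(1) by auto
  have const: "ptrace_opr d (S \<union> {j}) (T - {j}) (choi d S T \<Phi>) (x b) (x b) =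
    choi d (S - {i}) {j} \<Psi> (restrict (x 0) (S - {i} \<union> {j})) (restrict (x 0) (S - {i} \<union> {j}))"
    if b: "b < 2" for b
  proof -
    have "restrict (x b) {i} \<in> basis d {i}"
      by (rule restrict_basis[OF x[OF b]]) (use ij' in simp)
    moreover have "restrict (x b) (S - {i} \<union> {j}) = restrict (x 0) (S - {i} \<union> {j})"
      using ij'(5) by (intro restrict_ext) (auto simp: x_def)
    ultimately show ?thesis unfolding \<Psi> tensor_opr_def un using x[OF b] by (simp add: id_opr_def)
  qed
  have diag: "ptrace_opr d (S \<union> {j}) (T - {j}) (choi d S T \<Phi>) (x b) (x b) =
      of_nat (card (basis d (T - {j}))) * of_real (c * (1 + pm b))" if b: "b < 2" for b
  proof -
    have "choi d S T \<Phi> (override_on (x b) z (T - {j})) (override_on (x b) z (T - {j})) =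
        of_real (c * (1 + pm b))" if z: "z \<in> basis d (T - {j})" for z
    proof -
      have "override_on (x b) z (T - {j}) \<in> basis d {1..n}"
        using override_basis[OF x[OF b] z] unfolding un .
      moreover have "override_on (x b) z (T - {j}) i = b" "override_on (x b) z (T - {j}) j = 0"
        using ij' by (auto simp: override_on_def x_def)
      ultimately show ?thesis unfolding C by (simp add: pm_def)
    qed
    then show ?thesis using x[OF b] by (simp add: ptrace_opr_def)
  qed
  have "card (basis d (T - {j})) \<noteq> 0" using card_basis[of "T - {j}"] fin by (simp add: d_def)
  then show False using diag[of 0] diag[of 1] const[of 0] const[of 1] c by (simp add: pm_def)
qed

section \<open>The characterisation of signalling\<close>

theorem theorem5p5:
  fixes n :: nat and f :: "str \<Rightarrow> real" and i j :: nat
  assumes "type_fun n f"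
    and "i \<in> inputs n f"
    and "j \<in> outputs n f"
  shows "no_signalling n f i j \<longleftrightarrow> even (pair_rank n f i j)"
proof -
  obtain F where f: "\<And>W. f (ind_str n W) = (if F W then 1 else 0)" and F0: "F {}"
    and F_input: "\<And>i W. i \<in> {1..n} \<Longrightarrow> \<not> F {i} \<Longrightarrow> W \<subseteq> {1..n} \<Longrightarrow> F (insert i W) \<Longrightarrow> F W"
    and parity: "\<And>i j. i \<in> {1..n} \<Longrightarrow> j \<in> {1..n} \<Longrightarrow> \<not> F {i} \<Longrightarrow> F {j} \<Longrightarrow>
      even (pair_rank n f i j) \<longleftrightarrow> \<not> F {i, j}"
    by (rule type_fun_combinatorics[OF assms(1)], rule that)
  have inputs: "inputs n f = {i \<in> {1..n}. \<not> F {i}}" and outputs: "outputs n f = {i \<in> {1..n}. F {i}}"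
    unfolding inputs_def outputs_def unit_str_ind f by auto
  have ij: "i \<in> {1..n}" "\<not> F {i}" "j \<in> {1..n}" "F {j}" using assms(2,3) by (simp_all add: inputs outputs)
  have rank: "even (pair_rank n f i j) \<longleftrightarrow> \<not> F {i, j}" by (rule parity[OF ij(1,3,2,4)])
  have part: "inputs n f \<union> outputs n f = {1..n}" "inputs n f \<inter> outputs n f = {}"
    unfolding inputs outputs by auto
  have fin: "finite (inputs n f)" "finite (outputs n f)" by (simp_all add: inputs outputs)
  show ?thesis
  proof (cases "F {i, j}")
    case True
    then have "\<not> no_signalling n f i j"
      using signalling_of_pair[OF assms(2,3) part] f F0 by simp
    then show ?thesis using rank True by simp
  next
    case False
    \<comment> \<open>Inputs can be deleted from a support one at a time without making
      \<open>F\<close> false, since \<open>F\<close> is decreasing in them.\<close>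
    have shrink: "F W" if "finite U" "U \<subseteq> inputs n f" "W \<subseteq> {1..n}" "F (U \<union> W)" for U W
      using that
    proof (induction U arbitrary: W rule: finite_induct)
      case (insert a U)
      have "a \<in> {1..n}" "\<not> F {a}" using insert.prems(1) by (auto simp: inputs)
      moreover have "F (insert a W)"
        using insert.IH[of "insert a W"] insert.prems \<open>a \<in> {1..n}\<close> by simp
      ultimately show ?case using F_input insert.prems(2) by blast
    qed simp
    have zero: "s i = 0" if s: "s \<in> strings n" "f s = 1" "\<forall>k\<in>outputs n f - {j}. s k = 0" for s
    proof (rule ccontr)
      assume "s i \<noteq> 0"
      define W where "W = {k \<in> {1..n}. s k = 1}"
      have sW: "s = ind_str n W" unfolding W_def by (rule strings_eq_ind_str[OF s(1)])
      have FW: "F W" using s(2) f[of W] sW by (simp split: if_splits)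
      have "s i \<in> {0, 1}" using s(1) ij(1) unfolding strings_def by (rule PiE_mem)
      then have iW: "i \<in> W" using \<open>s i \<noteq> 0\<close> ij(1) by (simp add: W_def)
      have "k = j" if "k \<in> W" "k \<in> outputs n f" for k
        using s(3) that by (cases "k = j") (auto simp: W_def)
      then have sub: "W \<subseteq> inputs n f \<union> {j}" using part(1) by (auto simp: W_def)
      define U where "U = W - {i, j}"
      have U: "finite U" "U \<subseteq> inputs n f" using sub by (auto simp: U_def W_def)
      \<comment> \<open>Deleting the inputs other than \<open>i\<close> leaves \<open>{i, j}\<close>
        or \<open>{i}\<close>, and \<open>F\<close> is false on both.\<close>
      have "W = U \<union> (if j \<in> W then {i, j} else {i})" using iW by (auto simp: U_def)
      then have "F (if j \<in> W then {i, j} else {i})"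
        using shrink[OF U, of "if j \<in> W then {i, j} else {i}"] FW ij by simp
      then show False using False ij(2) by (simp split: if_splits)
    qed
    have "no_signalling n f i j"
      unfolding no_signalling_def
    proof (intro allI impI)
      fix d \<Phi>
      assume a: "(\<forall>k\<in>{1..n}. 2 \<le> d k) \<and> channel d (inputs n f) (outputs n f) \<Phi> \<and>
        choi d (inputs n f) (outputs n f) \<Phi> \<in> T1 n d f"
      then have d: "0 < d i" using ij(1) by fastforce
      have C: "choi d (inputs n f) (outputs n f) \<Phi> \<in> fun_space n d f" using a by (simp add: T1_def)
      \<comment> \<open>The inputs and \<open>j\<close> are kept and the other outputs are traced
        out, so the condition required of the strings is \<open>zero\<close>.\<close>
      have "identity_at d (inputs n f \<union> {j}) (outputs n f - {j}) i (choi d (inputs n f) (outputs n f) \<Phi>)"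
      proof (rule identity_at_fun_space[where d = d, OF _ _ _ d _ C])
        show "(inputs n f \<union> {j}) \<inter> (outputs n f - {j}) = {}" using part(2) by auto
        show "inputs n f \<union> {j} \<union> (outputs n f - {j}) = {1..n}" using part(1) assms(3) by auto
        show "i \<in> inputs n f \<union> {j}" using assms(2) by simp
      qed (use zero in blast)
      then show "no_signalling_channel d (inputs n f) (outputs n f) \<Phi> i j"
        using no_signalling_of_identity_at[where d = d, OF _ fin part(2) assms(2) d assms(3)] a by blast
    qed
    then show ?thesis using rank False by simp
  qed
qed

end
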